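(* Let $V$ be a complex vector space of dimension $N$, let $\{e_1,\ldots,e_N\}$ be a basis of $V$ and $\{e_1^*,\ldots,e_N^*\}$ the dual basis of $V^*$. Define $A=(a_{ij})_{1\leq i,j\leq N}\in\operatorname{Mat}_{N,N}(\Lambda(V\otimes V^* ))$ by $a_{ij}=e_i\otimes e_j^*\in V\otimes V^*\subset\Lambda(V\otimes V^* )$. Then the family $$\big\{\operatorname{imm}^{*\lambda}_{|\lambda|}A \;\big|\; \lambda \text{ is a self-conjugate partition whose first part is not greater than } N\big\}$$ forms a linear basis of the space $\Lambda(V\otimes V^* )^{GL(V)}$ of $GL(V)$-invariants in the exterior algebra $\Lambda(V\otimes V^* )$.
   Context: $GL(V)$ acts on $V\otimes V^*$ in the natural way and on the exterior algebra $\Lambda(V\otimes V^* )$ by the induced algebra automorphisms. $|\lambda|$ is the size of the partition $\lambda$; partitions of all sizes $n\geq 0$ are considered, including the empty partition, for which $\operatorname{imm}^{*\emptyset}_0A=1$ (empty product). Below, $\mathcal{A}=\Lambda(V\otimes V^* )$, $[N]=\{1,\ldots,N\}$, $i$ is the imaginary unit; for $X=(x_{ij})\in\operatorname{Mat}_{N,N}(\mathcal{A})$ and $I=(i_1,\ldots,i_n)\in[N]^n$, put $X_{II}=(x_{i_s i_t})_{1\leq s,t\leq n}$ (repetitions allowed). Definition of $\chi^{*\lambda}$. Let $\lambda$ be a self-conjugate partition of $n$ ($\lambda=\lambda'$), and let $r$ be its rank (the length of its main diagonal). Put $m(\lambda)=\frac12(n-r)$ (an integer) and $\mu=h(\lambda)=(\mu_1,\ldots,\mu_r)=(2\lambda_1-1,2\lambda_2-3,\ldots,2\lambda_r-(2r-1))$,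 the sequence of lengths of the diagonal hooks of $\lambda$; it is a partition of $n$ into distinct odd parts. For $\sigma\in\mathfrak{S}_n$ of cycle type $\mu$, write $\sigma=(i_{11}\ i_{12}\ \ldots\ i_{1\mu_1})(i_{21}\ \ldots\ i_{2\mu_2})\cdots(i_{r1}\ \ldots\ i_{r\mu_r})$ with cycles ordered by decreasing length, and let $f(\sigma)=1$ (resp. $-1$) if the number of inversions of the sequence $(i_{11},\ldots,i_{1\mu_1},i_{21},\ldots,i_{2\mu_2},\ldots,i_{r1},\ldots,i_{r\mu_r})$ is even (resp. odd); this is well defined since the $\mu_k$ are odd and distinct. Define $\chi^{*\lambda}:\mathfrak{S}_n\to\mathbb{C}$ by $$\chi^{*\lambda}(\sigma)=\begin{cases} f(\sigma)\, i^{m(\lambda)}\sqrt{\mu_1\cdots\mu_r}, & \text{if } \sigma \text{ has cycle type } \mu=h(\lambda),\\ 0,&\text{otherwise.}\end{cases}$$ For an $n\times n$ matrix $X=(x_{ij})$ over $\mathcal{A}$, the twisted immanant is $\operatorname{imm}^{*\lambda}X=\sum_{\sigma\in\mathfrak{S}_n}\chi^{*\lambda}(\sigma)\,x_{1\sigma(1)}\cdots x_{n\sigma(n)}$ (product in this order). For $A\in\operatorname{Mat}_{N,N}(\mathcal{A})$ and $n=|\lambda|$, put $\operatorname{imm}^{*\lambda}_n A=\frac{1}{n!}\sum_{I\in[N]^n}\operatorname{imm}^{*\lambda}A_{II}$. *)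

theory Defs
  imports
    Complex_Main
    "HOL-Library.Poly_Mapping"
    "HOL-Library.FuncSet"
    "HOL-Combinatorics.Cycles"
begin

section \<open>Complex vector spaces\<close>

class scaleC =
  fixes scaleC :: "complex \<Rightarrow> 'a \<Rightarrow> 'a"  (infixr \<open>*\<^sub>C\<close> 75)

class complex_vector = scaleC + ab_group_add +
  assumes scaleC_add_right: "a *\<^sub>C (x + y) = a *\<^sub>C x + a *\<^sub>C y"
    and scaleC_add_left: "(a + b) *\<^sub>C x = a *\<^sub>C x + b *\<^sub>C x"
    and scaleC_scaleC: "a *\<^sub>C b *\<^sub>C x = (a * b) *\<^sub>C x"
    and scaleC_one: "1 *\<^sub>C x = x"

class complex_algebra_1 = complex_vector + ring_1 +
  assumes mult_scaleC_left: "(a *\<^sub>C x) * y = a *\<^sub>C (x * y)"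
    and mult_scaleC_right: "x * (a *\<^sub>C y) = a *\<^sub>C (x * y)"

global_interpretation cvec: vector_space "scaleC :: complex \<Rightarrow> 'a \<Rightarrow> 'a :: complex_vector"
  by unfold_locales (auto simp: scaleC_add_right scaleC_add_left scaleC_scaleC scaleC_one)

abbreviation clinear :: "('a::complex_vector \<Rightarrow> 'b::complex_vector) \<Rightarrow> bool"
  where "clinear \<equiv> Vector_Spaces.linear scaleC scaleC"

lemma clinearI:
  assumes "\<And>x y. f (x + y) = f x + f y" "\<And>c x. f (c *\<^sub>C x) = c *\<^sub>C f x"
  shows "clinear f"
  using assms by unfold_locales auto

lemma clinearD:
  assumes "clinear f"
  shows "f (x + y) = f x + f y" "f (c *\<^sub>C x) = c *\<^sub>C f x" "f 0 = 0"
    "f (x - y) = f x - f y" "f (- x) = - f x" "f (sum h A) = (\<Sum>a\<in>A. f (h a))"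
proof -
  interpret Vector_Spaces.linear scaleC scaleC f by fact
  show "f (x + y) = f x + f y" "f (c *\<^sub>C x) = c *\<^sub>C f x" "f 0 = 0"
    "f (x - y) = f x - f y" "f (- x) = - f x" "f (sum h A) = (\<Sum>a\<in>A. f (h a))"
    by (simp_all add: add scale zero diff neg sum)
qed

instantiation complex :: complex_algebra_1
begin

definition scaleC_complex_def [simp]: "scaleC (a::complex) (x::complex) = a * x"

instance by standard (simp_all add: algebra_simps)

end

instantiation poly_mapping :: (type, complex_vector) complex_vector
begin

lift_definition scaleC_poly_mapping :: "complex \<Rightarrow> ('a \<Rightarrow>\<^sub>0 'b) \<Rightarrow> 'a \<Rightarrow>\<^sub>0 'b"
  is "\<lambda>c f k. c *\<^sub>C f k"
  by (erule rev_finite_subset) auto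

instance
  by standard (transfer; simp add: fun_eq_iff scaleC_add_right scaleC_add_left scaleC_scaleC scaleC_one)+

end

lemma equivp_reflp_eq: "equivp R \<Longrightarrow> x = y \<Longrightarrow> R x y"
  by (simp add: equivp_reflp)

lemma lookup_scaleC [simp]: "Poly_Mapping.lookup (c *\<^sub>C p) k = c *\<^sub>C Poly_Mapping.lookup p k"
  by transfer simp

lemma poly_mapping_sum_single:
  "(\<Sum>k\<in>Poly_Mapping.keys p. Poly_Mapping.single k (Poly_Mapping.lookup p k)) = p"
proof (rule poly_mapping_eqI)
  fix k
  show "Poly_Mapping.lookup (\<Sum>k\<in>Poly_Mapping.keys p. Poly_Mapping.single k (Poly_Mapping.lookup p k)) k
      = Poly_Mapping.lookup p k"
    by (cases "k \<in> Poly_Mapping.keys p")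
      (auto simp: lookup_sum lookup_single when_def in_keys_iff if_distrib sum.delta' cong: if_cong)
qed

text \<open>
  The type \<^typ>\<open>'a \<Rightarrow>\<^sub>0 complex\<close> is the vector space with basis
  \<^typ>\<open>'a\<close>; \<open>free_extend\<close> is the linear extension of a map given on that basis.
\<close>

definition free_extend :: "('a \<Rightarrow> 'b::complex_vector) \<Rightarrow> ('a \<Rightarrow>\<^sub>0 complex) \<Rightarrow> 'b"
  where "free_extend h p = (\<Sum>k\<in>Poly_Mapping.keys p. Poly_Mapping.lookup p k *\<^sub>C h k)"

lemma free_extend_superset:
  assumes "finite A" "Poly_Mapping.keys p \<subseteq> A"
  shows "free_extend h p = (\<Sum>k\<in>A. Poly_Mapping.lookup p k *\<^sub>C h k)"
  unfolding free_extend_def using assms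
  by (intro sum.mono_neutral_left) (auto simp: in_keys_iff)

lemma free_extend_linear: "clinear (free_extend h)"
proof (rule clinearI)
  fix p q :: "'a \<Rightarrow>\<^sub>0 complex"
  let ?A = "Poly_Mapping.keys p \<union> Poly_Mapping.keys q"
  have "Poly_Mapping.keys (p + q) \<subseteq> ?A" by (rule keys_add)
  then show "free_extend h (p + q) = free_extend h p + free_extend h q"
    by (simp add: free_extend_superset[of ?A] lookup_add scaleC_add_left sum.distrib)
next
  fix c and p :: "'a \<Rightarrow>\<^sub>0 complex"
  have "Poly_Mapping.keys (c *\<^sub>C p) \<subseteq> Poly_Mapping.keys p" by (auto simp: in_keys_iff)
  then show "free_extend h (c *\<^sub>C p) = c *\<^sub>C free_extend h p"
    by (simp add: free_extend_superset[of "Poly_Mapping.keys p"] cvec.scale_sum_right scaleC_scaleC)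
qed

lemma free_extend_single [simp]: "free_extend h (Poly_Mapping.single k c) = c *\<^sub>C h k"
  by (simp add: free_extend_superset[of "{k}"])


section \<open>Dual space\<close>

typedef (overloaded) 'a dual = "{f :: 'a::complex_vector \<Rightarrow> complex. clinear f}"
  morphisms dual_apply Dual
  by (rule exI[of _ "\<lambda>_. 0"]) (auto intro!: clinearI)

setup_lifting type_definition_dual

instantiation dual :: (complex_vector) complex_vector
begin

lift_definition zero_dual :: "'a dual" is "\<lambda>_. 0"
  by (rule clinearI) auto
lift_definition plus_dual :: "'a dual \<Rightarrow> 'a dual \<Rightarrow> 'a dual" is "\<lambda>f g x. f x + g x"
  by (rule clinearI) (auto simp: clinearD algebra_simps)
lift_definition minus_dual :: "'a dual \<Rightarrow> 'a dual \<Rightarrow> 'a dual" is "\<lambda>f g x. f x - g x"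
  by (rule clinearI) (auto simp: clinearD algebra_simps)
lift_definition uminus_dual :: "'a dual \<Rightarrow> 'a dual" is "\<lambda>f x. - f x"
  by (rule clinearI) (auto simp: clinearD algebra_simps)
lift_definition scaleC_dual :: "complex \<Rightarrow> 'a dual \<Rightarrow> 'a dual" is "\<lambda>c f x. c * f x"
  by (rule clinearI) (auto simp: clinearD algebra_simps)

instance by standard (transfer; simp add: fun_eq_iff algebra_simps)+

end


section \<open>Tensor product of two vector spaces\<close>

text \<open>
  The quotient of the vector space freely generated by all pairs by the bilinearity relations.
\<close>

inductive_set tensor_relators ::
    "('a::complex_vector \<times> 'b::complex_vector \<Rightarrow>\<^sub>0 complex) set"
  where
    add_left: "Poly_Mapping.single (v + v', w) 1 - Poly_Mapping.single (v, w) 1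
      - Poly_Mapping.single (v', w) 1 \<in> tensor_relators"
  | add_right: "Poly_Mapping.single (v, w + w') 1 - Poly_Mapping.single (v, w) 1
      - Poly_Mapping.single (v, w') 1 \<in> tensor_relators"
  | scale_left: "Poly_Mapping.single (c *\<^sub>C v, w) 1 - c *\<^sub>C Poly_Mapping.single (v, w) 1
      \<in> tensor_relators"
  | scale_right: "Poly_Mapping.single (v, c *\<^sub>C w) 1 - c *\<^sub>C Poly_Mapping.single (v, w) 1
      \<in> tensor_relators"

definition tensor_rel ::
    "('a::complex_vector \<times> 'b::complex_vector \<Rightarrow>\<^sub>0 complex) \<Rightarrow> ('a \<times> 'b \<Rightarrow>\<^sub>0 complex) \<Rightarrow> bool"
  where "tensor_rel p q \<longleftrightarrow> p - q \<in> cvec.span tensor_relators"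

lemma tensor_rel_equivp: "equivp tensor_rel"
proof (rule equivpI)
  show "reflp tensor_rel" by (rule reflpI) (simp add: tensor_rel_def cvec.span_zero)
  show "symp tensor_rel"
    by (rule sympI) (auto simp: tensor_rel_def dest: cvec.span_neg)
  show "transp tensor_rel"
    by (rule transpI) (auto simp: tensor_rel_def dest: cvec.span_add)
qed

quotient_type (overloaded) ('a, 'b) tensor =
  "('a::complex_vector \<times> 'b::complex_vector \<Rightarrow>\<^sub>0 complex)" / tensor_rel
  by (rule tensor_rel_equivp)

instantiation tensor :: (complex_vector, complex_vector) complex_vector
begin

lift_definition zero_tensor :: "('a, 'b) tensor" is 0 .
lift_definition plus_tensor :: "('a, 'b) tensor \<Rightarrow> ('a, 'b) tensor \<Rightarrow> ('a, 'b) tensor" is "(+)"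
  unfolding tensor_rel_def by (drule (1) cvec.span_add) (simp add: algebra_simps)
lift_definition minus_tensor :: "('a, 'b) tensor \<Rightarrow> ('a, 'b) tensor \<Rightarrow> ('a, 'b) tensor" is "(-)"
  unfolding tensor_rel_def by (drule (1) cvec.span_diff) (simp add: algebra_simps)
lift_definition uminus_tensor :: "('a, 'b) tensor \<Rightarrow> ('a, 'b) tensor" is uminus
  unfolding tensor_rel_def by (drule cvec.span_neg) simp
lift_definition scaleC_tensor :: "complex \<Rightarrow> ('a, 'b) tensor \<Rightarrow> ('a, 'b) tensor" is scaleC
  unfolding tensor_rel_def by (simp add: cvec.span_scale flip: cvec.scale_right_diff_distrib)

instance
  by standard (transfer; rule equivp_reflp_eq[OF tensor_rel_equivp];
      simp add: add.assoc add.commute scaleC_add_right scaleC_add_left scaleC_scaleC scaleC_one)+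

end

lift_definition tprod :: "'a::complex_vector \<Rightarrow> 'b::complex_vector \<Rightarrow> ('a, 'b) tensor"
    (infixr \<open>\<otimes>\<^sub>C\<close> 70)
  is "\<lambda>v w. Poly_Mapping.single (v, w) 1" .

lemma abs_tensor_linear: "clinear abs_tensor"
  by (rule clinearI) (simp_all add: plus_tensor.abs_eq scaleC_tensor.abs_eq)

lemma abs_tensor_span:
  assumes "p - q \<in> cvec.span tensor_relators"
  shows "abs_tensor p = abs_tensor q"
  using assms by (simp add: tensor.abs_eq_iff tensor_rel_def)

lemma tprod_add_left: "(v + v') \<otimes>\<^sub>C w = v \<otimes>\<^sub>C w + v' \<otimes>\<^sub>C w"
  unfolding tprod.abs_eq plus_tensor.abs_eq
  by (rule abs_tensor_span) (use cvec.span_base[OF tensor_relators.add_left] in \<open>simp add: diff_diff_eq\<close>)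

lemma tprod_add_right: "v \<otimes>\<^sub>C (w + w') = v \<otimes>\<^sub>C w + v \<otimes>\<^sub>C w'"
  unfolding tprod.abs_eq plus_tensor.abs_eq
  by (rule abs_tensor_span) (use cvec.span_base[OF tensor_relators.add_right] in \<open>simp add: diff_diff_eq\<close>)

lemma tprod_scale_left: "(c *\<^sub>C v) \<otimes>\<^sub>C w = c *\<^sub>C (v \<otimes>\<^sub>C w)"
  unfolding tprod.abs_eq scaleC_tensor.abs_eq
  by (rule abs_tensor_span) (intro cvec.span_base tensor_relators.scale_left)

lemma tprod_scale_right: "v \<otimes>\<^sub>C (c *\<^sub>C w) = c *\<^sub>C (v \<otimes>\<^sub>C w)"
  unfolding tprod.abs_eq scaleC_tensor.abs_eq
  by (rule abs_tensor_span) (intro cvec.span_base tensor_relators.scale_right)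

lemma tensor_eq_sum:
  "abs_tensor p = (\<Sum>(v, w)\<in>Poly_Mapping.keys p. Poly_Mapping.lookup p (v, w) *\<^sub>C (v \<otimes>\<^sub>C w))"
proof -
  have "abs_tensor p = abs_tensor (\<Sum>k\<in>Poly_Mapping.keys p. Poly_Mapping.single k (Poly_Mapping.lookup p k))"
    by (simp add: poly_mapping_sum_single)
  also have "\<dots> = (\<Sum>k\<in>Poly_Mapping.keys p. abs_tensor (Poly_Mapping.single k (Poly_Mapping.lookup p k)))"
    by (rule clinearD(6)[OF abs_tensor_linear])
  also have "\<dots> = (\<Sum>(v, w)\<in>Poly_Mapping.keys p. Poly_Mapping.lookup p (v, w) *\<^sub>C (v \<otimes>\<^sub>C w))"
  proof (rule sum.cong[OF refl])
    fix k :: "'a \<times> 'b"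
    let ?c = "Poly_Mapping.lookup p k"
    have "Poly_Mapping.single k ?c = ?c *\<^sub>C Poly_Mapping.single k (1::complex)"
      by (rule poly_mapping_eqI) (simp add: lookup_single when_def)
    then have "abs_tensor (Poly_Mapping.single k ?c) = ?c *\<^sub>C abs_tensor (Poly_Mapping.single k 1)"
      by (simp only: clinearD(2)[OF abs_tensor_linear])
    then show "abs_tensor (Poly_Mapping.single k ?c)
        = (case k of (v, w) \<Rightarrow> Poly_Mapping.lookup p (v, w) *\<^sub>C (v \<otimes>\<^sub>C w))"
      by (cases k) (simp add: tprod.abs_eq)
  qed
  finally show ?thesis .
qed

lemma tensor_universal:
  fixes B :: "'a::complex_vector \<Rightarrow> 'b::complex_vector \<Rightarrow> 'c::complex_vector"
  assumes "\<And>w. clinear (\<lambda>v. B v w)" and "\<And>v. clinear (B v)"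
  shows "\<exists>!T. clinear T \<and> (\<forall>v w. T (v \<otimes>\<^sub>C w) = B v w)"
proof (rule ex_ex1I)
  define h where "h = free_extend (\<lambda>(v, w). B v w)"
  have lin: "clinear h" unfolding h_def by (rule free_extend_linear)
  have zero: "h p = 0" if "p \<in> cvec.span tensor_relators" for p
    using that
  proof (induction rule: cvec.span_induct_alt)
    case base show ?case by (simp add: clinearD[OF lin])
  next
    case (step c x y)
    from step(1) have "h x = 0"
    proof cases
      case (add_left v v' w)
      then show ?thesis by (simp add: clinearD[OF lin]) (simp add: h_def scaleC_one clinearD[OF assms(1)])
    next
      case (add_right v w w')
      then show ?thesis by (simp add: clinearD[OF lin]) (simp add: h_def scaleC_one clinearD[OF assms(2)])
    next
      case (scale_left d v w)
      then show ?thesis by (simp add: clinearD[OF lin]) (simp add: h_def scaleC_one clinearD[OF assms(1)])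
    next
      case (scale_right v d w)
      then show ?thesis by (simp add: clinearD[OF lin]) (simp add: h_def scaleC_one clinearD[OF assms(2)])
    qed
    with step(2) show ?case by (simp add: clinearD[OF lin])
  qed
  define T where "T x = h (rep_tensor x)" for x
  have T: "T (abs_tensor p) = h p" for p
  proof -
    have "tensor_rel (rep_tensor (abs_tensor p)) p"
      by (rule Quotient3_rep_abs[OF Quotient3_tensor equivp_reflp[OF tensor_rel_equivp]])
    then show ?thesis
      using zero clinearD(4)[OF lin] by (fastforce simp: T_def tensor_rel_def)
  qed
  have "clinear T"
  proof (rule clinearI)
    fix x y show "T (x + y) = T x + T y"
      by (induct x; induct y) (simp add: plus_tensor.abs_eq T clinearD[OF lin])
  next
    fix c x show "T (c *\<^sub>C x) = c *\<^sub>C T x"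
      by (induct x) (simp add: scaleC_tensor.abs_eq T clinearD[OF lin])
  qed
  moreover have "T (v \<otimes>\<^sub>C w) = B v w" for v w
    by (simp add: tprod.abs_eq T) (simp add: h_def scaleC_one)
  ultimately show "\<exists>T. clinear T \<and> (\<forall>v w. T (v \<otimes>\<^sub>C w) = B v w)" by blast
next
  fix S T assume S: "clinear S \<and> (\<forall>v w. S (v \<otimes>\<^sub>C w) = B v w)"
    and T: "clinear T \<and> (\<forall>v w. T (v \<otimes>\<^sub>C w) = B v w)"
  show "S = T"
  proof
    fix x show "S x = T x"
      by (induct x) (use S T in \<open>simp add: tensor_eq_sum clinearD(2,6) case_prod_unfold\<close>)
  qed
qed

definition tensor_map :: "('a::complex_vector \<Rightarrow> 'a) \<Rightarrow> ('b::complex_vector \<Rightarrow> 'b)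
    \<Rightarrow> ('a, 'b) tensor \<Rightarrow> ('a, 'b) tensor"
  where "tensor_map f h = (THE T. clinear T \<and> (\<forall>v w. T (v \<otimes>\<^sub>C w) = f v \<otimes>\<^sub>C h w))"

lemma tensor_map:
  assumes "clinear f" "clinear h"
  shows "clinear (tensor_map f h)" "tensor_map f h (v \<otimes>\<^sub>C w) = f v \<otimes>\<^sub>C h w"
proof -
  have "\<exists>!T. clinear T \<and> (\<forall>v w. T (v \<otimes>\<^sub>C w) = f v \<otimes>\<^sub>C h w)"
    by (rule tensor_universal; rule clinearI)
      (simp_all add: clinearD[OF assms(1)] clinearD[OF assms(2)]
        tprod_add_left tprod_add_right tprod_scale_left tprod_scale_right)
  from theI'[OF this] show "clinear (tensor_map f h)" "tensor_map f h (v \<otimes>\<^sub>C w) = f v \<otimes>\<^sub>C h w"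
    unfolding tensor_map_def by blast+
qed


section \<open>Exterior algebra of a vector space\<close>

text \<open>
  \<^term>\<open>ext_relators\<close> consists of the relations defining the exterior algebra of \<open>W\<close> as a quotient
  of the free associative unital algebra on the underlying set of \<open>W\<close>: the first two kinds
  impose linearity (their quotient is the tensor algebra of \<open>W\<close>), the third \<open>w \<and> w = 0\<close>.
  The free algebra is the monoid algebra of the monoid of words in \<open>W\<close>.
\<close>

datatype 'a fword = Word (letters: "'a list")

instantiation fword :: (type) monoid_add
begin

definition zero_fword :: "'a fword" where "0 = Word []"
definition plus_fword :: "'a fword \<Rightarrow> 'a fword \<Rightarrow> 'a fword"
  where "u + v = Word (letters u @ letters v)"

instance by standard (simp_all add: zero_fword_def plus_fword_def)

end

type_synonym 'a free_algebra = "'a fword \<Rightarrow>\<^sub>0 complex"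

definition letter :: "'a \<Rightarrow> 'a free_algebra"
  where "letter w = Poly_Mapping.single (Word [w]) 1"

inductive_set ext_relators :: "('a::complex_vector) free_algebra set"
  where
    add: "letter (v + w) - letter v - letter w \<in> ext_relators"
  | scale: "letter (c *\<^sub>C w) - c *\<^sub>C letter w \<in> ext_relators"
  | square: "letter w * letter w \<in> ext_relators"

text \<open>The two-sided ideal generated by the relators.\<close>

definition ext_ideal :: "('a::complex_vector) free_algebra set"
  where "ext_ideal = cvec.span {a * r * b | a r b. r \<in> ext_relators}"

definition ext_rel :: "('a::complex_vector) free_algebra \<Rightarrow> 'a free_algebra \<Rightarrow> bool"
  where "ext_rel p q \<longleftrightarrow> p - q \<in> ext_ideal"

instance poly_mapping :: (monoid_add, complex_algebra_1) complex_algebra_1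
proof
  fix c and p q :: "'a \<Rightarrow>\<^sub>0 'b"
  let ?c = "Poly_Mapping.single 0 (c *\<^sub>C 1) :: 'a \<Rightarrow>\<^sub>0 'b"
  have left: "c *\<^sub>C r = ?c * r" for r
  proof -
    have "c *\<^sub>C r = Poly_Mapping.map ((*) (c *\<^sub>C 1)) r"
      by (rule poly_mapping_eqI) (simp add: Poly_Mapping.map.rep_eq when_def mult_scaleC_left)
    also have "\<dots> = ?c * r" by (rule mult_map_scale_conv_mult)
    finally show ?thesis .
  qed
  have single: "Poly_Mapping.single k a * ?c = ?c * Poly_Mapping.single k a" for k a
    by (simp add: mult_single mult_scaleC_left mult_scaleC_right)
  let ?p = "\<Sum>k\<in>Poly_Mapping.keys p. Poly_Mapping.single k (Poly_Mapping.lookup p k)"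
  have "?p * ?c = ?c * ?p"
    unfolding sum_distrib_left sum_distrib_right by (rule sum.cong[OF refl single])
  then have comm: "p * ?c = ?c * p" by (simp only: poly_mapping_sum_single)
  show "(c *\<^sub>C p) * q = c *\<^sub>C (p * q)" unfolding left by (rule mult.assoc)
  show "p * (c *\<^sub>C q) = c *\<^sub>C (p * q)"
    unfolding left mult.assoc[symmetric] comm ..
qed

lemma ext_ideal_add: "p \<in> ext_ideal \<Longrightarrow> q \<in> ext_ideal \<Longrightarrow> p + q \<in> ext_ideal"
  and ext_ideal_diff: "p \<in> ext_ideal \<Longrightarrow> q \<in> ext_ideal \<Longrightarrow> p - q \<in> ext_ideal"
  and ext_ideal_neg: "p \<in> ext_ideal \<Longrightarrow> - p \<in> ext_ideal"
  and ext_ideal_scale: "p \<in> ext_ideal \<Longrightarrow> c *\<^sub>C p \<in> ext_ideal"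
  and ext_ideal_zero: "0 \<in> ext_ideal"
  by (simp_all add: ext_ideal_def cvec.span_add cvec.span_diff cvec.span_neg cvec.span_scale
      cvec.span_zero)

lemma ext_ideal_base:
  assumes "r \<in> ext_relators" shows "r \<in> ext_ideal"
proof -
  have "1 * r * 1 \<in> ext_ideal"
    unfolding ext_ideal_def using assms by (intro cvec.span_base) blast
  then show ?thesis by simp
qed

lemma ext_ideal_mult:
  assumes "p \<in> ext_ideal"
  shows "a * p * b \<in> ext_ideal"
  using assms unfolding ext_ideal_def
proof (induction rule: cvec.span_induct_alt)
  case base show ?case by (simp add: cvec.span_zero)
next
  case (step c x y)
  then obtain a' r b' where x: "x = a' * r * b'" "r \<in> ext_relators" by blast
  have "a * x * b = (a * a') * r * (b' * b)" by (simp add: x mult.assoc)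
  then have "a * x * b \<in> cvec.span {a * r * b | a r b. r \<in> ext_relators}"
    using x(2) by (intro cvec.span_base) blast
  then show ?case using step(2)
    by (simp add: distrib_left distrib_right mult_scaleC_left mult_scaleC_right
        cvec.span_add cvec.span_scale)
qed

lemma ext_rel_equivp: "equivp ext_rel"
proof (rule equivpI)
  show "reflp ext_rel" by (rule reflpI) (simp add: ext_rel_def ext_ideal_zero)
  show "symp ext_rel"
    by (rule sympI) (auto simp: ext_rel_def dest: ext_ideal_neg)
  show "transp ext_rel"
    by (rule transpI) (auto simp: ext_rel_def dest: ext_ideal_add)
qed

definition word_eval :: "('a \<Rightarrow> 'b::complex_algebra_1) \<Rightarrow> 'a free_algebra \<Rightarrow> 'b"
  where "word_eval \<phi> = free_extend (\<lambda>u. prod_list (map \<phi> (letters u)))"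

lemma word_eval_linear: "clinear (word_eval \<phi>)"
  unfolding word_eval_def by (rule free_extend_linear)

lemma word_eval_one: "word_eval \<phi> 1 = 1"
  by (simp add: word_eval_def zero_fword_def scaleC_one flip: single_one)

lemma word_eval_letter: "word_eval \<phi> (letter w) = \<phi> w"
  by (simp add: word_eval_def letter_def scaleC_one)

lemma word_eval_mult:
  fixes p q :: "'a free_algebra"
  shows "word_eval \<phi> (p * q) = word_eval \<phi> p * word_eval \<phi> q"
proof -
  let ?s = "\<lambda>p::'a free_algebra. \<Sum>k\<in>Poly_Mapping.keys p. Poly_Mapping.single k (Poly_Mapping.lookup p k)"
  have single: "word_eval \<phi> (Poly_Mapping.single u a * Poly_Mapping.single v b)
      = word_eval \<phi> (Poly_Mapping.single u a) * word_eval \<phi> (Poly_Mapping.single v b)" for u v a b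
    by (simp add: word_eval_def mult_single plus_fword_def mult_scaleC_left mult_scaleC_right
        scaleC_scaleC)
  have "word_eval \<phi> (?s p * ?s q) = word_eval \<phi> (?s p) * word_eval \<phi> (?s q)"
    by (simp only: sum_product clinearD(6)[OF word_eval_linear] single)
  then show ?thesis by (simp only: poly_mapping_sum_single)
qed

lemma word_eval_ideal:
  assumes "clinear \<phi>" "\<And>w. \<phi> w * \<phi> w = 0" "p \<in> ext_ideal"
  shows "word_eval \<phi> p = 0"
  using assms(3) unfolding ext_ideal_def
proof (induction rule: cvec.span_induct_alt)
  case base show ?case by (rule clinearD[OF word_eval_linear])
next
  case (step c x y)
  then obtain a r b where x: "x = a * r * b" "r \<in> ext_relators" by blast
  from x(2) have "word_eval \<phi> r = 0"
    by cases (simp_all add: clinearD[OF word_eval_linear] word_eval_mult word_eval_letter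
        clinearD[OF assms(1)] assms(2))
  then show ?case using step(2)
    by (simp add: x clinearD[OF word_eval_linear] word_eval_mult)
qed

quotient_type (overloaded) 'a exterior = "('a::complex_vector) free_algebra" / ext_rel
  by (rule ext_rel_equivp)

instantiation exterior :: (complex_vector) complex_algebra_1
begin

lift_definition zero_exterior :: "'a exterior" is 0 .
lift_definition one_exterior :: "'a exterior" is 1 .
lift_definition plus_exterior :: "'a exterior \<Rightarrow> 'a exterior \<Rightarrow> 'a exterior" is "(+)"
  unfolding ext_rel_def by (drule (1) ext_ideal_add) (simp add: algebra_simps)
lift_definition minus_exterior :: "'a exterior \<Rightarrow> 'a exterior \<Rightarrow> 'a exterior" is "(-)"
  unfolding ext_rel_def by (drule (1) ext_ideal_diff) (simp add: algebra_simps)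
lift_definition uminus_exterior :: "'a exterior \<Rightarrow> 'a exterior" is uminus
  unfolding ext_rel_def by (drule ext_ideal_neg) simp
lift_definition scaleC_exterior :: "complex \<Rightarrow> 'a exterior \<Rightarrow> 'a exterior" is scaleC
  unfolding ext_rel_def by (simp add: ext_ideal_scale flip: cvec.scale_right_diff_distrib)
lift_definition times_exterior :: "'a exterior \<Rightarrow> 'a exterior \<Rightarrow> 'a exterior" is "(*)"
proof -
  fix p p' q q' :: "'a free_algebra"
  assume "ext_rel p p'" "ext_rel q q'"
  then have "1 * (p - p') * q + p' * (q - q') * 1 \<in> ext_ideal"
    unfolding ext_rel_def by (intro ext_ideal_add ext_ideal_mult)
  then show "ext_rel (p * q) (p' * q')"
    by (simp add: ext_rel_def algebra_simps)
qed

instance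
proof
  show "(0::'a exterior) \<noteq> 1"
  proof (transfer, rule notI)
    assume "ext_rel (0::'a free_algebra) 1"
    then have "0 - 1 \<in> (ext_ideal :: 'a free_algebra set)" by (simp only: ext_rel_def)
    moreover have "clinear (\<lambda>_::'a. 0::complex)" by (rule clinearI) simp_all
    ultimately have "word_eval (\<lambda>_. 0::complex) (0 - 1 :: 'a free_algebra) = 0"
      by (intro word_eval_ideal) simp_all
    then show False
      by (simp only: clinearD[OF word_eval_linear] word_eval_one) simp
  qed
qed (transfer; rule equivp_reflp_eq[OF ext_rel_equivp];
    simp add: add.assoc add.commute mult.assoc distrib_left distrib_right
      mult_scaleC_left mult_scaleC_right
      scaleC_add_right scaleC_add_left scaleC_scaleC scaleC_one)+

end

lift_definition ext_inj :: "'a::complex_vector \<Rightarrow> 'a exterior" is letter .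

lemma abs_exterior_linear: "clinear abs_exterior"
  by (rule clinearI) (simp_all add: plus_exterior.abs_eq scaleC_exterior.abs_eq)

lemma ext_inj_linear: "clinear ext_inj"
proof (rule clinearI)
  fix x y :: 'a
  show "ext_inj (x + y) = ext_inj x + ext_inj y"
    by transfer (use ext_ideal_base[OF ext_relators.add] in \<open>simp add: ext_rel_def diff_diff_eq\<close>)
next
  fix c and x :: 'a
  show "ext_inj (c *\<^sub>C x) = c *\<^sub>C ext_inj x"
    by transfer (simp add: ext_rel_def ext_ideal_base ext_relators.scale)
qed

lemma ext_inj_square: "ext_inj w * ext_inj w = 0"
  by transfer (simp add: ext_rel_def ext_ideal_base ext_relators.square)

definition alg_hom :: "('a::complex_algebra_1 \<Rightarrow> 'b::complex_algebra_1) \<Rightarrow> bool"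
  where "alg_hom F \<longleftrightarrow> clinear F \<and> F 1 = 1 \<and> (\<forall>x y. F (x * y) = F x * F y)"

lemma abs_exterior_eval: "abs_exterior p = word_eval ext_inj p"
proof -
  have word: "abs_exterior (Poly_Mapping.single (Word ws) 1) = prod_list (map ext_inj ws)" for ws :: "'a list"
  proof (induction ws)
    case Nil
    show ?case by (simp add: one_exterior.abs_eq flip: single_one zero_fword_def)
  next
    case (Cons w ws)
    have "Poly_Mapping.single (Word (w # ws)) (1::complex) = letter w * Poly_Mapping.single (Word ws) 1"
      by (simp add: letter_def mult_single plus_fword_def)
    then show ?case using Cons
      by (simp add: ext_inj.abs_eq flip: times_exterior.abs_eq)
  qed
  have single: "abs_exterior (Poly_Mapping.single u c) = word_eval ext_inj (Poly_Mapping.single u c)"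
    for u :: "'a fword" and c
  proof -
    have "Poly_Mapping.single u c = c *\<^sub>C Poly_Mapping.single u (1::complex)"
      by (rule poly_mapping_eqI) (simp add: lookup_single when_def)
    then have "abs_exterior (Poly_Mapping.single u c) = c *\<^sub>C abs_exterior (Poly_Mapping.single u 1)"
      by (simp only: clinearD(2)[OF abs_exterior_linear])
    then show ?thesis by (cases u) (simp add: word word_eval_def)
  qed
  have "abs_exterior (\<Sum>k\<in>Poly_Mapping.keys p. Poly_Mapping.single k (Poly_Mapping.lookup p k))
      = word_eval ext_inj (\<Sum>k\<in>Poly_Mapping.keys p. Poly_Mapping.single k (Poly_Mapping.lookup p k))"
    by (simp only: clinearD(6)[OF abs_exterior_linear] clinearD(6)[OF word_eval_linear] single)
  then show ?thesis by (simp only: poly_mapping_sum_single)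
qed

lemma ext_universal:
  fixes \<phi> :: "'a::complex_vector \<Rightarrow> 'b::complex_algebra_1"
  assumes "clinear \<phi>" "\<And>w. \<phi> w * \<phi> w = 0"
  shows "\<exists>!F. alg_hom F \<and> (\<forall>w. F (ext_inj w) = \<phi> w)"
proof (rule ex_ex1I)
  define F where "F x = word_eval \<phi> (rep_exterior x)" for x
  have F: "F (abs_exterior p) = word_eval \<phi> p" for p
  proof -
    have "ext_rel (rep_exterior (abs_exterior p)) p"
      by (rule Quotient3_rep_abs[OF Quotient3_exterior equivp_reflp[OF ext_rel_equivp]])
    then show ?thesis
      using word_eval_ideal[OF assms] clinearD(4)[OF word_eval_linear, of \<phi>]
      by (fastforce simp: F_def ext_rel_def)
  qed
  have "clinear F"
  proof (rule clinearI)
    fix x y show "F (x + y) = F x + F y"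
      by (induct x; induct y) (simp add: plus_exterior.abs_eq F clinearD[OF word_eval_linear])
  next
    fix c x show "F (c *\<^sub>C x) = c *\<^sub>C F x"
      by (induct x) (simp add: scaleC_exterior.abs_eq F clinearD[OF word_eval_linear])
  qed
  moreover have "F 1 = 1" by (simp add: one_exterior.abs_eq F word_eval_one)
  moreover have "F (x * y) = F x * F y" for x y
    by (induct x; induct y) (simp add: times_exterior.abs_eq F word_eval_mult)
  moreover have "F (ext_inj w) = \<phi> w" for w
    by (simp add: ext_inj.abs_eq F word_eval_letter)
  ultimately show "\<exists>F. alg_hom F \<and> (\<forall>w. F (ext_inj w) = \<phi> w)"
    unfolding alg_hom_def by blast
next
  have *: "H (abs_exterior p) = word_eval \<phi> p" if "alg_hom H" "\<forall>w. H (ext_inj w) = \<phi> w" for H p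
  proof -
    have H: "clinear H" using that(1) by (simp add: alg_hom_def)
    have list: "H (prod_list (map ext_inj ws)) = prod_list (map \<phi> ws)" for ws
      by (induction ws) (use that in \<open>simp_all add: alg_hom_def\<close>)
    show ?thesis
      by (simp add: abs_exterior_eval word_eval_def free_extend_def clinearD(2,6)[OF H] list)
  qed
  fix F G assume "alg_hom F \<and> (\<forall>w. F (ext_inj w) = \<phi> w)" "alg_hom G \<and> (\<forall>w. G (ext_inj w) = \<phi> w)"
  then have eq: "F (abs_exterior p) = G (abs_exterior p)" for p using *[of F] *[of G] by simp
  show "F = G"
  proof
    fix x show "F x = G x" by (induct x) (rule eq)
  qed
qed

text \<open>The algebra endomorphism of the exterior algebra induced by a linear endomorphism.\<close>

definition ext_map :: "('a::complex_vector \<Rightarrow> 'a) \<Rightarrow> 'a exterior \<Rightarrow> 'a exterior"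
  where "ext_map f = (THE F. alg_hom F \<and> (\<forall>w. F (ext_inj w) = ext_inj (f w)))"

lemma ext_map:
  assumes "clinear f"
  shows "alg_hom (ext_map f)" "ext_map f (ext_inj w) = ext_inj (f w)"
proof -
  have "\<exists>!F. alg_hom F \<and> (\<forall>w. F (ext_inj w) = ext_inj (f w))"
    by (rule ext_universal)
      (auto intro!: clinearI simp: ext_inj_square clinearD[OF assms] clinearD[OF ext_inj_linear])
  from theI'[OF this] show "alg_hom (ext_map f)" "ext_map f (ext_inj w) = ext_inj (f w)"
    unfolding ext_map_def by blast+
qed


section \<open>The action of the general linear group\<close>

definition GL :: "('v::complex_vector \<Rightarrow> 'v) set"
  where "GL = {g. clinear g \<and> bij g}"

definition dual_act :: "('v::complex_vector \<Rightarrow> 'v) \<Rightarrow> 'v dual \<Rightarrow> 'v dual"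
  where "dual_act g f = Dual (dual_apply f \<circ> inv g)"

lemma GL_inv:
  assumes "g \<in> GL" shows "clinear (inv g)"
proof -
  have g: "g (inv g x) = x" "inv g (g x) = x" for x
    using assms by (auto simp: GL_def bij_is_surj surj_f_inv_f bij_is_inj)
  have lin: "clinear g" using assms by (simp add: GL_def)
  show ?thesis
  proof (rule clinearI)
    fix x y
    have "g (inv g x + inv g y) = x + y" by (simp only: clinearD(1)[OF lin] g)
    then show "inv g (x + y) = inv g x + inv g y" by (metis g(2))
  next
    fix c x
    have "g (c *\<^sub>C inv g x) = c *\<^sub>C x" by (simp only: clinearD(2)[OF lin] g)
    then show "inv g (c *\<^sub>C x) = c *\<^sub>C inv g x" by (metis g(2))
  qed
qed

lemma dual_apply_dual_act:
  assumes "g \<in> GL" shows "dual_apply (dual_act g f) x = dual_apply f (inv g x)"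
proof -
  have "clinear (dual_apply f)" using dual_apply[of f] by simp
  then have "clinear (dual_apply f \<circ> inv g)"
    using GL_inv[OF assms] by (intro clinearI) (simp_all add: clinearD)
  then show ?thesis by (simp add: dual_act_def Dual_inverse)
qed

lemma dual_act_linear:
  assumes "g \<in> GL" shows "clinear (dual_act g)"
  by (rule clinearI; rule dual_apply_inject[THEN iffD1]; rule ext)
    (simp_all add: dual_apply_dual_act[OF assms] plus_dual.rep_eq scaleC_dual.rep_eq)

definition GL_act :: "('v::complex_vector \<Rightarrow> 'v) \<Rightarrow> ('v, 'v dual) tensor exterior
    \<Rightarrow> ('v, 'v dual) tensor exterior"
  where "GL_act g = ext_map (tensor_map g (dual_act g))"

lemma GL_act:
  assumes "g \<in> GL"
  shows "alg_hom (GL_act g)"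
    "GL_act g (ext_inj (v \<otimes>\<^sub>C f)) = ext_inj (g v \<otimes>\<^sub>C dual_act g f)"
proof -
  have "clinear g" using assms by (simp add: GL_def)
  note T = tensor_map[OF this dual_act_linear[OF assms]]
  show "alg_hom (GL_act g)" "GL_act g (ext_inj (v \<otimes>\<^sub>C f)) = ext_inj (g v \<otimes>\<^sub>C dual_act g f)"
    unfolding GL_act_def using ext_map[OF T(1)] by (simp_all add: T(2))
qed

definition GL_invariants :: "('v::complex_vector, 'v dual) tensor exterior set"
  where "GL_invariants = {x. \<forall>g\<in>GL. GL_act g x = x}"


section \<open>Self-conjugate partitions\<close>

text \<open>
  A partition is the list of its parts in weakly decreasing order; \<^term>\<open>[]\<close> is the partition
  of \<open>0\<close>, whose first part is taken to be \<open>0\<close>. The part \<open>\<lambda>\<^sub>k\<close> is \<open>lam ! (k - 1)\<close>.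
\<close>

definition is_partition :: "nat list \<Rightarrow> bool"
  where "is_partition lam \<longleftrightarrow> sorted_wrt (\<ge>) lam \<and> 0 \<notin> set lam"

definition first_part :: "nat list \<Rightarrow> nat"
  where "first_part lam = (case lam of [] \<Rightarrow> 0 | a # _ \<Rightarrow> a)"

definition conjugate :: "nat list \<Rightarrow> nat list"
  where "conjugate lam = map (\<lambda>j. length (filter (\<lambda>a. j \<le> a) lam)) [1..<Suc (first_part lam)]"

definition self_conjugate :: "nat list \<Rightarrow> bool"
  where "self_conjugate lam \<longleftrightarrow> is_partition lam \<and> conjugate lam = lam"

definition diag_rank :: "nat list \<Rightarrow> nat"
  where "diag_rank lam = card {k. k < length lam \<and> k < lam ! k}"

text \<open>Shifting the index by one, \<open>2\<lambda>\<^sub>k - (2k - 1)\<close> becomes \<open>2 * lam ! k - (2 * k + 1)\<close>.\<close>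

definition diag_hooks :: "nat list \<Rightarrow> nat list"
  where "diag_hooks lam = map (\<lambda>k. 2 * lam ! k - (2 * k + 1)) [0..<diag_rank lam]"


section \<open>Twisted immanants\<close>

text \<open>
  \<open>cs\<close> lists the cycles, of lengths \<open>mu\<close> in this order and with fixed points included,
  of the permutation \<open>\<sigma>\<close> of \<open>{1..n}\<close>.
\<close>

definition cycle_notation :: "nat \<Rightarrow> nat list \<Rightarrow> (nat \<Rightarrow> nat) \<Rightarrow> nat list list \<Rightarrow> bool"
  where "cycle_notation n mu \<sigma> cs \<longleftrightarrow>
    map length cs = mu \<and> distinct (concat cs) \<and> set (concat cs) = {1..n}
    \<and> \<sigma> = foldr (\<circ>) (map cycle_of_list cs) id"

definition inversions :: "nat list \<Rightarrow> nat"
  where "inversions xs = card {(s, t). s < t \<and> t < length xs \<and> xs ! t < xs ! s}"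

text \<open>
  When the entries of \<open>mu\<close> are odd and distinct, as for \<open>mu = diag_hooks lam\<close>, the parity below
  does not depend on the chosen cycle notation.
\<close>

definition cycle_sign :: "nat \<Rightarrow> nat list \<Rightarrow> (nat \<Rightarrow> nat) \<Rightarrow> complex"
  where "cycle_sign n mu \<sigma> =
    (if even (inversions (concat (SOME cs. cycle_notation n mu \<sigma> cs))) then 1 else -1)"

definition twisted_char :: "nat list \<Rightarrow> (nat \<Rightarrow> nat) \<Rightarrow> complex"
  where "twisted_char lam \<sigma> =
    (let n = sum_list lam; mu = diag_hooks lam; m = (n - diag_rank lam) div 2 in
     if \<exists>cs. cycle_notation n mu \<sigma> cs
     then cycle_sign n mu \<sigma> * \<i> ^ m * complex_of_real (sqrt (real (prod_list mu)))
     else 0)"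

text \<open>Matrices are functions of two indices, starting from \<open>1\<close>.\<close>

definition twisted_imm :: "nat list \<Rightarrow> (nat \<Rightarrow> nat \<Rightarrow> 'a::complex_algebra_1) \<Rightarrow> 'a"
  where "twisted_imm lam X =
    (let n = sum_list lam in
     \<Sum>\<sigma> | \<sigma> permutes {1..n}.
       twisted_char lam \<sigma> *\<^sub>C prod_list (map (\<lambda>s. X s (\<sigma> s)) [1..<Suc n]))"

definition twisted_imm_sum :: "nat \<Rightarrow> nat list \<Rightarrow> (nat \<Rightarrow> nat \<Rightarrow> 'a::complex_algebra_1) \<Rightarrow> 'a"
  where "twisted_imm_sum N lam A =
    (let n = sum_list lam in
     (1 / fact n) *\<^sub>C (\<Sum>I \<in> {1..n} \<rightarrow>\<^sub>E {1..N}. twisted_imm lam (\<lambda>s t. A (I s) (I t))))"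

end

theory Submission
  imports Defs "HOL-Library.More_List" "HOL-Computational_Algebra.Polynomial"
begin

text \<open>
  Summing over \<open>I\<close> and sorting the anticommuting factors along the cycles of \<open>\<sigma>\<close> turns
  \<open>\<Sum>\<^sub>I \<Prod>\<^sub>s a(I s, I(\<sigma> s))\<close> into a product of traces \<open>tr A\<^sup>k\<close>, one per cycle, with precisely the sign
  that occurs in the twisted character. Hence the twisted immanant of \<open>\<lambda>\<close> is a nonzero multiple of
  \<open>\<Prod>\<^sub>k tr A\<^bsup>\<mu>\<^sub>k\<^esup>\<close> with \<open>\<mu> = h(\<lambda>)\<close>, and \<open>h\<close> is a bijection onto the strictly decreasing lists of odd
  numbers below \<open>2N\<close>.

  The invariants are spanned by products of traces by the first fundamental theorem: the coefficients
  of an invariant commute with all \<open>g \<otimes> \<dots> \<otimes> g\<close>, hence by polarization with all symmetric operators, so they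
  are a combination of permutations. As \<open>tr A\<^sup>k\<close> vanishes for even \<open>k > 0\<close> and for odd \<open>k > 2N\<close>
  (Amitsur-Levitzki), and odd traces anticommute, the products with distinct odd exponents below
  \<open>2N\<close> suffice. The volume form \<open>\<Prod> a\<^sub>i\<^sub>j\<close> is itself invariant of degree \<open>N\<^sup>2 = 1 + 3 + \<dots> + (2N - 1)\<close>;
  being in the span, it forces the product of all these traces to be nonzero. Multiplying
  a linear relation by a complementary product then shows linear independence.
\<close>

section \<open>Self-conjugate partitions and their diagonal hooks\<close>

text \<open>The exterior algebra is given as a quotient by relations, without a basis of monomials.
  Coefficients are therefore read off by determinants of linear functionals, which descend to the
  quotient; these also show that products are nonzero. The commutant theorem is proved without
  representation theory: the component of an operator orthogonal to all permutation operators has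
  norm zero, by positivity of the Hermitian form. Invariance only gives commutation with powers of
  invertible matrices, whereas polarization uses singular ones. Since M + c I is invertible for all
  large c and the condition is polynomial in c, it extends to every M. The sum over I is evaluated
  for positions carrying powers of A, not just A itself (\<open>sum_prod_of_cycles\<close>). The
  same formula then serves the twisted immanants, where all exponents are 1, and Rosset's argument,
  where all but one are 2. Invariance of the volume form needs det g det (inverse of g) = 1, which
  is read off from products in the algebra itself.\<close>

lemma downward_closed_eq_lessThan:
  fixes A :: "nat set"
  assumes "finite A" "\<And>x y. x \<in> A \<Longrightarrow> y < x \<Longrightarrow> y \<in> A"
  shows "A = {..<card A}"
proof -
  obtain m where m: "m \<notin> A" using assms(1) ex_new_if_finite infinite_UNIV_nat by blast
  define l where "l = (LEAST m. m \<notin> A)"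
  have "l \<notin> A" unfolding l_def by (rule LeastI[of _ m]) (rule m)
  moreover have "x \<in> A" if "x < l" for x using not_less_Least that unfolding l_def by blast
  ultimately have "A = {..<l}" using assms(2) by (metis lessThan_iff linorder_neqE_nat subsetI subset_antisym)
  then show ?thesis by simp
qed

lemma self_conjugate_length: "self_conjugate lam \<Longrightarrow> length lam = first_part lam"
  unfolding self_conjugate_def conjugate_def
  by (metis add_diff_cancel_left' length_map length_upt plus_1_eq_Suc)

text \<open>Padding with zeros makes the parts a function on all natural numbers, so that the
  symmetry of the diagram and its rank can be stated without conditions on the length.\<close>

lemma nth_default_antimono:
  assumes "is_partition lam" "i \<le> j"
  shows "nth_default 0 lam j \<le> nth_default 0 lam i"
  using assms sorted_wrt_nth_less[of "(\<ge>)" lam i j]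
  by (cases "i = j") (auto simp: is_partition_def nth_default_def)

lemma nth_default_le_first_part:
  assumes "is_partition lam"
  shows "nth_default 0 lam i \<le> first_part lam"
  using nth_default_antimono[OF assms, of 0 i]
  by (cases lam) (auto simp: first_part_def)

text \<open>The rows reaching beyond column j form an initial segment, so their number, which is
  \<open>lam ! j\<close> by self-conjugacy, determines which rows they are. Positions outside the
  diagram are handled by the zero padding.\<close>

lemma self_conjugate_sym:
  assumes "self_conjugate lam"
  shows "i < nth_default 0 lam j \<longleftrightarrow> j < nth_default 0 lam i"
proof -
  have p: "is_partition lam" and len: "length lam = first_part lam"
    using assms self_conjugate_length by (auto simp: self_conjugate_def)
  show ?thesis
  proof (cases "j < length lam")
    case True
    have "lam ! j = conjugate lam ! j" using assms by (simp add: self_conjugate_def)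
    also have "\<dots> = length (filter (\<lambda>a. j < a) lam)"
      using True len by (simp add: conjugate_def Suc_le_eq[abs_def] del: upt_Suc)
    also have "\<dots> = card {i. i < length lam \<and> j < lam ! i}"
      by (simp add: length_filter_conv_card)
    finally have card: "lam ! j = card {i. i < length lam \<and> j < lam ! i}" .
    have "{i. i < length lam \<and> j < lam ! i} = {..<card {i. i < length lam \<and> j < lam ! i}}"
    proof (rule downward_closed_eq_lessThan)
      fix x y assume "x \<in> {i. i < length lam \<and> j < lam ! i}" "y < x"
      then show "y \<in> {i. i < length lam \<and> j < lam ! i}"
        using nth_default_antimono[OF p, of y x] by (auto simp: nth_default_def)
    qed simp
    then have "{i. i < length lam \<and> j < lam ! i} = {..<lam ! j}" by (simp only: card)
    then have "i < lam ! j \<longleftrightarrow> i < length lam \<and> j < lam ! i" by (simp add: set_eq_iff)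
    then show ?thesis using True by (simp add: nth_default_def)
  next
    case False
    then show ?thesis using nth_default_le_first_part[OF p, of i] len
      by (auto simp: nth_default_def)
  qed
qed

lemma less_diag_rank_iff:
  assumes "is_partition lam"
  shows "k < diag_rank lam \<longleftrightarrow> k < nth_default 0 lam k"
proof -
  have "{k. k < length lam \<and> k < lam ! k} = {..<diag_rank lam}"
    unfolding diag_rank_def
  proof (rule downward_closed_eq_lessThan)
    fix x y assume "x \<in> {k. k < length lam \<and> k < lam ! k}" "y < x"
    then show "y \<in> {k. k < length lam \<and> k < lam ! k}"
      using nth_default_antimono[OF assms, of y x] by (auto simp: nth_default_def)
  qed simp
  then have "k < diag_rank lam \<longleftrightarrow> k < length lam \<and> k < lam ! k" by (simp add: set_eq_iff)
  then show ?thesis by (simp add: nth_default_def)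
qed

text \<open>A row that meets the main diagonal is recovered from its hook length. The cells of a
  lower row are, by symmetry, cells of those upper rows, hence already known.\<close>

lemma diag_hooks_inj:
  assumes "self_conjugate lam" "self_conjugate lam'" "diag_hooks lam = diag_hooks lam'"
  shows "lam = lam'"
proof -
  have p: "is_partition lam" "is_partition lam'" using assms by (auto simp: self_conjugate_def)
  have r: "diag_rank lam = diag_rank lam'"
    using arg_cong[OF assms(3), of length] by (simp add: diag_hooks_def)
  have rank: "k < diag_rank lam \<longleftrightarrow> k < nth_default 0 lam k"
    "k < diag_rank lam \<longleftrightarrow> k < nth_default 0 lam' k" for k
    using less_diag_rank_iff[OF p(1)] less_diag_rank_iff[OF p(2)] r by simp_all
  have small: "nth_default 0 lam k = nth_default 0 lam' k" if k: "k < diag_rank lam" for k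
  proof -
    have "diag_hooks lam ! k = diag_hooks lam' ! k" using assms(3) by simp
    moreover have "k < lam ! k" "k < length lam" "k < lam' ! k" "k < length lam'"
      using rank[of k] k by (auto simp: nth_default_def split: if_splits)
    ultimately show ?thesis using k r by (simp add: diag_hooks_def nth_default_def)
  qed
  \<comment> \<open>If row k misses the diagonal and has a cell in column j, then j < l_k \<le> k <
    l_j, so row j meets the diagonal.\<close>
  have large: "j < nth_default 0 l k \<longleftrightarrow> j < diag_rank lam \<and> k < nth_default 0 l j"
    if "self_conjugate l" "\<And>k. k < diag_rank lam \<longleftrightarrow> k < nth_default 0 l k" "\<not> k < diag_rank lam" for l j k
    using self_conjugate_sym[OF that(1), of j k] that(2)[of k] that(2)[of j] that(3) by linarith
  have eq: "nth_default 0 lam k = nth_default 0 lam' k" for k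
  proof (cases "k < diag_rank lam")
    case False
    have "j < nth_default 0 lam k \<longleftrightarrow> j < nth_default 0 lam' k" for j
      using large[OF assms(1) rank(1) False] large[OF assms(2) rank(2) False] small by metis
    then show ?thesis by (metis linorder_neqE_nat order_less_irrefl)
  qed (rule small)
  have len: "k < length l \<longleftrightarrow> nth_default 0 l k \<noteq> 0" if "is_partition l" for k and l :: "nat list"
    using that by (auto simp: is_partition_def nth_default_def in_set_conv_nth)
  have "k < length lam \<longleftrightarrow> k < length lam'" for k using len[OF p(1)] len[OF p(2)] eq by simp
  then have l: "length lam = length lam'" by (metis linorder_neqE_nat order_less_irrefl)
  show ?thesis
    using eq l by (intro nth_equalityI) (metis nth_default_def)+
qed

definition odd_decreasing :: "nat list \<Rightarrow> bool"
  where "odd_decreasing mu \<longleftrightarrow> sorted_wrt (>) mu \<and> (\<forall>m\<in>set mu. odd m)"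

lemma diag_hooks_odd_decreasing:
  assumes "self_conjugate lam"
  shows "odd_decreasing (diag_hooks lam)" "m \<in> set (diag_hooks lam) \<Longrightarrow> m < 2 * first_part lam"
proof -
  have p: "is_partition lam" using assms by (auto simp: self_conjugate_def)
  have k: "k < lam ! k" "k < length lam" "lam ! k \<le> first_part lam" if "k < diag_rank lam" for k
    using less_diag_rank_iff[OF p, of k] that nth_default_le_first_part[OF p, of k]
    by (auto simp: nth_default_def split: if_splits)
  have "lam ! j \<le> lam ! i" if "i < j" "j < diag_rank lam" for i j
    using nth_default_antimono[OF p, of i j] that k[of i] k[of j] by (auto simp: nth_default_def)
  then have "sorted_wrt (>) (diag_hooks lam)"
    using k by (fastforce simp: sorted_wrt_iff_nth_less diag_hooks_def)
  moreover have "odd (2 * a - (2 * k + 1))" if "k < a" for a k :: nat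
  proof -
    have "2 * a - (2 * k + 1) = Suc (2 * (a - k - 1))" using that by simp
    then show ?thesis by simp
  qed
  ultimately show "odd_decreasing (diag_hooks lam)"
    using k by (auto simp: odd_decreasing_def diag_hooks_def simp del: even_diff_nat)
  show "m \<in> set (diag_hooks lam) \<Longrightarrow> m < 2 * first_part lam"
    using k by (force simp: diag_hooks_def)
qed

text \<open>Wraps a symmetric hook with l cells in each arm around the diagram of
  \<open>lam\<close>; the trailing ones extend the first column to height l.\<close>

fun add_hook :: "nat \<Rightarrow> nat list \<Rightarrow> nat list"
  where "add_hook l lam = l # map Suc lam @ replicate (l - Suc (length lam)) 1"

lemma add_hook:
  assumes "self_conjugate lam" "first_part lam < l"
  shows "self_conjugate (add_hook l lam)" "diag_hooks (add_hook l lam) = (2 * l - 1) # diag_hooks lam"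
    "sum_list (add_hook l lam) = 2 * l - 1 + sum_list lam" "first_part (add_hook l lam) = l"
proof -
  have p: "is_partition lam" and len: "length lam = first_part lam"
    using assms self_conjugate_length by (auto simp: self_conjugate_def)
  have le: "a \<le> first_part lam" if "a \<in> set lam" for a
    using nth_default_le_first_part[OF p] that by (metis in_set_conv_nth nth_default_nth)
  have part: "is_partition (add_hook l lam)"
    unfolding is_partition_def
  proof
    have "sorted_wrt (\<lambda>a b. Suc b \<le> Suc a) lam" using p by (simp add: is_partition_def)
    moreover have "\<forall>a\<in>set lam. Suc a \<le> l" using le assms(2) by (meson Suc_leI le_less_trans)
    moreover have "sorted_wrt (\<ge>) (replicate k (1::nat))" for k by (induction k) auto
    ultimately show "sorted_wrt (\<ge>) (add_hook l lam)"
      using assms(2) by (auto simp: sorted_wrt_append sorted_wrt_map)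
    show "0 \<notin> set (add_hook l lam)" using assms(2) by auto
  qed
  show fp: "first_part (add_hook l lam) = l" by (simp add: first_part_def)
  have length: "length (add_hook l lam) = l" using assms(2) len by simp
  have "conjugate (add_hook l lam) = add_hook l lam"
  proof (rule nth_equalityI)
    show "length (conjugate (add_hook l lam)) = length (add_hook l lam)"
      by (simp only: length) (simp add: conjugate_def fp del: add_hook.simps)
    fix j assume "j < length (conjugate (add_hook l lam))"
    then have j: "j < l" by (simp add: conjugate_def fp del: add_hook.simps upt_Suc)
    then have c: "conjugate (add_hook l lam) ! j = length (filter (\<lambda>a. Suc j \<le> a) (add_hook l lam))"
      by (simp add: conjugate_def fp del: add_hook.simps upt_Suc)
    show "conjugate (add_hook l lam) ! j = add_hook l lam ! j"
    proof (cases j)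
      case 0
      have "filter (\<lambda>a. Suc 0 \<le> a) (add_hook l lam) = add_hook l lam"
        using part by (intro filter_True) (auto simp: is_partition_def Suc_le_eq)
      then show ?thesis using c length 0 by (simp only:) simp
    next
      case (Suc i)
      have "length (filter (\<lambda>a. Suc j \<le> a) (add_hook l lam)) = Suc (length (filter (\<lambda>a. Suc i \<le> a) lam))"
        using j Suc by (simp add: filter_map o_def)
      also have "\<dots> = add_hook l lam ! j"
      proof (cases "i < length lam")
        case True
        have "lam ! i = conjugate lam ! i" using assms by (simp add: self_conjugate_def)
        also have "\<dots> = length (filter (\<lambda>a. Suc i \<le> a) lam)"
          using True len by (simp add: conjugate_def del: upt_Suc)
        finally show ?thesis using True Suc by (simp add: nth_append)
      next
        case False
        then have "filter (\<lambda>a. Suc i \<le> a) lam = []" using le len by (fastforce simp: filter_empty_conv)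
        then show ?thesis using False Suc j by (simp add: nth_append)
      qed
      finally show ?thesis using c by simp
    qed
  qed
  with part show "self_conjugate (add_hook l lam)" by (simp add: self_conjugate_def)
  show "sum_list (add_hook l lam) = 2 * l - 1 + sum_list lam"
    using assms(2) len by (simp add: sum_list_Suc sum_list_replicate)
  have set: "{k. k < length (add_hook l lam) \<and> k < add_hook l lam ! k}
      = insert 0 (Suc ` {k. k < length lam \<and> k < lam ! k})" (is "?L = ?R")
  proof (rule set_eqI)
    fix k show "k \<in> ?L \<longleftrightarrow> k \<in> ?R"
      using assms(2) len by (cases k) (auto simp: nth_append)
  qed
  have rank: "diag_rank (add_hook l lam) = Suc (diag_rank lam)"
    unfolding diag_rank_def set by (subst card_insert_disjoint) (auto simp: card_image)
  have k: "k < length lam" if "k < diag_rank lam" for k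
    using less_diag_rank_iff[OF p, of k] that by (auto simp: nth_default_def split: if_splits)
  have "[0..<Suc (diag_rank lam)] = 0 # map Suc [0..<diag_rank lam]"
    by (simp add: map_Suc_upt upt_conv_Cons del: upt_Suc)
  then show "diag_hooks (add_hook l lam) = (2 * l - 1) # diag_hooks lam"
    using k unfolding diag_hooks_def rank by (simp add: nth_append del: upt_Suc)
qed

text \<open>Hooks are added from the innermost outwards; the hook of odd length m has l = (m + 1) /
  2. The claim on the first part belongs to the induction because it ensures that the next, longer
  hook fits around the diagram.\<close>

lemma self_conjugate_of_hooks:
  assumes "odd_decreasing mu"
  shows "\<exists>lam. self_conjugate lam \<and> diag_hooks lam = mu \<and> sum_list lam = sum_list mu
    \<and> 2 * first_part lam = (case mu of [] \<Rightarrow> 0 | m # _ \<Rightarrow> Suc m)"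
  using assms
proof (induction mu)
  case Nil
  show ?case
    by (rule exI[of _ "[]"]) (simp add: self_conjugate_def is_partition_def conjugate_def first_part_def
        diag_hooks_def diag_rank_def)
next
  case (Cons m mu)
  then obtain lam where lam: "self_conjugate lam" "diag_hooks lam = mu" "sum_list lam = sum_list mu"
    "2 * first_part lam = (case mu of [] \<Rightarrow> 0 | m # _ \<Rightarrow> Suc m)"
    by (auto simp: odd_decreasing_def)
  have m: "2 * (Suc m div 2) = Suc m" using Cons.prems by (simp add: odd_decreasing_def)
  moreover have "first_part lam < Suc m div 2"
    using lam(4) Cons.prems m by (cases mu) (auto simp: odd_decreasing_def)
  note H = add_hook[OF lam(1) this]
  show ?case
    by (rule exI[of _ "add_hook (Suc m div 2) lam"]) (use H lam m in \<open>simp del: add_hook.simps\<close>)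
qed

text \<open>The size is known for the partition built from the hooks, and injectivity of
  \<open>diag_hooks\<close> identifies that partition with \<open>lam\<close>.\<close>

lemma sum_list_diag_hooks:
  assumes "self_conjugate lam"
  shows "sum_list (diag_hooks lam) = sum_list lam"
  using self_conjugate_of_hooks[OF diag_hooks_odd_decreasing(1)[OF assms]] diag_hooks_inj assms by metis

lemma diag_hooks_image:
  "diag_hooks ` {lam. self_conjugate lam \<and> first_part lam \<le> N}
    = {mu. odd_decreasing mu \<and> (\<forall>m\<in>set mu. m < 2 * N)}" (is "?L = ?R")
proof
  show "?L \<subseteq> ?R" using diag_hooks_odd_decreasing by fastforce
  show "?R \<subseteq> ?L"
  proof
    fix mu assume mu: "mu \<in> ?R"
    then obtain lam where lam: "self_conjugate lam" "diag_hooks lam = mu"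
      "2 * first_part lam = (case mu of [] \<Rightarrow> 0 | m # _ \<Rightarrow> Suc m)"
      using self_conjugate_of_hooks by blast
    have "first_part lam \<le> N" using lam(3) mu by (cases mu) auto
    with lam show "mu \<in> ?L" by blast
  qed
qed

section \<open>The commutant of the symmetric tensors\<close>

lemma sum_of_bool_mult:
  fixes f :: "'x \<Rightarrow> 'a::semiring_1"
  assumes "finite A" "a \<in> A"
  shows "(\<Sum>x\<in>A. of_bool (x = a) * f x) = f a" "(\<Sum>x\<in>A. of_bool (a = x) * f x) = f a"
proof -
  show "(\<Sum>x\<in>A. of_bool (x = a) * f x) = f a"
    using assms by (subst sum.remove[of _ a]) (auto intro!: sum.neutral)
  then show "(\<Sum>x\<in>A. of_bool (a = x) * f x) = f a" by (simp only: eq_commute[of a])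
qed

lemma sum_rotate: "(\<Sum>a\<in>A. \<Sum>b\<in>B. \<Sum>c\<in>C. F a b c) = (\<Sum>c\<in>C. \<Sum>a\<in>A. \<Sum>b\<in>B. F a b c)"
proof -
  have "(\<Sum>b\<in>B. \<Sum>c\<in>C. F a b c) = (\<Sum>c\<in>C. \<Sum>b\<in>B. F a b c)" for a by (rule sum.swap)
  then show ?thesis by (simp only:) (rule sum.swap)
qed

lemma sum_mult_diff_sum:
  fixes c :: "'h \<Rightarrow> 'a::comm_ring_1"
  shows "(\<Sum>x\<in>G. b x * (f x - (\<Sum>h\<in>H. c h * g x h)))
    = (\<Sum>x\<in>G. b x * f x) - (\<Sum>h\<in>H. c h * (\<Sum>x\<in>G. b x * g x h))"
proof -
  have "(\<Sum>x\<in>G. b x * (\<Sum>h\<in>H. c h * g x h)) = (\<Sum>x\<in>G. \<Sum>h\<in>H. c h * (b x * g x h))"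
    by (simp add: sum_distrib_left mult.left_commute)
  also have "\<dots> = (\<Sum>h\<in>H. \<Sum>x\<in>G. c h * (b x * g x h))" by (rule sum.swap)
  finally show ?thesis by (simp add: right_diff_distrib sum_subtractf sum_distrib_left)
qed

lemma cnj_of_bool [simp]: "cnj (of_bool b) = of_bool b"
  by (cases b) simp_all

text \<open>Orthogonal projection onto a span, for the standard Hermitian form on functions on D.
  Gram-Schmidt: project both X and the new vector onto the old span, then correct X along the
  remainder u of the new vector, with coefficient \<alpha>.\<close>

lemma orthogonal_projection:
  fixes f :: "'i \<Rightarrow> 'x \<Rightarrow> complex"
  assumes "finite G" "finite D"
  shows "\<exists>c. \<forall>g\<in>G. (\<Sum>x\<in>D. cnj (f g x) * (X x - (\<Sum>h\<in>G. c h * f h x))) = 0"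
  using assms(1)
proof (induction G arbitrary: X rule: finite_induct)
  case empty
  show ?case by simp
next
  case (insert g G)
  from insert.IH[of X] obtain c1 where
    c1: "\<forall>h\<in>G. (\<Sum>x\<in>D. cnj (f h x) * (X x - (\<Sum>h\<in>G. c1 h * f h x))) = 0" by blast
  from insert.IH[of "f g"] obtain c2 where
    c2: "\<forall>h\<in>G. (\<Sum>x\<in>D. cnj (f h x) * (f g x - (\<Sum>h\<in>G. c2 h * f h x))) = 0" by blast
  define u where "u x = f g x - (\<Sum>h\<in>G. c2 h * f h x)" for x
  define v where "v x = X x - (\<Sum>h\<in>G. c1 h * f h x)" for x
  define \<alpha> where "\<alpha> = (\<Sum>x\<in>D. cnj (u x) * v x) / (\<Sum>x\<in>D. cnj (u x) * u x)"
  define c where "c h = (if h = g then \<alpha> else c1 h - \<alpha> * c2 h)" for h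
  have c: "X x - (\<Sum>h\<in>insert g G. c h * f h x) = v x - \<alpha> * u x" for x
  proof -
    have "(\<Sum>h\<in>G. c h * f h x) = (\<Sum>h\<in>G. (c1 h - \<alpha> * c2 h) * f h x)"
      using insert(2) by (intro sum.cong) (auto simp: c_def)
    then show ?thesis using insert(1,2)
      by (simp add: c_def u_def v_def algebra_simps sum_subtractf sum_distrib_left)
  qed
  have h: "(\<Sum>x\<in>D. cnj (f h x) * (v x - \<alpha> * u x)) = 0" if "h \<in> G" for h
  proof -
    have "(\<Sum>x\<in>D. cnj (f h x) * (v x - \<alpha> * u x))
        = (\<Sum>x\<in>D. cnj (f h x) * v x) - \<alpha> * (\<Sum>x\<in>D. cnj (f h x) * u x)"
      by (simp add: algebra_simps sum_subtractf sum_distrib_left)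
    then show ?thesis using c1 c2 that by (simp add: u_def v_def)
  qed
  \<comment> \<open>The vectors may be dependent. If u has norm zero, it vanishes on D and the value
    of \<alpha> is immaterial.\<close>
  have u: "(\<Sum>x\<in>D. cnj (u x) * (v x - \<alpha> * u x)) = 0"
  proof (cases "(\<Sum>x\<in>D. cnj (u x) * u x) = 0")
    case True
    then have "complex_of_real (\<Sum>x\<in>D. (cmod (u x))\<^sup>2) = 0"
      by (simp only: of_real_sum complex_norm_square mult.commute)
    then have "(\<Sum>x\<in>D. (cmod (u x))\<^sup>2) = 0" by (simp only: of_real_eq_0_iff)
    then have "\<forall>x\<in>D. u x = 0" using assms(2) by (simp add: sum_nonneg_eq_0_iff)
    then show ?thesis by simp
  next
    case False
    have "(\<Sum>x\<in>D. cnj (u x) * (v x - \<alpha> * u x))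
        = (\<Sum>x\<in>D. cnj (u x) * v x) - \<alpha> * (\<Sum>x\<in>D. cnj (u x) * u x)"
      by (simp add: algebra_simps sum_subtractf sum_distrib_left)
    then show ?thesis using False by (simp add: \<alpha>_def)
  qed
  \<comment> \<open>The new vector is u plus a combination of the old ones, and the residual is
    orthogonal to each of these.\<close>
  have g: "(\<Sum>x\<in>D. cnj (f g x) * (v x - \<alpha> * u x)) = 0"
  proof -
    have "cnj (f g x) * (v x - \<alpha> * u x) = cnj (u x) * (v x - \<alpha> * u x)
        + (\<Sum>h\<in>G. cnj (c2 h) * (cnj (f h x) * (v x - \<alpha> * u x)))" for x
      by (simp add: u_def algebra_simps sum_distrib_left sum_subtractf sum.distrib)
    then have "(\<Sum>x\<in>D. cnj (f g x) * (v x - \<alpha> * u x))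
        = (\<Sum>x\<in>D. cnj (u x) * (v x - \<alpha> * u x))
        + (\<Sum>h\<in>G. cnj (c2 h) * (\<Sum>x\<in>D. cnj (f h x) * (v x - \<alpha> * u x)))"
      by (simp add: sum.distrib sum_distrib_left sum.swap[of _ G D])
    then show ?thesis using u h by simp
  qed
  show ?case by (rule exI[of _ c]) (use g h c in auto)
qed

lemma PiE_permutes: "I \<in> S \<rightarrow>\<^sub>E B \<Longrightarrow> \<sigma> permutes S \<Longrightarrow> I \<circ> \<sigma> \<in> S \<rightarrow>\<^sub>E B"
  by (auto simp: PiE_iff extensional_def permutes_in_image permutes_not_in)

text \<open>A double commutant theorem in coordinates: the hypothesis says that X commutes with
  every symmetrized matrix unit. Let Y be X minus its projection to the permutation operators, and
  let \<open>d \<sigma>\<close> be the inner product of Y with its translate by \<sigma>.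
  Commutation and orthogonality force the sum of the |d \<sigma>|^2 to vanish, and
  \<open>d id\<close> is the squared norm of Y.\<close>

lemma commutant_of_symmetric_tensors:
  fixes X :: "('s \<Rightarrow> 'b) \<Rightarrow> ('s \<Rightarrow> 'b) \<Rightarrow> complex"
  assumes fin: "finite S" "finite B"
    and E: "E = (S \<rightarrow>\<^sub>E B)" and G: "G = {\<sigma>. \<sigma> permutes S}"
    and comm: "\<And>K L P Q. K \<in> E \<Longrightarrow> L \<in> E \<Longrightarrow> P \<in> E \<Longrightarrow> Q \<in> E \<Longrightarrow>
      (\<Sum>\<sigma>\<in>G. of_bool (K \<circ> \<sigma> = P) * X (L \<circ> \<sigma>) Q) = (\<Sum>\<sigma>\<in>G. of_bool (L \<circ> \<sigma> = Q) * X P (K \<circ> \<sigma>))"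
  shows "\<exists>c. \<forall>I\<in>E. \<forall>J\<in>E. X I J = (\<Sum>\<sigma>\<in>G. c \<sigma> * of_bool (J = I \<circ> \<sigma>))"
proof -
  have finE: "finite E" and finG: "finite G"
    using fin by (auto simp: E G finite_PiE finite_permutations)
  have EG: "I \<circ> \<sigma> \<in> E" if "I \<in> E" "\<sigma> \<in> G" for I \<sigma>
    using that PiE_permutes unfolding E G by blast
  obtain c where c: "\<forall>\<sigma>\<in>G. (\<Sum>x\<in>E \<times> E. cnj (of_bool (snd x = fst x \<circ> \<sigma>)) *
      (X (fst x) (snd x) - (\<Sum>h\<in>G. c h * of_bool (snd x = fst x \<circ> h)))) = 0"
    using orthogonal_projection[of G "E \<times> E" "\<lambda>\<sigma> x. of_bool (snd x = fst x \<circ> \<sigma>)"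
        "\<lambda>x. X (fst x) (snd x)"] finE finG by blast
  define Y where "Y I J = X I J - (\<Sum>h\<in>G. c h * of_bool (J = I \<circ> h))" for I J
  have orth: "(\<Sum>I\<in>E. Y I (I \<circ> \<sigma>)) = 0" if \<sigma>: "\<sigma> \<in> G" for \<sigma>
  proof -
    have "0 = (\<Sum>x\<in>E \<times> E. of_bool (snd x = fst x \<circ> \<sigma>) * Y (fst x) (snd x))"
      using c \<sigma> by (simp add: Y_def)
    also have "\<dots> = (\<Sum>I\<in>E. \<Sum>J\<in>E. of_bool (J = I \<circ> \<sigma>) * Y I J)"
      by (simp add: sum.cartesian_product case_prod_unfold)
    also have "\<dots> = (\<Sum>I\<in>E. Y I (I \<circ> \<sigma>))"
      using EG[OF _ \<sigma>] finE by (intro sum.cong refl sum_of_bool_mult)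
    finally show ?thesis by simp
  qed
  \<comment> \<open>Permutation operators commute with the symmetrized units, by the substitution of
    \<sigma> \<circ> \<tau> for \<sigma>. Hence Y inherits the hypothesis on X.\<close>
  have f_comm: "(\<Sum>\<sigma>\<in>G. of_bool (K \<circ> \<sigma> = P) * of_bool (Q = (L \<circ> \<sigma>) \<circ> \<tau>))
      = (\<Sum>\<sigma>\<in>G. of_bool (L \<circ> \<sigma> = Q) * (of_bool (K \<circ> \<sigma> = P \<circ> \<tau>) :: complex))"
    if \<tau>: "\<tau> \<in> G" for K L P Q \<tau>
  proof -
    have \<tau>p: "\<tau> permutes S" using \<tau> by (simp add: G)
    then have surj: "surj \<tau>" by (rule permutes_surj)
    have "K \<circ> (\<sigma> \<circ> \<tau>) = P \<circ> \<tau> \<longleftrightarrow> K \<circ> \<sigma> = P" for \<sigma>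
      unfolding comp_assoc[symmetric] using surj by (metis fun.map_comp comp_id surj_iff)
    then show ?thesis
      unfolding G by (subst (2) sum_permutations_compose_right[OF \<tau>p])
        (auto intro!: sum.cong simp: comp_assoc)
  qed
  have Ycomm: "(\<Sum>\<sigma>\<in>G. of_bool (K \<circ> \<sigma> = P) * Y (L \<circ> \<sigma>) Q)
      = (\<Sum>\<sigma>\<in>G. of_bool (L \<circ> \<sigma> = Q) * Y P (K \<circ> \<sigma>))"
    if "K \<in> E" "L \<in> E" "P \<in> E" "Q \<in> E" for K L P Q
  proof -
    have "(\<Sum>\<sigma>\<in>G. of_bool (K \<circ> \<sigma> = P) * Y (L \<circ> \<sigma>) Q)
      = (\<Sum>\<sigma>\<in>G. of_bool (K \<circ> \<sigma> = P) * X (L \<circ> \<sigma>) Q)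
        - (\<Sum>h\<in>G. c h * (\<Sum>\<sigma>\<in>G. of_bool (K \<circ> \<sigma> = P) * of_bool (Q = (L \<circ> \<sigma>) \<circ> h)))"
      unfolding Y_def by (rule sum_mult_diff_sum)
    also have "\<dots> = (\<Sum>\<sigma>\<in>G. of_bool (L \<circ> \<sigma> = Q) * X P (K \<circ> \<sigma>))
        - (\<Sum>h\<in>G. c h * (\<Sum>\<sigma>\<in>G. of_bool (L \<circ> \<sigma> = Q) * of_bool (K \<circ> \<sigma> = P \<circ> h)))"
      unfolding comm[OF that] by (intro arg_cong2[of _ _ _ _ "(-)"] sum.cong refl) (simp only: f_comm)
    also have "\<dots> = (\<Sum>\<sigma>\<in>G. of_bool (L \<circ> \<sigma> = Q) * Y P (K \<circ> \<sigma>))"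
      unfolding Y_def by (rule sum_mult_diff_sum[symmetric])
    finally show ?thesis .
  qed
  define d where "d \<sigma> = (\<Sum>L\<in>E. \<Sum>Q\<in>E. cnj (Y L Q) * Y (L \<circ> \<sigma>) Q)" for \<sigma>
  \<comment> \<open>Commutation trades the translates of Y in the first index for the sums of
    \<open>Y L (L \<circ> \<sigma>)\<close> over L, which are inner products with permutation
    operators and vanish by \<open>orth\<close>.\<close>
  have step1: "(\<Sum>\<sigma>\<in>G. of_bool (K \<circ> \<sigma> = P) * d \<sigma>) = 0" if KP: "K \<in> E" "P \<in> E" for K P
  proof -
    have "(\<Sum>\<sigma>\<in>G. of_bool (K \<circ> \<sigma> = P) * d \<sigma>)
        = (\<Sum>L\<in>E. \<Sum>Q\<in>E. \<Sum>\<sigma>\<in>G. cnj (Y L Q) * (of_bool (K \<circ> \<sigma> = P) * Y (L \<circ> \<sigma>) Q))"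
      unfolding d_def by (subst sum_rotate) (simp add: sum_distrib_left mult.left_commute)
    also have "\<dots> = (\<Sum>L\<in>E. \<Sum>Q\<in>E. \<Sum>\<sigma>\<in>G. cnj (Y L Q) * (of_bool (L \<circ> \<sigma> = Q) * Y P (K \<circ> \<sigma>)))"
      using Ycomm KP by (simp only: sum_distrib_left[symmetric] cong: sum.cong)
    also have "\<dots> = (\<Sum>\<sigma>\<in>G. Y P (K \<circ> \<sigma>) * (\<Sum>L\<in>E. \<Sum>Q\<in>E. of_bool (L \<circ> \<sigma> = Q) * cnj (Y L Q)))"
      by (subst sum_rotate) (simp add: sum_distrib_left mult_ac)
    also have "\<dots> = (\<Sum>\<sigma>\<in>G. Y P (K \<circ> \<sigma>) * cnj (\<Sum>L\<in>E. Y L (L \<circ> \<sigma>)))"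
    proof (intro sum.cong refl arg_cong2[of _ _ _ _ "(*)"])
      fix \<sigma> assume "\<sigma> \<in> G"
      then show "(\<Sum>L\<in>E. \<Sum>Q\<in>E. of_bool (L \<circ> \<sigma> = Q) * cnj (Y L Q)) = cnj (\<Sum>L\<in>E. Y L (L \<circ> \<sigma>))"
        using EG finE by (simp only: cnj_sum) (intro sum.cong refl sum_of_bool_mult)
    qed
    also have "\<dots> = 0" using orth by simp
    finally show ?thesis .
  qed
  \<comment> \<open>The conjugate of \<open>d \<sigma>\<close> is itself a combination, over K and
    P, of the indicators of K \<circ> \<sigma> = P, so interchanging the sums leads back to
    \<open>step1\<close>.\<close>
  have "(\<Sum>\<sigma>\<in>G. d \<sigma> * cnj (d \<sigma>))
      = (\<Sum>\<sigma>\<in>G. \<Sum>K\<in>E. \<Sum>P\<in>E. (\<Sum>R\<in>E. Y K R * cnj (Y P R)) * (of_bool (K \<circ> \<sigma> = P) * d \<sigma>))"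
  proof (rule sum.cong[OF refl])
    fix \<sigma> assume \<sigma>: "\<sigma> \<in> G"
    have "(\<Sum>P\<in>E. (\<Sum>R\<in>E. Y K R * cnj (Y P R)) * (of_bool (K \<circ> \<sigma> = P) * d \<sigma>))
        = (\<Sum>R\<in>E. Y K R * cnj (Y (K \<circ> \<sigma>) R)) * d \<sigma>" if "K \<in> E" for K
    proof -
      have "(\<Sum>P\<in>E. (\<Sum>R\<in>E. Y K R * cnj (Y P R)) * (of_bool (K \<circ> \<sigma> = P) * d \<sigma>))
        = (\<Sum>P\<in>E. if K \<circ> \<sigma> = P then (\<Sum>R\<in>E. Y K R * cnj (Y P R)) * d \<sigma> else 0)"
        by (intro sum.cong) auto
      then show ?thesis using EG[OF that \<sigma>] finE by (simp add: sum.delta)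
    qed
    moreover have "d \<sigma> * cnj (d \<sigma>) = (\<Sum>K\<in>E. (\<Sum>R\<in>E. Y K R * cnj (Y (K \<circ> \<sigma>) R)) * d \<sigma>)"
      by (simp add: d_def[of \<sigma>] sum_distrib_right[symmetric] mult.commute)
    ultimately show "d \<sigma> * cnj (d \<sigma>)
        = (\<Sum>K\<in>E. \<Sum>P\<in>E. (\<Sum>R\<in>E. Y K R * cnj (Y P R)) * (of_bool (K \<circ> \<sigma> = P) * d \<sigma>))"
      by simp
  qed
  also have "\<dots> = (\<Sum>K\<in>E. \<Sum>P\<in>E. (\<Sum>R\<in>E. Y K R * cnj (Y P R)) * (\<Sum>\<sigma>\<in>G. of_bool (K \<circ> \<sigma> = P) * d \<sigma>))"
    by (subst sum_rotate[symmetric]) (simp add: sum_distrib_left)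
  also have "\<dots> = 0" using step1 by simp
  finally have "complex_of_real (\<Sum>\<sigma>\<in>G. (cmod (d \<sigma>))\<^sup>2) = 0"
    by (simp only: of_real_sum complex_norm_square)
  then have "(\<Sum>\<sigma>\<in>G. (cmod (d \<sigma>))\<^sup>2) = 0" by (simp only: of_real_eq_0_iff)
  then have "\<forall>\<sigma>\<in>G. d \<sigma> = 0" using finG by (simp add: sum_nonneg_eq_0_iff)
  then have "d id = 0" by (simp add: G permutes_id)
  then have "complex_of_real (\<Sum>L\<in>E. \<Sum>Q\<in>E. (cmod (Y L Q))\<^sup>2) = 0"
    by (simp only: d_def o_id of_real_sum complex_norm_square mult.commute)
  then have "(\<Sum>L\<in>E. \<Sum>Q\<in>E. (cmod (Y L Q))\<^sup>2) = 0" by (simp only: of_real_eq_0_iff)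
  then have "\<forall>L\<in>E. \<forall>Q\<in>E. Y L Q = 0" using finE by (simp add: sum_nonneg_eq_0_iff sum_nonneg)
  then show ?thesis by (intro exI[of _ c]) (simp add: Y_def)
qed

section \<open>Polarization: from powers of single matrices to symmetrized products\<close>

lemma sum_PiE_permutes:
  fixes F :: "('s \<Rightarrow> 's) \<Rightarrow> 'm::comm_monoid_add"
  assumes "finite S" "\<And>f. f \<in> S \<rightarrow>\<^sub>E S \<Longrightarrow> \<not> inj_on f S \<Longrightarrow> F f = 0"
  shows "(\<Sum>f\<in>S \<rightarrow>\<^sub>E S. F f) = (\<Sum>\<sigma> | \<sigma> permutes S. F (restrict \<sigma> S))"
proof -
  have "(\<Sum>f\<in>S \<rightarrow>\<^sub>E S. F f) = (\<Sum>f | f \<in> S \<rightarrow>\<^sub>E S \<and> inj_on f S. F f)"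
    using assms by (intro sum.mono_neutral_right finite_PiE) auto
  also have "\<dots> = (\<Sum>\<sigma> | \<sigma> permutes S. F (restrict \<sigma> S))"
  proof (rule sum.reindex_bij_witness[of _ "\<lambda>\<sigma>. restrict \<sigma> S" "\<lambda>f x. if x \<in> S then f x else x"])
    fix f assume "f \<in> {f \<in> S \<rightarrow>\<^sub>E S. inj_on f S}"
    then have f: "f \<in> S \<rightarrow>\<^sub>E S" "inj_on f S" by auto
    show r: "restrict (\<lambda>x. if x \<in> S then f x else x) S = f"
      using f(1) by (auto simp: fun_eq_iff PiE_def extensional_def)
    have "bij_betw f S S"
      using f assms(1) by (metis PiE_E bij_betw_def endo_inj_surj image_subsetI)
    then have "bij_betw (\<lambda>x. if x \<in> S then f x else x) S S"
      by (rule bij_betw_cong[THEN iffD1, rotated]) simp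
    then show "(\<lambda>x. if x \<in> S then f x else x) \<in> {\<sigma>. \<sigma> permutes S}"
      by (auto intro: bij_imp_permutes)
    show "F (restrict (\<lambda>x. if x \<in> S then f x else x) S) = F f" by (simp only: r)
  next
    fix \<sigma> assume "\<sigma> \<in> {\<sigma>. \<sigma> permutes S}"
    then have \<sigma>: "\<sigma> permutes S" by simp
    show "(\<lambda>x. if x \<in> S then restrict \<sigma> S x else x) = \<sigma>"
      using \<sigma> by (auto simp: fun_eq_iff permutes_not_in)
    show "restrict \<sigma> S \<in> {f \<in> S \<rightarrow>\<^sub>E S. inj_on f S}"
      using permutes_in_image[OF \<sigma>] permutes_inj_on[OF \<sigma>] by (auto simp: inj_on_def)
  qed
  finally show ?thesis .
qed

text \<open>Toggling one chosen element of S outside R pairs the supersets with opposite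
  signs.\<close>

lemma sum_alternating_supersets:
  assumes "finite S" "R \<subset> S"
  shows "(\<Sum>T | R \<subseteq> T \<and> T \<subseteq> S. (-1) ^ card T) = (0::'a::ring_1)"
proof -
  obtain x where x: "x \<in> S" "x \<notin> R" using assms(2) by blast
  have fin: "finite {T. R \<subseteq> T \<and> T \<subseteq> S}" using assms(1) by (auto intro: finite_subset[of _ "Pow S"])
  have "(\<Sum>T | R \<subseteq> T \<and> T \<subseteq> S. (-1) ^ card T) = (\<Sum>T | (R \<subseteq> T \<and> T \<subseteq> S) \<and> x \<in> T. (-1) ^ card T)
      + (\<Sum>T | (R \<subseteq> T \<and> T \<subseteq> S) \<and> x \<notin> T. (-1::'a) ^ card T)"
    using fin by (subst sum.union_disjoint[symmetric]) (auto intro!: sum.cong intro: finite_subset[OF _ fin])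
  also have "(\<Sum>T | (R \<subseteq> T \<and> T \<subseteq> S) \<and> x \<in> T. (-1::'a) ^ card T)
      = (\<Sum>T | (R \<subseteq> T \<and> T \<subseteq> S) \<and> x \<notin> T. - ((-1) ^ card T))"
  proof (rule sum.reindex_bij_witness[of _ "insert x" "\<lambda>T. T - {x}"])
    fix T assume T: "T \<in> {T. (R \<subseteq> T \<and> T \<subseteq> S) \<and> x \<in> T}"
    then have "finite T" using assms(1) finite_subset by blast
    then have "card T = Suc (card (T - {x}))" using T by (metis (lifting) card_Suc_Diff1 mem_Collect_eq)
    then show "- ((-1) ^ card (T - {x})) = (-1::'a) ^ card T" by simp
  qed (use x in auto)
  finally show ?thesis by (simp add: sum_negf)
qed

text \<open>Ryser's formula for the permanent. Expanding the product yields all maps f from S to S;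
  the alternating sum over the sets T containing the image of f removes every f that is not
  surjective, leaving the permutations. Read backwards, it writes a symmetrized product as a
  combination of pure powers.\<close>

lemma Ryser:
  fixes A :: "'s \<Rightarrow> 's \<Rightarrow> 'a::comm_ring_1"
  assumes "finite S"
  shows "(\<Sum>T\<in>Pow S. (-1) ^ card T * (\<Prod>s\<in>S. \<Sum>r\<in>T. A s r))
    = (-1) ^ card S * (\<Sum>\<sigma> | \<sigma> permutes S. \<Prod>s\<in>S. A s (\<sigma> s))"
proof -
  have "(\<Sum>T\<in>Pow S. (-1) ^ card T * (\<Prod>s\<in>S. \<Sum>r\<in>T. A s r))
      = (\<Sum>T\<in>Pow S. \<Sum>f\<in>S \<rightarrow>\<^sub>E S. of_bool (f ` S \<subseteq> T) * ((-1) ^ card T * (\<Prod>s\<in>S. A s (f s))))"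
  proof (rule sum.cong[OF refl])
    fix T assume T: "T \<in> Pow S"
    have "(\<Prod>s\<in>S. \<Sum>r\<in>T. A s r) = (\<Sum>f\<in>S \<rightarrow>\<^sub>E T. \<Prod>s\<in>S. A s (f s))"
      using assms T by (intro prod_sum_PiE) (auto intro: finite_subset)
    also have "\<dots> = (\<Sum>f\<in>S \<rightarrow>\<^sub>E S. of_bool (f ` S \<subseteq> T) * (\<Prod>s\<in>S. A s (f s)))"
      using T assms by (intro sum.mono_neutral_cong_left finite_PiE) (auto simp: PiE_iff)
    finally show "(-1) ^ card T * (\<Prod>s\<in>S. \<Sum>r\<in>T. A s r)
        = (\<Sum>f\<in>S \<rightarrow>\<^sub>E S. of_bool (f ` S \<subseteq> T) * ((-1) ^ card T * (\<Prod>s\<in>S. A s (f s))))"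
      by (simp add: sum_distrib_left mult.left_commute)
  qed
  also have "\<dots> = (\<Sum>f\<in>S \<rightarrow>\<^sub>E S. (\<Sum>T | f ` S \<subseteq> T \<and> T \<subseteq> S. (-1) ^ card T) * (\<Prod>s\<in>S. A s (f s)))"
  proof (subst sum.swap, rule sum.cong[OF refl])
    fix f assume "f \<in> S \<rightarrow>\<^sub>E S"
    have "(\<Sum>T\<in>Pow S. of_bool (f ` S \<subseteq> T) * ((-1) ^ card T * (\<Prod>s\<in>S. A s (f s))))
        = (\<Sum>T | f ` S \<subseteq> T \<and> T \<subseteq> S. (-1) ^ card T * (\<Prod>s\<in>S. A s (f s)))"
      using assms by (intro sum.mono_neutral_cong_right) auto
    then show "(\<Sum>T\<in>Pow S. of_bool (f ` S \<subseteq> T) * ((-1) ^ card T * (\<Prod>s\<in>S. A s (f s))))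
        = (\<Sum>T | f ` S \<subseteq> T \<and> T \<subseteq> S. (-1) ^ card T) * (\<Prod>s\<in>S. A s (f s))"
      by (simp add: sum_distrib_right)
  qed
  also have "\<dots> = (\<Sum>\<sigma> | \<sigma> permutes S. (\<Sum>T | restrict \<sigma> S ` S \<subseteq> T \<and> T \<subseteq> S. (-1) ^ card T)
      * (\<Prod>s\<in>S. A s (restrict \<sigma> S s)))"
  proof (rule sum_PiE_permutes[OF assms])
    fix f assume f: "f \<in> S \<rightarrow>\<^sub>E S" "\<not> inj_on f S"
    then have "f ` S \<noteq> S" using assms by (metis finite_surj_inj order_refl)
    then have "f ` S \<subset> S" using f(1) by blast
    then show "(\<Sum>T | f ` S \<subseteq> T \<and> T \<subseteq> S. (-1) ^ card T) * (\<Prod>s\<in>S. A s (f s)) = 0"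
      by (simp add: sum_alternating_supersets[OF assms])
  qed
  also have "\<dots> = (\<Sum>\<sigma> | \<sigma> permutes S. (-1) ^ card S * (\<Prod>s\<in>S. A s (\<sigma> s)))"
  proof (rule sum.cong[OF refl])
    fix \<sigma> assume "\<sigma> \<in> {\<sigma>. \<sigma> permutes S}"
    then have "restrict \<sigma> S ` S = S" by (simp add: permutes_image)
    then have "{T. restrict \<sigma> S ` S \<subseteq> T \<and> T \<subseteq> S} = {S}" by auto
    then show "(\<Sum>T | restrict \<sigma> S ` S \<subseteq> T \<and> T \<subseteq> S. (-1) ^ card T) * (\<Prod>s\<in>S. A s (restrict \<sigma> S s))
        = (-1) ^ card S * (\<Prod>s\<in>S. A s (\<sigma> s))" by simp
  qed
  finally show ?thesis by (simp add: sum_distrib_left)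
qed

text \<open>The equality, entry by entry at (P, Q), of the two products of X with the tensor power
  of M over S.\<close>

definition commutes_with_power ::
    "'s set \<Rightarrow> 'b set \<Rightarrow> (('s \<Rightarrow> 'b) \<Rightarrow> ('s \<Rightarrow> 'b) \<Rightarrow> complex) \<Rightarrow> ('b \<Rightarrow> 'b \<Rightarrow> complex) \<Rightarrow> bool"
  where "commutes_with_power S B X M \<longleftrightarrow> (\<forall>P\<in>S \<rightarrow>\<^sub>E B. \<forall>Q\<in>S \<rightarrow>\<^sub>E B.
    (\<Sum>I\<in>S \<rightarrow>\<^sub>E B. X I Q * (\<Prod>s\<in>S. M (P s) (I s))) = (\<Sum>J\<in>S \<rightarrow>\<^sub>E B. X P J * (\<Prod>s\<in>S. M (J s) (Q s))))"

text \<open>For fixed P and Q both sides are polynomials in c. They agree on the infinite set C,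
  hence identically, and c = 0 is the claim.\<close>

lemma commutes_with_power_shift:
  assumes "infinite C"
    and "\<And>c. c \<in> C \<Longrightarrow> commutes_with_power S B X (\<lambda>a b. M a b + c * of_bool (a = b))"
  shows "commutes_with_power S B X M"
  unfolding commutes_with_power_def
proof (intro ballI)
  fix P Q assume PQ: "P \<in> S \<rightarrow>\<^sub>E B" "Q \<in> S \<rightarrow>\<^sub>E B"
  let ?m = "\<lambda>a b. [:M a b, of_bool (a = b):]"
  define p where "p = (\<Sum>I\<in>S \<rightarrow>\<^sub>E B. [:X I Q:] * (\<Prod>s\<in>S. ?m (P s) (I s)))
    - (\<Sum>J\<in>S \<rightarrow>\<^sub>E B. [:X P J:] * (\<Prod>s\<in>S. ?m (J s) (Q s)))"
  have p: "poly p c = (\<Sum>I\<in>S \<rightarrow>\<^sub>E B. X I Q * (\<Prod>s\<in>S. M (P s) (I s) + c * of_bool (P s = I s)))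
    - (\<Sum>J\<in>S \<rightarrow>\<^sub>E B. X P J * (\<Prod>s\<in>S. M (J s) (Q s) + c * of_bool (J s = Q s)))" for c
    by (simp add: p_def poly_sum poly_prod)
  have "C \<subseteq> {c. poly p c = 0}"
    using assms(2) PQ by (auto simp: p commutes_with_power_def)
  then have "p = 0" using assms(1) poly_roots_finite finite_subset by blast
  then show "(\<Sum>I\<in>S \<rightarrow>\<^sub>E B. X I Q * (\<Prod>s\<in>S. M (P s) (I s))) = (\<Sum>J\<in>S \<rightarrow>\<^sub>E B. X P J * (\<Prod>s\<in>S. M (J s) (Q s)))"
    using p[of 0] by simp
qed

lemma prod_of_bool: "finite S \<Longrightarrow> (\<Prod>s\<in>S. of_bool (R s)) = (of_bool (\<forall>s\<in>S. R s) :: 'a::comm_semiring_1)"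
  by (induction S rule: finite_induct) auto

text \<open>The hypothesis is applied to the matrices \<open>?M T\<close>, the sum over r in T of
  the matrix units at (K r, L r). Ryser's alternating sum over T turns their tensor powers into the
  symmetrized product of all these units.\<close>

lemma commutes_with_powers_symmetrized:
  fixes X :: "('s \<Rightarrow> 'b) \<Rightarrow> ('s \<Rightarrow> 'b) \<Rightarrow> complex"
  assumes fin: "finite S" "finite B"
    and E: "E = (S \<rightarrow>\<^sub>E B)" and G: "G = {\<sigma>. \<sigma> permutes S}"
    and comm: "\<And>M. commutes_with_power S B X M"
    and KLPQ: "K \<in> E" "L \<in> E" "P \<in> E" "Q \<in> E"
  shows "(\<Sum>\<sigma>\<in>G. of_bool (K \<circ> \<sigma> = P) * X (L \<circ> \<sigma>) Q) = (\<Sum>\<sigma>\<in>G. of_bool (L \<circ> \<sigma> = Q) * X P (K \<circ> \<sigma>))"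
proof -
  have finE: "finite E" and finG: "finite G"
    using fin by (auto simp: E G finite_PiE finite_permutations)
  have EG: "I \<circ> \<sigma> \<in> E" if "I \<in> E" "\<sigma> \<in> G" for I \<sigma>
    using that PiE_permutes unfolding E G by blast
  have eq: "(\<forall>s\<in>S. I s = J (\<sigma> s)) \<longleftrightarrow> J \<circ> \<sigma> = I" if "I \<in> E" "J \<in> E" "\<sigma> \<in> G" for I J \<sigma>
    using PiE_ext[of I S "\<lambda>_. B" "J \<circ> \<sigma>"] that EG[of J \<sigma>] unfolding E by auto
  have perm: "(\<Sum>T\<in>Pow S. (-1) ^ card T * (\<Prod>s\<in>S. \<Sum>r\<in>T. of_bool (I s = K r) * of_bool (J s = L r)))
      = (-1) ^ card S * (\<Sum>\<sigma>\<in>G. of_bool (K \<circ> \<sigma> = I) * (of_bool (L \<circ> \<sigma> = J) :: complex))"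
    if "I \<in> E" "J \<in> E" for I J
    unfolding Ryser[OF fin(1)] using eq that KLPQ fin
    by (auto simp: prod.distrib prod_of_bool G intro!: sum.cong)
  let ?M = "\<lambda>T a b. \<Sum>r\<in>T. of_bool (a = K r) * (of_bool (b = L r) :: complex)"
  have commE: "(\<Sum>I\<in>E. X I Q * (\<Prod>s\<in>S. M (P s) (I s))) = (\<Sum>J\<in>E. X P J * (\<Prod>s\<in>S. M (J s) (Q s)))" for M
    using comm KLPQ unfolding commutes_with_power_def E by blast
  have "(\<Sum>T\<in>Pow S. (-1) ^ card T * (\<Sum>I\<in>E. X I Q * (\<Prod>s\<in>S. ?M T (P s) (I s))))
      = (\<Sum>T\<in>Pow S. (-1) ^ card T * (\<Sum>J\<in>E. X P J * (\<Prod>s\<in>S. ?M T (J s) (Q s))))"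
    by (rule sum.cong[OF refl]) (rule arg_cong[OF commE])
  moreover have "(\<Sum>T\<in>Pow S. (-1) ^ card T * (\<Sum>I\<in>E. X I Q * (\<Prod>s\<in>S. ?M T (P s) (I s))))
      = (\<Sum>I\<in>E. X I Q * (\<Sum>T\<in>Pow S. (-1) ^ card T * (\<Prod>s\<in>S. ?M T (P s) (I s))))"
    by (simp only: sum_distrib_left, subst sum.swap) (simp add: mult.left_commute)
  moreover have "\<dots> = (\<Sum>I\<in>E. X I Q * ((-1) ^ card S * (\<Sum>\<sigma>\<in>G. of_bool (K \<circ> \<sigma> = P) * of_bool (L \<circ> \<sigma> = I))))"
    using perm KLPQ by (intro sum.cong) auto
  moreover have "\<dots> = (-1) ^ card S * (\<Sum>\<sigma>\<in>G. of_bool (K \<circ> \<sigma> = P) * (\<Sum>I\<in>E. of_bool (L \<circ> \<sigma> = I) * X I Q))"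
    by (simp only: sum_distrib_left, subst sum.swap) (simp add: mult_ac)
  moreover have "\<dots> = (-1) ^ card S * (\<Sum>\<sigma>\<in>G. of_bool (K \<circ> \<sigma> = P) * X (L \<circ> \<sigma>) Q)"
    using EG KLPQ finE by (auto intro!: sum.cong simp: sum_of_bool_mult)
  moreover have "(\<Sum>T\<in>Pow S. (-1) ^ card T * (\<Sum>J\<in>E. X P J * (\<Prod>s\<in>S. ?M T (J s) (Q s))))
      = (\<Sum>J\<in>E. X P J * (\<Sum>T\<in>Pow S. (-1) ^ card T * (\<Prod>s\<in>S. ?M T (J s) (Q s))))"
    by (simp only: sum_distrib_left, subst sum.swap) (simp add: mult.left_commute)
  moreover have "\<dots> = (\<Sum>J\<in>E. X P J * ((-1) ^ card S * (\<Sum>\<sigma>\<in>G. of_bool (K \<circ> \<sigma> = J) * of_bool (L \<circ> \<sigma> = Q))))"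
    using perm KLPQ by (intro sum.cong) auto
  moreover have "\<dots> = (-1) ^ card S * (\<Sum>\<sigma>\<in>G. of_bool (L \<circ> \<sigma> = Q) * (\<Sum>J\<in>E. of_bool (K \<circ> \<sigma> = J) * X P J))"
    by (simp only: sum_distrib_left, subst sum.swap) (simp add: mult_ac)
  moreover have "\<dots> = (-1) ^ card S * (\<Sum>\<sigma>\<in>G. of_bool (L \<circ> \<sigma> = Q) * X P (K \<circ> \<sigma>))"
    using EG KLPQ finE by (auto intro!: sum.cong simp: sum_of_bool_mult)
  ultimately show ?thesis by simp
qed

section \<open>Products of anticommuting elements\<close>

lemma prod_list_eq_zero: "0 \<in> set xs \<Longrightarrow> prod_list xs = (0::'a::ring_1)"
  by (induction xs) auto

lemma minus_one_power_left: "x * ((-1) ^ n * z) = (-1::'a::ring_1) ^ n * (x * z)"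
  by (cases "even n") simp_all

lemma prod_list_move:
  fixes y :: "'b \<Rightarrow> 'a::ring_1"
  assumes "\<And>v. v \<in> set vs \<Longrightarrow> y x * y v = (-1) ^ q * (y v * y x)"
  shows "y x * prod_list (map y vs) = (-1) ^ (q * length vs) * (prod_list (map y vs) * y x)"
  using assms
proof (induction vs)
  case (Cons v vs)
  have "y x * prod_list (map y (v # vs)) = (y x * y v) * prod_list (map y vs)" by (simp add: mult.assoc)
  also have "\<dots> = (-1) ^ q * (y v * (y x * prod_list (map y vs)))"
    using Cons.prems by (simp add: mult.assoc)
  also have "\<dots> = (-1) ^ q * (-1) ^ (q * length vs) * (y v * (prod_list (map y vs) * y x))"
    using Cons by (simp add: mult.assoc minus_one_power_left[of "y v"])
  finally show ?case by (simp add: mult.assoc power_add)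
qed simp

text \<open>A single parity q treats the commuting and the anticommuting case together. Only
  distinct elements are compared, whereas \<open>anticommuting\<close> includes u = v and so makes
  squares vanish in a complex algebra.\<close>

definition sign_commuting :: "nat \<Rightarrow> ('b \<Rightarrow> 'a::ring_1) \<Rightarrow> 'b set \<Rightarrow> bool"
  where "sign_commuting q y S \<longleftrightarrow> (\<forall>u\<in>S. \<forall>v\<in>S. u \<noteq> v \<longrightarrow> y u * y v = (-1) ^ q * (y v * y u))"

definition anticommuting :: "('b \<Rightarrow> 'a::ring_1) \<Rightarrow> 'b set \<Rightarrow> bool"
  where "anticommuting y S \<longleftrightarrow> (\<forall>u\<in>S. \<forall>v\<in>S. y u * y v = - (y v * y u))"

lemma sign_commutingD: "sign_commuting q y S \<Longrightarrow> u \<in> S \<Longrightarrow> v \<in> S \<Longrightarrow> u \<noteq> v \<Longrightarrow> y u * y v = (-1) ^ q * (y v * y u)"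
  unfolding sign_commuting_def by blast

lemma sign_commuting_subset: "sign_commuting q y S \<Longrightarrow> T \<subseteq> S \<Longrightarrow> sign_commuting q y T"
  unfolding sign_commuting_def by blast

lemma anticommutingD: "anticommuting y S \<Longrightarrow> u \<in> S \<Longrightarrow> v \<in> S \<Longrightarrow> y u * y v = - (y v * y u)"
  unfolding anticommuting_def by blast

lemma anticommuting_subset: "anticommuting y S \<Longrightarrow> T \<subseteq> S \<Longrightarrow> anticommuting y T"
  unfolding anticommuting_def by blast

lemma anticommuting_comp: "anticommuting y S \<Longrightarrow> f ` T \<subseteq> S \<Longrightarrow> anticommuting (\<lambda>t. y (f t)) T"
  unfolding anticommuting_def by blast

lemma inversions_Cons: "inversions (x # xs) = length (filter (\<lambda>z. z < x) xs) + inversions xs"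
proof -
  have "{(s, t). s < t \<and> t < length (x # xs) \<and> (x # xs) ! t < (x # xs) ! s}
      = (\<lambda>t. (0, Suc t)) ` {t. t < length xs \<and> xs ! t < x}
        \<union> map_prod Suc Suc ` {(s, t). s < t \<and> t < length xs \<and> xs ! t < xs ! s}" (is "?L = ?A \<union> ?B")
  proof (rule set_eqI, rule iffI)
    fix p assume p: "p \<in> ?L"
    obtain s t where st: "p = (s, t)" by (cases p)
    with p obtain t' where "t = Suc t'" by (cases t) auto
    with p st show "p \<in> ?A \<union> ?B" by (cases s) (auto simp: image_iff)
  qed auto
  moreover have "?A \<inter> ?B = {}" by auto
  moreover have "finite ?A" "finite ?B"
    by (auto intro!: finite_imageI intro: finite_subset[of _ "{..length xs} \<times> {..length xs}"])
  moreover have "card ?A = length (filter (\<lambda>z. z < x) xs)"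
    by (subst card_image) (auto simp: inj_on_def length_filter_conv_card)
  moreover have "card ?B = inversions xs"
    by (subst card_image) (auto simp: inversions_def inj_on_def)
  ultimately show ?thesis by (simp add: inversions_def card_Un_disjoint)
qed

lemma prod_list_insort:
  fixes y :: "nat \<Rightarrow> 'a::ring_1"
  assumes "\<And>v. v \<in> set vs \<Longrightarrow> v \<noteq> x \<Longrightarrow> y x * y v = (-1) ^ q * (y v * y x)" "sorted vs" "x \<notin> set vs"
  shows "y x * prod_list (map y vs)
    = (-1) ^ (q * length (filter (\<lambda>z. z < x) vs)) * prod_list (map y (insort x vs))"
  using assms
proof (induction vs)
  case (Cons v vs)
  show ?case
  proof (cases "x \<le> v")
    case True
    with Cons.prems have "filter (\<lambda>z. z < x) (v # vs) = []" by (auto simp: filter_empty_conv)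
    then show ?thesis using True by simp
  next
    case False
    have "y x * prod_list (map y (v # vs)) = (y x * y v) * prod_list (map y vs)" by (simp add: mult.assoc)
    also have "\<dots> = (-1) ^ q * (y v * (y x * prod_list (map y vs)))"
      using Cons.prems by (simp add: mult.assoc)
    also have "\<dots> = (-1) ^ q * (-1) ^ (q * length (filter (\<lambda>z. z < x) vs)) * (y v * prod_list (map y (insort x vs)))"
      using Cons by (simp add: mult.assoc minus_one_power_left[of "y v"])
    finally show ?thesis using False by (simp add: mult.assoc power_add)
  qed
qed simp

text \<open>Insertion sort: the head, on its way into the sorted tail, passes exactly the smaller
  elements, and each passage is one inversion and one sign (-1)^q.\<close>

lemma prod_list_inversions:
  fixes y :: "nat \<Rightarrow> 'a::ring_1"
  assumes "distinct xs" "sign_commuting q y (set xs)"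
  shows "prod_list (map y xs) = (-1) ^ (q * inversions xs) * prod_list (map y (sort xs))"
  using assms
proof (induction xs)
  case Nil
  show ?case by (simp add: inversions_def)
next
  case (Cons x xs)
  have "sign_commuting q y (set xs)" using Cons.prems(2) by (rule sign_commuting_subset) auto
  then have "prod_list (map y (x # xs)) = y x * ((-1) ^ (q * inversions xs) * prod_list (map y (sort xs)))"
    using Cons.IH Cons.prems(1) by simp
  also have "\<dots> = (-1) ^ (q * inversions xs) * (y x * prod_list (map y (sort xs)))"
    by (rule minus_one_power_left)
  also have "y x * prod_list (map y (sort xs))
      = (-1) ^ (q * length (filter (\<lambda>z. z < x) (sort xs))) * prod_list (map y (insort x (sort xs)))"
  proof (rule prod_list_insort)
    fix v assume "v \<in> set (sort xs)" "v \<noteq> x"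
    then show "y x * y v = (-1) ^ q * (y v * y x)" by (intro sign_commutingD[OF Cons.prems(2)]) auto
  qed (use Cons.prems(1) in auto)
  also have "length (filter (\<lambda>z. z < x) (sort xs)) = length (filter (\<lambda>z. z < x) xs)"
    by (simp add: filter_sort)
  finally show ?case
    by (simp add: inversions_Cons distrib_left add.commute[of "q * length _"] power_add mult.assoc)
qed

lemma sort_eq_upt:
  assumes "distinct xs" "set xs = {1..n}" shows "sort xs = [1..<Suc n]"
proof (rule sorted_distinct_set_unique)
  show "set (sort xs) = set [1..<Suc n]" by (simp only: set_sort assms set_upt atLeastLessThanSuc_atLeastAtMost)
qed (use assms in \<open>simp_all del: upt_Suc\<close>)

text \<open>The exponent k is chosen before y: it depends on the two arrangements only. The
  invariance of the volume form uses the same k for two different families.\<close>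

lemma prod_list_mset_eq:
  fixes xs ys :: "'b list"
  assumes "mset xs = mset ys"
  shows "\<exists>k. \<forall>y :: 'b \<Rightarrow> 'a::ring_1. anticommuting y (set xs)
    \<longrightarrow> prod_list (map y xs) = (-1) ^ k * prod_list (map y ys)"
  using assms
proof (induction xs arbitrary: ys)
  case (Cons x xs)
  then have "x \<in> set ys" by (metis list.set_intros(1) mset_eq_setD)
  then obtain us vs where ys: "ys = us @ x # vs" by (meson split_list)
  with Cons.prems have "mset xs = mset (us @ vs)" by simp
  from Cons.IH[OF this] obtain k where k:
    "\<And>y :: 'b \<Rightarrow> 'a. anticommuting y (set xs) \<Longrightarrow>
      prod_list (map y xs) = (-1) ^ k * prod_list (map y (us @ vs))" by blast
  have "prod_list (map y (x # xs)) = (-1) ^ (k + length us) * prod_list (map y ys)"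
    if y: "anticommuting y (set (x # xs))" for y :: "'b \<Rightarrow> 'a"
  proof -
    have us: "set us \<subseteq> set (x # xs)"
      using mset_eq_setD[OF Cons.prems] by (auto simp: ys)
    have "anticommuting y (set xs)" using y by (rule anticommuting_subset) auto
    then have "prod_list (map y (x # xs)) = y x * ((-1) ^ k * (prod_list (map y us) * prod_list (map y vs)))"
      using k[of y] by simp
    also have "\<dots> = (-1) ^ k * ((y x * prod_list (map y us)) * prod_list (map y vs))"
      by (simp only: minus_one_power_left mult.assoc)
    also have "y x * prod_list (map y us) = (-1) ^ (1 * length us) * (prod_list (map y us) * y x)"
    proof (rule prod_list_move)
      fix v assume "v \<in> set us"
      then show "y x * y v = (-1) ^ 1 * (y v * y x)" using anticommutingD[OF y, of x v] us by auto
    qed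
    finally show ?thesis by (simp add: ys mult.assoc power_add)
  qed
  then show ?case by blast
qed (simp add: exI[of _ 0])

lemma prod_list_swap:
  fixes y :: "'b \<Rightarrow> 'a::ring_1"
  assumes "anticommuting y (insert a (insert b (set vs)))"
  shows "y a * prod_list (map y vs) * y b = - (y b * prod_list (map y vs) * y a)"
proof -
  note ac = anticommutingD[OF assms]
  have a: "y a * prod_list (map y vs) = (-1) ^ (1 * length vs) * (prod_list (map y vs) * y a)"
    and b: "y b * prod_list (map y vs) = (-1) ^ (1 * length vs) * (prod_list (map y vs) * y b)"
    using ac[of a] ac[of b] by (intro prod_list_move; simp)+
  have "y a * prod_list (map y vs) * y b = (-1) ^ length vs * (prod_list (map y vs) * (y a * y b))"
    unfolding a by (simp add: mult.assoc)
  also have "y a * y b = - (y b * y a)" by (rule ac) auto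
  also have "(-1) ^ length vs * (prod_list (map y vs) * - (y b * y a)) = - (y b * prod_list (map y vs) * y a)"
    unfolding b by (simp add: mult.assoc)
  finally show ?thesis .
qed

lemma prod_list_transpose:
  fixes y :: "nat \<Rightarrow> 'a::ring_1"
  assumes "a \<in> {1..n}" "b \<in> {1..n}" "a < b" "anticommuting y {1..n}"
  shows "prod_list (map (\<lambda>s. y (Transposition.transpose a b s)) [1..<Suc n]) = - prod_list (map y [1..<Suc n])"
proof -
  let ?us = "[1..<a]" and ?vs = "[Suc a..<b]" and ?ws = "[Suc b..<Suc n]"
  have "[1..<Suc n] = ?us @ [a..<Suc n]" using assms(1) upt_add_eq_append[of 1 a "Suc n - a"] by simp
  also have "[a..<Suc n] = a # [Suc a..<Suc n]" using assms(1) upt_conv_Cons[of a "Suc n"] by simp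
  also have "[Suc a..<Suc n] = ?vs @ [b..<Suc n]"
    using assms(2,3) upt_add_eq_append[of "Suc a" b "Suc n - b"] by simp
  also have "[b..<Suc n] = b # ?ws" using assms(2) upt_conv_Cons[of b "Suc n"] by simp
  finally have split: "[1..<Suc n] = ?us @ a # ?vs @ b # ?ws" .
  have eq: "map (\<lambda>s. y (Transposition.transpose a b s)) ?us = map y ?us"
    "map (\<lambda>s. y (Transposition.transpose a b s)) ?vs = map y ?vs"
    "map (\<lambda>s. y (Transposition.transpose a b s)) ?ws = map y ?ws"
    using assms(3) by (auto simp: transpose_def)
  have "anticommuting y (insert a (insert b (set ?vs)))"
    using assms(4) by (rule anticommuting_subset) (use assms(1-3) in auto)
  from prod_list_swap[OF this]
  have swap: "y b * prod_list (map y ?vs) * y a = - (y a * prod_list (map y ?vs) * y b)" by simp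
  have "prod_list (map (\<lambda>s. y (Transposition.transpose a b s)) [1..<Suc n])
      = prod_list (map y ?us) * (y b * prod_list (map y ?vs) * y a) * prod_list (map y ?ws)"
    unfolding split map_append list.map prod_list.append prod_list.Cons eq by (simp add: mult.assoc)
  also have "\<dots> = - prod_list (map y [1..<Suc n])"
    unfolding swap split by (simp add: mult.assoc del: upt_Suc)
  finally show ?thesis .
qed

lemma prod_list_permutes:
  fixes y :: "nat \<Rightarrow> 'a::ring_1"
  assumes "\<sigma> permutes {1..n}" "anticommuting y {1..n}"
  shows "prod_list (map (\<lambda>s. y (\<sigma> s)) [1..<Suc n]) = of_int (sign \<sigma>) * prod_list (map y [1..<Suc n])"
  using finite_atLeastAtMost[of 1 n] assms(1)
proof (induction rule: permutes_rev_induct)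
  case id
  show ?case by simp
next
  case (swap a b \<sigma>)
  have perm: "permutation \<sigma>" using swap.hyps by (auto simp: permutation_permutes)
  have ac: "anticommuting (\<lambda>s. y (\<sigma> s)) {1..n}"
    using assms(2) by (rule anticommuting_comp) (use permutes_image[OF swap.hyps(4)] in simp)
  have "prod_list (map (\<lambda>s. y (\<sigma> (Transposition.transpose a b s))) [1..<Suc n])
      = - prod_list (map (\<lambda>s. y (\<sigma> s)) [1..<Suc n])"
  proof (cases "a < b")
    case True
    show ?thesis by (rule prod_list_transpose[OF swap.hyps(1,2) True ac])
  next
    case False
    then have "b < a" using swap.hyps(3) by simp
    from prod_list_transpose[OF swap.hyps(2,1) this ac] show ?thesis by (simp only: transpose_commute)
  qed
  also have "\<dots> = of_int (- sign \<sigma>) * prod_list (map y [1..<Suc n])"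
    by (simp only: swap.IH of_int_minus mult_minus_left)
  also have "- sign \<sigma> = sign (\<sigma> \<circ> Transposition.transpose a b)"
    using swap.hyps(3) by (subst sign_compose[OF perm permutation_swap_id]) (simp add: sign_swap_id)
  finally show ?case unfolding comp_apply .
qed

lemma eq_neg_self:
  fixes x :: "'a::complex_vector"
  assumes "x = - x" shows "x = 0"
proof -
  have "x + x = 0" using assms by (metis add.left_inverse)
  then have "2 *\<^sub>C x = 0" using scaleC_add_left[of 1 1 x] by (simp add: scaleC_one)
  then show ?thesis by simp
qed

lemma anticommuting_square:
  fixes y :: "'b \<Rightarrow> 'a::complex_algebra_1"
  assumes "anticommuting y S" "u \<in> S"
  shows "y u * y u = 0"
proof -
  have "y u * y u = - (y u * y u)" by (rule anticommutingD[OF assms assms(2)])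
  then show ?thesis by (rule eq_neg_self)
qed

lemma prod_list_repeated:
  fixes y :: "'b \<Rightarrow> 'a::complex_algebra_1"
  assumes "anticommuting y (set xs)" "\<not> distinct xs"
  shows "prod_list (map y xs) = 0"
proof -
  obtain us vs ws a where xs: "xs = us @ a # vs @ a # ws"
    using not_distinct_decomp[OF assms(2)] by auto
  have "y a * prod_list (map y vs) = (-1) ^ (1 * length vs) * (prod_list (map y vs) * y a)"
  proof (rule prod_list_move)
    fix v assume "v \<in> set vs"
    then show "y a * y v = (-1) ^ 1 * (y v * y a)" using anticommutingD[OF assms(1), of a v] xs by simp
  qed
  then have "y a * prod_list (map y vs) * y a = (-1) ^ length vs * (prod_list (map y vs) * (y a * y a))"
    by (simp add: mult.assoc)
  also have "y a * y a = 0" by (rule anticommuting_square[OF assms(1)]) (simp add: xs)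
  finally have "y a * (prod_list (map y vs) * y a) = 0" by (simp add: mult.assoc)
  then have "y a * (prod_list (map y vs) * (y a * z)) = 0" for z
    by (metis mult.assoc mult_zero_left)
  then show ?thesis by (simp add: xs)
qed

section \<open>Traces of powers of a matrix with anticommuting entries\<close>

primrec mat_pow :: "nat \<Rightarrow> (nat \<Rightarrow> nat \<Rightarrow> 'a::ring_1) \<Rightarrow> nat \<Rightarrow> nat \<Rightarrow> nat \<Rightarrow> 'a" where
  "mat_pow N A 0 i j = of_bool (i = j)"
| "mat_pow N A (Suc p) i j = (\<Sum>l\<in>{1..N}. A i l * mat_pow N A p l j)"

definition mat_tr :: "nat \<Rightarrow> (nat \<Rightarrow> nat \<Rightarrow> 'a::ring_1) \<Rightarrow> nat \<Rightarrow> 'a"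
  where "mat_tr N A p = (\<Sum>i\<in>{1..N}. mat_pow N A p i i)"

lemma mat_pow_add:
  assumes "i \<in> {1..N}"
  shows "(\<Sum>l\<in>{1..N}. mat_pow N A p i l * mat_pow N A q l j) = mat_pow N A (p + q) i j"
  using assms
proof (induction p arbitrary: i)
  case 0
  then show ?case by (simp add: sum_of_bool_mult)
next
  case (Suc p)
  have "(\<Sum>l\<in>{1..N}. mat_pow N A (Suc p) i l * mat_pow N A q l j)
      = (\<Sum>k\<in>{1..N}. A i k * (\<Sum>l\<in>{1..N}. mat_pow N A p k l * mat_pow N A q l j))"
    by (simp add: sum_distrib_right sum_distrib_left mult.assoc) (rule sum.swap)
  also have "\<dots> = mat_pow N A (Suc p + q) i j" using Suc.IH by simp
  finally show ?case .
qed

lemma mat_pow_1: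
  assumes "j \<in> {1..N}" shows "mat_pow N A 1 i j = A i j"
proof -
  have "mat_pow N A 1 i j = (\<Sum>l\<in>{1..N}. if l = j then A i l else 0)"
    by (simp add: of_bool_def if_distrib[of "(*) _"] cong: if_cong)
  also have "\<dots> = A i j" using assms by simp
  finally show ?thesis .
qed

text \<open>The product along a cycle cut open at position s: \<open>M (p s)\<close> leads from
  index i to the index of the next position, and the last factor ends in j. The end indices are
  arguments of their own, so that the interior ones can be summed by induction and the cycle closed
  afterwards by j = i.\<close>

fun walk :: "(nat \<Rightarrow> nat \<Rightarrow> nat \<Rightarrow> 'a::ring_1) \<Rightarrow> (nat \<Rightarrow> nat) \<Rightarrow> (nat \<Rightarrow> nat) \<Rightarrow> nat \<Rightarrow> nat \<Rightarrow> nat list \<Rightarrow> nat \<Rightarrow> 'a" where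
  "walk M p I s i [] j = M (p s) i j"
| "walk M p I s i (x # xs) j = M (p s) i (I x) * walk M p I x (I x) xs j"

lemma prod_list_eq_walk:
  assumes "map \<sigma> (s # xs) = xs @ [t]"
  shows "prod_list (map (\<lambda>s. M (p s) (I s) (I (\<sigma> s))) (s # xs)) = walk M p I s (I s) xs (I t)"
  using assms
proof (induction xs arbitrary: s)
  case (Cons x xs)
  then have "\<sigma> s = x" "map \<sigma> (x # xs) = xs @ [t]" by auto
  with Cons.IH[of x] show ?case by simp
qed simp

lemma walk_cong: "(\<And>x. x \<in> set xs \<Longrightarrow> I x = J x) \<Longrightarrow> walk M p I s i xs j = walk M p J s i xs j"
  by (induction xs arbitrary: s i) auto

lemma sum_PiE_insert:
  fixes F :: "('s \<Rightarrow> 'b) \<Rightarrow> 'm::comm_monoid_add"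
  assumes "x \<notin> S"
  shows "(\<Sum>I\<in>insert x S \<rightarrow>\<^sub>E B. F I) = (\<Sum>b\<in>B. \<Sum>I\<in>S \<rightarrow>\<^sub>E B. F (I(x := b)))"
  unfolding PiE_insert_eq sum.cartesian_product
  using inj_combinator[OF assms, of "\<lambda>_. B"]
  by (subst sum.reindex) (auto simp: case_prod_unfold)

text \<open>A Fubini rule for noncommuting factors that depend on disjoint sets of
  coordinates.\<close>

lemma sum_PiE_Un:
  fixes F G :: "('s \<Rightarrow> 'b) \<Rightarrow> 'a::semiring_0"
  assumes "S \<inter> T = {}"
    and F: "\<And>I J. (\<And>x. x \<in> S \<Longrightarrow> I x = J x) \<Longrightarrow> F I = F J"
    and G: "\<And>I J. (\<And>x. x \<in> T \<Longrightarrow> I x = J x) \<Longrightarrow> G I = G J"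
  shows "(\<Sum>I\<in>(S \<union> T) \<rightarrow>\<^sub>E B. F I * G I) = (\<Sum>I\<in>S \<rightarrow>\<^sub>E B. F I) * (\<Sum>I\<in>T \<rightarrow>\<^sub>E B. G I)"
proof -
  have "(\<Sum>I\<in>(S \<union> T) \<rightarrow>\<^sub>E B. F I * G I)
      = (\<Sum>(I, J)\<in>(S \<rightarrow>\<^sub>E B) \<times> (T \<rightarrow>\<^sub>E B). F I * G J)"
  proof (rule sum.reindex_bij_witness[of _ "\<lambda>(I, J) x. if x \<in> S then I x else J x"
        "\<lambda>I. (restrict I S, restrict I T)"])
    fix I assume "I \<in> (S \<union> T) \<rightarrow>\<^sub>E B"
    then show "(case (restrict I S, restrict I T) of (I, J) \<Rightarrow> \<lambda>x. if x \<in> S then I x else J x) = I"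
      and "(restrict I S, restrict I T) \<in> (S \<rightarrow>\<^sub>E B) \<times> (T \<rightarrow>\<^sub>E B)"
      by (auto simp: fun_eq_iff PiE_iff extensional_def)
    show "(case (restrict I S, restrict I T) of (I, J) \<Rightarrow> F I * G J) = F I * G I"
      using F[of "restrict I S" I] G[of "restrict I T" I] by simp
  next
    fix p assume "p \<in> (S \<rightarrow>\<^sub>E B) \<times> (T \<rightarrow>\<^sub>E B)"
    then obtain I J where p: "p = (I, J)" "I \<in> S \<rightarrow>\<^sub>E B" "J \<in> T \<rightarrow>\<^sub>E B" by auto
    show "(case p of (I, J) \<Rightarrow> \<lambda>x. if x \<in> S then I x else J x) \<in> (S \<union> T) \<rightarrow>\<^sub>E B"
      using p by (auto simp: PiE_iff extensional_def)
    have "restrict (\<lambda>x. if x \<in> S then I x else J x) S = I" "restrict (\<lambda>x. if x \<in> S then I x else J x) T = J"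
      using p assms(1) by (fastforce simp: fun_eq_iff PiE_iff extensional_def)+
    then show "(restrict (case p of (I, J) \<Rightarrow> \<lambda>x. if x \<in> S then I x else J x) S,
        restrict (case p of (I, J) \<Rightarrow> \<lambda>x. if x \<in> S then I x else J x) T) = p"
      by (simp add: p)
  qed
  then show ?thesis by (simp add: sum_product sum.cartesian_product)
qed

lemma sum_walk:
  assumes "distinct xs" "i \<in> {1..N}"
  shows "(\<Sum>I\<in>set xs \<rightarrow>\<^sub>E {1..N}. walk (mat_pow N A) p I s i xs j) = mat_pow N A (p s + sum_list (map p xs)) i j"
  using assms
proof (induction xs arbitrary: s i)
  case (Cons x xs)
  have "(\<Sum>I\<in>set (x # xs) \<rightarrow>\<^sub>E {1..N}. walk (mat_pow N A) p I s i (x # xs) j)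
      = (\<Sum>k\<in>{1..N}. \<Sum>I\<in>set xs \<rightarrow>\<^sub>E {1..N}. walk (mat_pow N A) p (I(x := k)) s i (x # xs) j)"
    using Cons.prems by (simp only: list.set) (intro sum_PiE_insert, simp)
  also have "\<dots> = (\<Sum>k\<in>{1..N}. mat_pow N A (p s) i k * (\<Sum>I\<in>set xs \<rightarrow>\<^sub>E {1..N}. walk (mat_pow N A) p I x k xs j))"
  proof (rule sum.cong[OF refl])
    fix k
    have "walk (mat_pow N A) p (I(x := k)) x k xs j = walk (mat_pow N A) p I x k xs j" for I
      using Cons.prems by (intro walk_cong) auto
    then show "(\<Sum>I\<in>set xs \<rightarrow>\<^sub>E {1..N}. walk (mat_pow N A) p (I(x := k)) s i (x # xs) j)
        = mat_pow N A (p s) i k * (\<Sum>I\<in>set xs \<rightarrow>\<^sub>E {1..N}. walk (mat_pow N A) p I x k xs j)"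
      by (simp add: sum_distrib_left)
  qed
  also have "\<dots> = (\<Sum>k\<in>{1..N}. mat_pow N A (p s) i k * mat_pow N A (p x + sum_list (map p xs)) k j)"
    using Cons by (intro sum.cong) auto
  also have "\<dots> = mat_pow N A (p s + sum_list (map p (x # xs))) i j"
    using Cons.prems by (subst mat_pow_add) auto
  finally show ?case .
qed simp

text \<open>Summing over all indices except that of the first position multiplies the matrices
  around the cycle; the sum over the remaining index closes it to a trace.\<close>

lemma sum_cycle:
  fixes p \<sigma> :: "nat \<Rightarrow> nat"
  assumes "distinct c" "c \<noteq> []" "map \<sigma> c = rotate1 c"
  shows "(\<Sum>I\<in>set c \<rightarrow>\<^sub>E {1..N}. prod_list (map (\<lambda>s. mat_pow N A (p s) (I s) (I (\<sigma> s))) c))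
    = mat_tr N A (sum_list (map p c))"
proof -
  obtain s xs where c: "c = s # xs" using assms(2) by (cases c) auto
  have "(\<Sum>I\<in>set c \<rightarrow>\<^sub>E {1..N}. prod_list (map (\<lambda>s. mat_pow N A (p s) (I s) (I (\<sigma> s))) c))
      = (\<Sum>I\<in>insert s (set xs) \<rightarrow>\<^sub>E {1..N}. walk (mat_pow N A) p I s (I s) xs (I s))"
    unfolding c list.set using assms(3) c
    by (intro sum.cong refl prod_list_eq_walk) simp
  also have "\<dots> = (\<Sum>b\<in>{1..N}. \<Sum>I\<in>set xs \<rightarrow>\<^sub>E {1..N}. walk (mat_pow N A) p (I(s := b)) s b xs b)"
    using assms(1) c by (subst sum_PiE_insert) auto
  also have "\<dots> = (\<Sum>b\<in>{1..N}. \<Sum>I\<in>set xs \<rightarrow>\<^sub>E {1..N}. walk (mat_pow N A) p I s b xs b)"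
    using assms(1) c by (intro sum.cong refl walk_cong) auto
  also have "\<dots> = mat_tr N A (sum_list (map p c))"
    unfolding mat_tr_def using assms(1) c by (intro sum.cong refl) (subst sum_walk, auto)
  finally show ?thesis .
qed

lemma sum_cycles:
  fixes p \<sigma> :: "nat \<Rightarrow> nat"
  assumes "distinct (concat cs)" "[] \<notin> set cs" "\<And>c. c \<in> set cs \<Longrightarrow> map \<sigma> c = rotate1 c"
  shows "(\<Sum>I\<in>set (concat cs) \<rightarrow>\<^sub>E {1..N}. prod_list (map (\<lambda>s. mat_pow N A (p s) (I s) (I (\<sigma> s))) (concat cs)))
    = prod_list (map (\<lambda>c. mat_tr N A (sum_list (map p c))) cs)"
  using assms
proof (induction cs)
  case (Cons c cs)
  have image: "\<sigma> x \<in> set d" if "d \<in> set (c # cs)" "x \<in> set d" for x d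
    using Cons.prems(3)[OF that(1)] that(2) by (metis image_eqI list.set_map set_rotate1)
  let ?P = "\<lambda>I cs. prod_list (map (\<lambda>s. mat_pow N A (p s) (I s) (I (\<sigma> s))) cs)"
  have "(\<Sum>I\<in>set (concat (c # cs)) \<rightarrow>\<^sub>E {1..N}. ?P I (concat (c # cs)))
      = (\<Sum>I\<in>(set c \<union> set (concat cs)) \<rightarrow>\<^sub>E {1..N}. ?P I c * ?P I (concat cs))" by simp
  also have "\<dots> = (\<Sum>I\<in>set c \<rightarrow>\<^sub>E {1..N}. ?P I c) * (\<Sum>I\<in>set (concat cs) \<rightarrow>\<^sub>E {1..N}. ?P I (concat cs))"
  proof (rule sum_PiE_Un)
    show "set c \<inter> set (concat cs) = {}" using Cons.prems(1) by simp
    show "?P I c = ?P J c" if "\<And>x. x \<in> set c \<Longrightarrow> I x = J x" for I J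
      using that image[of c] by (intro arg_cong[of _ _ prod_list] map_cong) auto
    show "?P I (concat cs) = ?P J (concat cs)" if "\<And>x. x \<in> set (concat cs) \<Longrightarrow> I x = J x" for I J
    proof (intro arg_cong[of _ _ prod_list] map_cong refl)
      fix s assume s: "s \<in> set (concat cs)"
      then have "\<sigma> s \<in> set (concat cs)" using image by (auto simp del: set_map)
      with s that show "mat_pow N A (p s) (I s) (I (\<sigma> s)) = mat_pow N A (p s) (J s) (J (\<sigma> s))"
        by simp
    qed
  qed
  also have "(\<Sum>I\<in>set c \<rightarrow>\<^sub>E {1..N}. ?P I c) = mat_tr N A (sum_list (map p c))"
    using Cons.prems by (intro sum_cycle) auto
  also have "(\<Sum>I\<in>set (concat cs) \<rightarrow>\<^sub>E {1..N}. ?P I (concat cs)) = prod_list (map (\<lambda>c. mat_tr N A (sum_list (map p c))) cs)"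
    using Cons.prems by (intro Cons.IH) auto
  finally show ?case by simp
qed simp

section \<open>Permutations as products of disjoint cycles\<close>

definition prod_of_cycles :: "'a list list \<Rightarrow> 'a \<Rightarrow> 'a"
  where "prod_of_cycles cs = foldr (\<circ>) (map cycle_of_list cs) id"

lemma prod_of_cycles_Nil: "prod_of_cycles [] = id"
  by (simp add: prod_of_cycles_def id_def)

lemma prod_of_cycles_Cons: "prod_of_cycles (c # cs) = cycle_of_list c \<circ> prod_of_cycles cs"
  by (simp add: prod_of_cycles_def)

lemma prod_of_cycles_outside: "x \<notin> set (concat cs) \<Longrightarrow> prod_of_cycles cs x = x"
  by (induction cs) (auto simp: id_outside_supp prod_of_cycles_Nil prod_of_cycles_Cons)

lemma prod_of_cycles_rotate1:
  assumes "distinct (concat cs)" "c \<in> set cs"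
  shows "map (prod_of_cycles cs) c = rotate1 c"
  using assms
proof (induction cs)
  case (Cons d cs)
  show ?case
  proof (cases "c \<in> set cs")
    case True
    have disj: "set d \<inter> set (concat cs) = {}" "distinct (concat cs)"
      using Cons.prems(1) by auto
    have "map (prod_of_cycles (d # cs)) c = map (cycle_of_list d) (map (prod_of_cycles cs) c)"
      by (simp add: prod_of_cycles_Cons)
    also have "map (prod_of_cycles cs) c = rotate1 c" by (rule Cons.IH[OF disj(2) True])
    also have "map (cycle_of_list d) (rotate1 c) = map id (rotate1 c)"
      using True disj(1) by (intro map_cong refl) (auto intro!: id_outside_supp)
    finally show ?thesis by simp
  next
    case False
    with Cons.prems have d: "c = d" by simp
    have disj: "set d \<inter> set (concat cs) = {}" "distinct d"
      using Cons.prems(1) by auto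
    have "map (prod_of_cycles (d # cs)) d = map (cycle_of_list d) d"
      using disj(1) by (intro map_cong refl) (simp add: prod_of_cycles_Cons prod_of_cycles_outside disjoint_iff del: set_concat)
    also have "\<dots> = rotate1 d" using cyclic_rotation[of d 1] disj(2) by simp
    finally show ?thesis by (simp only: d)
  qed
qed simp

lemma prod_of_cycles_permutes: "prod_of_cycles cs permutes set (concat cs)"
proof (induction cs)
  case Nil
  show ?case by (simp only: prod_of_cycles_Nil permutes_id)
next
  case (Cons c cs)
  have "cycle_of_list c permutes set (concat (c # cs))"
    by (rule permutes_subset[OF cycle_permutes]) auto
  moreover have "prod_of_cycles cs permutes set (concat (c # cs))"
    by (rule permutes_subset[OF Cons.IH]) auto
  ultimately show ?case unfolding prod_of_cycles_Cons by (intro permutes_compose)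
qed

text \<open>Fixed points occur as cycles of length one, so that the cycles exhaust S. Empty cycles
  are dropped, because each would contribute the factor \<open>mat_tr N A 0\<close>, which is N and
  not 1.\<close>

lemma permutes_prod_of_cycles:
  assumes "\<sigma> permutes S" "finite S"
  obtains cs where "distinct (concat cs)" "set (concat cs) = S" "[] \<notin> set cs" "\<sigma> = prod_of_cycles cs"
proof -
  have "cycle_decomp S \<sigma>" using assms by (rule cycle_decomposition)
  then have "\<exists>cs. distinct (concat cs) \<and> set (concat cs) = S \<and> [] \<notin> set cs \<and> \<sigma> = prod_of_cycles cs"
  proof induction
    case empty
    show ?case by (rule exI[of _ "[]"]) (simp add: prod_of_cycles_Nil id_def)
  next
    case (comp I p c)
    then obtain cs where cs: "distinct (concat cs)" "set (concat cs) = I" "[] \<notin> set cs" "p = prod_of_cycles cs"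
      by blast
    show ?case
    proof (cases "c = []")
      case True
      then have "cycle_of_list c \<circ> p = prod_of_cycles cs" "set c \<union> I = set (concat cs)"
        using cs by (simp_all add: id_def comp_def)
      then show ?thesis using cs by blast
    next
      case False
      have "distinct (concat (c # cs))" "set (concat (c # cs)) = set c \<union> I" "[] \<notin> set (c # cs)"
        using cs comp(2,3) False by auto
      note this prod_of_cycles_Cons[of c cs, folded cs(4), symmetric]
      then show ?thesis by (intro exI[of _ "c # cs"] conjI)
    qed
  qed
  then show thesis using that by blast
qed

lemma sign_cycle_of_list:
  assumes "distinct c" shows "sign (cycle_of_list c) = (-1) ^ (length c - 1)"
  using assms
proof (induction c rule: cycle_of_list.induct)
  case (1 i j cs)
  have "sign (cycle_of_list (i # j # cs)) = sign (Transposition.transpose i j) * sign (cycle_of_list (j # cs))"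
    unfolding cycle_of_list.simps(1) by (rule sign_compose[OF permutation_swap_id permutation_of_cycle])
  with 1 show ?case by (simp add: sign_swap_id del: cycle_of_list.simps)
qed (simp_all add: id_def)

lemma of_nat_mult_scaleC: "of_nat n * x = of_nat n *\<^sub>C (x::'a::complex_algebra_1)"
  by (induction n) (simp_all add: distrib_right scaleC_add_left scaleC_one)

section \<open>Commutation signs for powers of an odd matrix, and vanishing of traces\<close>

locale odd_matrix =
  fixes N :: nat and A :: "nat \<Rightarrow> nat \<Rightarrow> 'a::complex_algebra_1"
  assumes anti: "\<And>i j k l. i \<in> {1..N} \<Longrightarrow> j \<in> {1..N} \<Longrightarrow> k \<in> {1..N} \<Longrightarrow> l \<in> {1..N} \<Longrightarrow>
    A i j * A k l = - (A k l * A i j)"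
begin

abbreviation "mpow \<equiv> mat_pow N A"
abbreviation "tr \<equiv> mat_tr N A"

lemma entry_mat_pow:
  assumes "i \<in> {1..N}" "j \<in> {1..N}" "k \<in> {1..N}" "l \<in> {1..N}"
  shows "A i j * mpow q k l = (-1) ^ q * (mpow q k l * A i j)"
  using assms(3)
proof (induction q arbitrary: k)
  case (Suc q)
  have "A i j * mpow (Suc q) k l = (\<Sum>m\<in>{1..N}. A i j * A k m * mpow q m l)"
    by (simp add: sum_distrib_left mult.assoc)
  also have "\<dots> = (\<Sum>m\<in>{1..N}. - (A k m * (A i j * mpow q m l)))"
    using assms Suc.prems by (intro sum.cong refl) (subst anti, auto simp: mult.assoc)
  also have "\<dots> = (\<Sum>m\<in>{1..N}. (-1) ^ Suc q * (A k m * mpow q m l * A i j))"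
    using Suc.IH by (intro sum.cong refl) (simp add: minus_one_power_left[of "A _ _"] mult.assoc)
  finally show ?case by (simp add: sum_distrib_left sum_distrib_right)
qed simp

text \<open>The entries of the powers have degrees p and q in the anticommuting entries of A, so
  that p * q transpositions take place.\<close>

lemma mat_pow_commute:
  assumes "i \<in> {1..N}" "j \<in> {1..N}" "k \<in> {1..N}" "l \<in> {1..N}"
  shows "mpow p i j * mpow q k l = (-1) ^ (p * q) * (mpow q k l * mpow p i j)"
  using assms(1)
proof (induction p arbitrary: i)
  case (Suc p)
  have "mpow (Suc p) i j * mpow q k l = (\<Sum>m\<in>{1..N}. A i m * (mpow p m j * mpow q k l))"
    by (simp add: sum_distrib_right mult.assoc)
  also have "\<dots> = (\<Sum>m\<in>{1..N}. (-1) ^ (p * q) * ((A i m * mpow q k l) * mpow p m j))"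
    using Suc.IH by (intro sum.cong refl) (simp add: minus_one_power_left[of "A _ _"] mult.assoc)
  also have "\<dots> = (\<Sum>m\<in>{1..N}. (-1) ^ (p * q) * ((-1) ^ q * (mpow q k l * A i m) * mpow p m j))"
    using assms Suc.prems by (intro sum.cong refl) (subst entry_mat_pow, auto)
  finally show ?case by (simp add: sum_distrib_left mult.assoc power_add add.commute[of q])
qed simp

text \<open>Rotating the trace cyclically moves one entry past p - 1 others, an odd number, so that
  the trace equals its own negative.\<close>

lemma tr_even: assumes "even p" "p > 0" shows "tr p = 0"
proof -
  obtain q where q: "p = Suc q" using assms(2) gr0_implies_Suc by blast
  have "tr p = (\<Sum>i\<in>{1..N}. \<Sum>l\<in>{1..N}. A i l * mpow q l i)" by (simp add: mat_tr_def q)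
  also have "\<dots> = (\<Sum>i\<in>{1..N}. \<Sum>l\<in>{1..N}. - (mpow q l i * mpow 1 i l))"
    using assms(1) by (intro sum.cong refl, subst entry_mat_pow, simp_all only: mat_pow_1) (simp add: q)
  also have "\<dots> = - (\<Sum>l\<in>{1..N}. \<Sum>i\<in>{1..N}. mpow q l i * mpow 1 i l)"
    unfolding sum_negf by (rule arg_cong[of _ _ uminus]) (rule sum.swap)
  also have "\<dots> = - tr p" unfolding mat_tr_def
    by (intro arg_cong[of _ _ uminus] sum.cong refl) (subst mat_pow_add, simp_all add: q del: mat_pow.simps)
  finally show ?thesis by (rule eq_neg_self)
qed

lemma tr_commute: "tr p * tr q = (-1) ^ (p * q) * (tr q * tr p)"
proof -
  have "tr p * tr q = (\<Sum>i\<in>{1..N}. \<Sum>k\<in>{1..N}. mpow p i i * mpow q k k)"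
    by (simp add: mat_tr_def sum_product)
  also have "\<dots> = (\<Sum>i\<in>{1..N}. \<Sum>k\<in>{1..N}. (-1) ^ (p * q) * (mpow q k k * mpow p i i))"
    by (intro sum.cong refl mat_pow_commute)
  also have "\<dots> = (-1) ^ (p * q) * (\<Sum>i\<in>{1..N}. \<Sum>k\<in>{1..N}. mpow q k k * mpow p i i)"
    by (simp only: sum_distrib_left)
  also have "(\<Sum>i\<in>{1..N}. \<Sum>k\<in>{1..N}. mpow q k k * mpow p i i) = tr q * tr p"
    unfolding mat_tr_def sum_product by (rule sum.swap)
  finally show ?thesis .
qed

lemma tr_anticommuting: "(\<And>p. p \<in> S \<Longrightarrow> odd p) \<Longrightarrow> anticommuting tr S"
  unfolding anticommuting_def
proof (intro ballI)
  fix u v assume "\<And>p. p \<in> S \<Longrightarrow> odd p" "u \<in> S" "v \<in> S"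
  then show "tr u * tr v = - (tr v * tr u)" by (subst tr_commute) simp
qed

text \<open>The parity condition makes the factors at any two distinct positions commute up to the
  uniform sign (-1)^q. Reordering from 1, ..., n to the order of the cycles therefore costs a sign
  determined by the inversions, the same for all I, and then the sum factors over the
  cycles.\<close>

lemma sum_prod_of_cycles:
  assumes "distinct (concat cs)" "set (concat cs) = {1..n}" "[] \<notin> set cs"
    and q: "\<And>u v. u \<in> {1..n} \<Longrightarrow> v \<in> {1..n} \<Longrightarrow> u \<noteq> v \<Longrightarrow> even (p u * p v) \<longleftrightarrow> even q"
  shows "(\<Sum>I\<in>{1..n} \<rightarrow>\<^sub>E {1..N}. prod_list (map (\<lambda>s. mpow (p s) (I s) (I (prod_of_cycles cs s))) [1..<Suc n]))
    = (-1) ^ (q * inversions (concat cs)) * prod_list (map (\<lambda>c. tr (sum_list (map p c))) cs)"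
proof -
  let ?\<sigma> = "prod_of_cycles cs"
  let ?P = "\<lambda>I xs. prod_list (map (\<lambda>s. mpow (p s) (I s) (I (?\<sigma> s))) xs)"
  let ?e = "(-1) ^ (q * inversions (concat cs)) :: 'a"
  have \<sigma>: "?\<sigma> permutes {1..n}" using prod_of_cycles_permutes[of cs] by (simp only: assms(2))
  have "?P I [1..<Suc n] = ?e * ?P I (concat cs)" if I: "I \<in> {1..n} \<rightarrow>\<^sub>E {1..N}" for I
  proof -
    have rng: "I s \<in> {1..N}" "I (?\<sigma> s) \<in> {1..N}" if "s \<in> {1..n}" for s
      using I that permutes_in_image[OF \<sigma>, of s] by auto
    have "sign_commuting q (\<lambda>s. mpow (p s) (I s) (I (?\<sigma> s))) (set (concat cs))"
      unfolding sign_commuting_def assms(2)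
    proof (intro ballI impI)
      fix u v assume uv: "u \<in> {1..n}" "v \<in> {1..n}" "u \<noteq> v"
      have "(-1) ^ (p u * p v) = (-1 :: 'a) ^ q" using q[OF uv] by (cases "even q") auto
      with mat_pow_commute[of "I u" "I (?\<sigma> u)" "I v" "I (?\<sigma> v)" "p u" "p v"] rng uv
      show "mpow (p u) (I u) (I (?\<sigma> u)) * mpow (p v) (I v) (I (?\<sigma> v))
          = (-1) ^ q * (mpow (p v) (I v) (I (?\<sigma> v)) * mpow (p u) (I u) (I (?\<sigma> u)))" by simp
    qed
    from prod_list_inversions[OF assms(1) this]
    have "?P I (concat cs) = ?e * ?P I [1..<Suc n]"
      by (simp only: sort_eq_upt[OF assms(1,2)])
    then show ?thesis by (simp add: mult.assoc[symmetric] flip: power_add mult_2 del: upt_Suc)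
  qed
  then have "(\<Sum>I\<in>{1..n} \<rightarrow>\<^sub>E {1..N}. ?P I [1..<Suc n]) = ?e * (\<Sum>I\<in>set (concat cs) \<rightarrow>\<^sub>E {1..N}. ?P I (concat cs))"
    by (simp only: assms(2) sum_distrib_left cong: sum.cong)
  also have "(\<Sum>I\<in>set (concat cs) \<rightarrow>\<^sub>E {1..N}. ?P I (concat cs)) = prod_list (map (\<lambda>c. tr (sum_list (map p c))) cs)"
    using assms by (intro sum_cycles prod_of_cycles_rotate1) auto
  finally show ?thesis .
qed

definition perm_trace :: "nat \<Rightarrow> (nat \<Rightarrow> nat) \<Rightarrow> 'a"
  where "perm_trace n \<sigma> = (\<Sum>I\<in>{1..n} \<rightarrow>\<^sub>E {1..N}. prod_list (map (\<lambda>s. A (I s) (I (\<sigma> s))) [1..<Suc n]))"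

lemma perm_trace_cycles:
  assumes "distinct (concat cs)" "set (concat cs) = {1..n}" "[] \<notin> set cs"
  shows "perm_trace n (prod_of_cycles cs) = (-1) ^ inversions (concat cs) * prod_list (map (\<lambda>c. tr (length c)) cs)"
proof -
  let ?\<sigma> = "prod_of_cycles cs"
  have \<sigma>: "?\<sigma> permutes {1..n}" using prod_of_cycles_permutes[of cs] by (simp only: assms(2))
  have "perm_trace n ?\<sigma> = (\<Sum>I\<in>{1..n} \<rightarrow>\<^sub>E {1..N}. prod_list (map (\<lambda>s. mpow 1 (I s) (I (?\<sigma> s))) [1..<Suc n]))"
    unfolding perm_trace_def
  proof (intro sum.cong refl arg_cong[of _ _ prod_list] map_cong)
    fix I s assume "I \<in> {1..n} \<rightarrow>\<^sub>E {1..N}" "s \<in> set [1..<Suc n]"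
    then have "I (?\<sigma> s) \<in> {1..N}"
      using permutes_in_image[OF \<sigma>, of s] by (auto simp del: upt_Suc)
    then show "A (I s) (I (?\<sigma> s)) = mpow 1 (I s) (I (?\<sigma> s))" by (simp only: mat_pow_1)
  qed
  also have "\<dots> = (-1) ^ (1 * inversions (concat cs)) * prod_list (map (\<lambda>c. tr (sum_list (map (\<lambda>_. 1) c))) cs)"
    using assms by (intro sum_prod_of_cycles) auto
  finally show ?thesis by (simp add: sum_list_triv)
qed

text \<open>By the pigeonhole principle I agrees at two positions. Composing with their
  transposition leaves the argument of F unchanged and reverses the sign.\<close>

lemma sum_sign_permutes_repeated:
  assumes "finite S" "I \<in> S \<rightarrow> B" "finite B" "card B < card S"
  shows "(\<Sum>\<sigma> | \<sigma> permutes S. of_int (sign \<sigma>) * F (\<lambda>s. I (\<sigma> s))) = (0::'a)"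
proof -
  have "\<not> inj_on I S" using assms card_inj_on_le[of I S B] by auto
  then obtain a b where ab: "a \<in> S" "b \<in> S" "a \<noteq> b" "I a = I b" by (auto simp: inj_on_def)
  have I: "I (Transposition.transpose a b s) = I s" for s using ab by (simp add: transpose_def)
  let ?f = "\<lambda>\<sigma>. of_int (sign \<sigma>) * F (\<lambda>s. I (\<sigma> s)) :: 'a"
  have "(\<Sum>\<sigma> | \<sigma> permutes S. ?f \<sigma>) = (\<Sum>\<sigma> | \<sigma> permutes S. ?f (Transposition.transpose a b \<circ> \<sigma>))"
    using ab by (intro setum_permutations_compose_left permutes_swap_id)
  also have "\<dots> = (\<Sum>\<sigma> | \<sigma> permutes S. - ?f \<sigma>)"
  proof (intro sum.cong refl)
    fix \<sigma> assume "\<sigma> \<in> {\<sigma>. \<sigma> permutes S}"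
    then have "permutation \<sigma>" using assms(1) by (auto simp: permutation_permutes)
    then have "sign (Transposition.transpose a b \<circ> \<sigma>) = - sign \<sigma>"
      using ab(3) by (subst sign_compose[OF permutation_swap_id]) (simp_all add: sign_swap_id)
    then show "?f (Transposition.transpose a b \<circ> \<sigma>) = - ?f \<sigma>"
      by (simp only: comp_apply I of_int_minus mult_minus_left)
  qed
  also have "\<dots> = - (\<Sum>\<sigma> | \<sigma> permutes S. ?f \<sigma>)" by (rule sum_negf)
  finally show ?thesis by (rule eq_neg_self)
qed

text \<open>
  Rosset's argument for the Amitsur-Levitzki theorem, in multilinear form: antisymmetrizing over
  \<open>N + 1\<close> indices gives zero, and all cycles through squares of \<open>A\<close> only have trace zero.
\<close>

lemma tr_large:
  assumes "odd k" "2 * N < k"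
  shows "tr k = 0"
proof -
  let ?n = "Suc N"
  \<comment> \<open>The exponents add up to k and only the last one is odd, so the factors at
    distinct positions commute and reordering produces no sign.\<close>
  define p where "p s = (if s = ?n then k - 2 * N else 2)" for s
  define t where "t \<sigma> = (\<Sum>I\<in>{1..?n} \<rightarrow>\<^sub>E {1..N}. prod_list (map (\<lambda>s. mpow (p s) (I s) (I (\<sigma> s))) [1..<Suc ?n]))" for \<sigma>
  have par: "even (p u * p v) \<longleftrightarrow> even (0::nat)" if "u \<noteq> v" for u v
    using that by (auto simp: p_def)
  have t: "t (prod_of_cycles cs) = prod_list (map (\<lambda>c. tr (sum_list (map p c))) cs)"
    if "distinct (concat cs)" "set (concat cs) = {1..?n}" "[] \<notin> set cs" for cs
    using sum_prod_of_cycles[where p = p and q = 0, OF that par] by (simp add: t_def del: upt_Suc)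
  have sum_p: "sum_list (map p c) = k" if "distinct c" "set c = {1..?n}" for c
  proof -
    have "sum_list (map p c) = (\<Sum>s\<in>{1..?n}. p s)" using that by (simp add: sum_list_distinct_conv_sum_set)
    also have "{1..?n} = insert ?n {1..N}" by auto
    also have "(\<Sum>s\<in>insert ?n {1..N}. p s) = k - 2 * N + (\<Sum>s\<in>{1..N}. 2)"
      by (subst sum.insert) (auto simp: p_def intro!: sum.cong)
    finally show ?thesis using assms by simp
  qed
  define full where "full = {cycle_of_list c | c. distinct c \<and> set c = {1..?n}}"
  have full: "full \<subseteq> {\<sigma>. \<sigma> permutes {1..?n}}"
    unfolding full_def by (auto simp only: mem_Collect_eq) (metis cycle_permutes)
  \<comment> \<open>All full cycles have the same sign (-1)^N and the same trace, so their
    contributions cannot cancel each other.\<close>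
  have t_full: "of_int (sign \<sigma>) * t \<sigma> = (-1) ^ N * tr k" if \<sigma>: "\<sigma> \<in> full" for \<sigma>
  proof -
    obtain c where c: "distinct c" "set c = {1..?n}" "\<sigma> = cycle_of_list c"
      using \<sigma> unfolding full_def by blast
    then have "length c = ?n" using distinct_card[of c] by simp
    moreover have "\<sigma> = prod_of_cycles [c]" using c(3) by (simp add: prod_of_cycles_Cons prod_of_cycles_Nil id_def comp_def)
    ultimately have sign: "sign \<sigma> = (-1) ^ N" and t\<sigma>: "t \<sigma> = t (prod_of_cycles [c])"
      using sign_cycle_of_list[OF c(1)] c(3) by (simp_all only: diff_Suc_1)
    have "distinct (concat [c])" "set (concat [c]) = {1..?n}" "[] \<notin> set [c]"
      using c(1,2) by auto
    from t[OF this] have "t (prod_of_cycles [c]) = tr k"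
      by (simp only: list.map sum_p[OF c(1,2)] prod_list.Cons prod_list.Nil mult_1_right)
    then show ?thesis using sign t\<sigma> by simp
  qed
  have t_not_full: "t \<sigma> = 0" if \<sigma>: "\<sigma> permutes {1..?n}" "\<sigma> \<notin> full" for \<sigma>
  proof -
    obtain cs where cs: "distinct (concat cs)" "set (concat cs) = {1..?n}" "[] \<notin> set cs" "\<sigma> = prod_of_cycles cs"
      using permutes_prod_of_cycles[OF \<sigma>(1)] by auto
    have "?n \<in> set (concat cs)" using cs(2) by simp
    then obtain d where d: "d \<in> set cs" "?n \<in> set d" by auto
    obtain as bs where split: "cs = as @ d # bs" using d(1) by (meson split_list)
    have "as @ bs \<noteq> []"
    proof
      assume "as @ bs = []"
      then have "cs = [d]" using split by simp
      then have "\<sigma> = cycle_of_list d" "distinct d" "set d = {1..?n}"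
        using cs by (simp_all add: prod_of_cycles_Cons prod_of_cycles_Nil id_def comp_def)
      then show False using \<sigma>(2) by (auto simp: full_def)
    qed
    then obtain c where c: "c \<in> set (as @ bs)" using hd_in_set by blast
    have "set c \<inter> set d = {}" using cs(1) c by (auto simp: split)
    then have "sum_list (map p c) = sum_list (map (\<lambda>_. 2) c)"
      using d(2) by (intro arg_cong[of _ _ sum_list] map_cong) (auto simp: p_def)
    moreover have "c \<noteq> []" using c cs(3) by (auto simp: split)
    ultimately have "tr (sum_list (map p c)) = 0"
      by (intro tr_even) (auto simp: sum_list_triv)
    then have "0 \<in> set (map (\<lambda>c. tr (sum_list (map p c))) cs)" using c by (force simp: split)
    then show ?thesis using t[OF cs(1-3)] cs(4) prod_list_eq_zero by metis
  qed
  have "0 = (\<Sum>I\<in>{1..?n} \<rightarrow>\<^sub>E {1..N}. \<Sum>\<sigma> | \<sigma> permutes {1..?n}.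
      of_int (sign \<sigma>) * prod_list (map (\<lambda>s. mpow (p s) (I s) (I (\<sigma> s))) [1..<Suc ?n]))"
  proof (rule sum.neutral[symmetric], rule ballI)
    fix I assume "I \<in> {1..?n} \<rightarrow>\<^sub>E {1..N}"
    then show "(\<Sum>\<sigma> | \<sigma> permutes {1..?n}.
        of_int (sign \<sigma>) * prod_list (map (\<lambda>s. mpow (p s) (I s) (I (\<sigma> s))) [1..<Suc ?n])) = 0"
      by (intro sum_sign_permutes_repeated[where B = "{1..N}" and
            F = "\<lambda>J. prod_list (map (\<lambda>s. mpow (p s) (I s) (J s)) [1..<Suc ?n])"]) (auto simp: PiE_def)
  qed
  also have "\<dots> = (\<Sum>\<sigma> | \<sigma> permutes {1..?n}. of_int (sign \<sigma>) * t \<sigma>)"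
    unfolding t_def sum_distrib_left by (rule sum.swap)
  also have "\<dots> = (\<Sum>\<sigma>\<in>full. of_int (sign \<sigma>) * t \<sigma>)"
    using full t_not_full by (intro sum.mono_neutral_right finite_permutations) auto
  also have "\<dots> = of_nat (card full) * ((-1) ^ N * tr k)"
    using t_full by simp
  finally have eq: "of_nat (card full) * ((-1) ^ N * tr k) = 0" by simp
  have "cycle_of_list [1..<Suc ?n] \<in> full" unfolding full_def by (intro CollectI exI[of _ "[1..<Suc ?n]"]) auto
  moreover have "finite full" by (rule finite_subset[OF full]) (simp add: finite_permutations)
  ultimately have "card full \<noteq> 0" by (metis card_0_eq empty_iff)
  then have "(-1) ^ N * tr k = 0" using eq by (simp add: of_nat_mult_scaleC)
  then show ?thesis by (cases "even N") simp_all
qed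

end

section \<open>Alternating forms on the exterior algebra\<close>

text \<open>The determinant of the pairings of n functionals, numbered from 1, with the n letters,
  numbered from 0. Words of other lengths get 0, so that the degree is detected as well.\<close>

definition alt_word :: "nat \<Rightarrow> (nat \<Rightarrow> 'w \<Rightarrow> complex) \<Rightarrow> 'w list \<Rightarrow> complex"
  where "alt_word n \<psi> ws = (if length ws = n
    then \<Sum>\<sigma> | \<sigma> permutes {1..n}. of_int (sign \<sigma>) * (\<Prod>s\<in>{1..n}. \<psi> s (ws ! (\<sigma> s - 1))) else 0)"

text \<open>Linearity in one letter of a word: each permutation pairs the slot of w with exactly one
  functional, and the other factors do not involve w, so \<open>undefined\<close> may stand in the
  slot when the coefficient is formed.\<close>

lemma alt_word_split:
  "\<exists>c. \<forall>w. alt_word n \<psi> (us @ w # vs) = (\<Sum>\<sigma> | \<sigma> permutes {1..n}. c \<sigma> * \<psi> (inv \<sigma> (Suc (length us))) w)"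
proof (cases "length us + Suc (length vs) = n")
  case True
  let ?k = "Suc (length us)"
  define d where "d \<sigma> = of_int (sign \<sigma>) * (\<Prod>s\<in>{1..n} - {inv \<sigma> ?k}. \<psi> s ((us @ undefined # vs) ! (\<sigma> s - 1)))" for \<sigma>
  have "alt_word n \<psi> (us @ w # vs) = (\<Sum>\<sigma> | \<sigma> permutes {1..n}. d \<sigma> * \<psi> (inv \<sigma> ?k) w)" for w
  proof -
    have "of_int (sign \<sigma>) * (\<Prod>s\<in>{1..n}. \<psi> s ((us @ w # vs) ! (\<sigma> s - 1))) = d \<sigma> * \<psi> (inv \<sigma> ?k) w"
      if \<sigma>: "\<sigma> permutes {1..n}" for \<sigma>
    proof -
      have k: "inv \<sigma> ?k \<in> {1..n}" "\<sigma> (inv \<sigma> ?k) = ?k"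
        using True permutes_in_image[OF permutes_inv[OF \<sigma>], of ?k] permutes_inverses[OF \<sigma>] by auto
      have "(us @ w # vs) ! (\<sigma> s - 1) = (us @ undefined # vs) ! (\<sigma> s - 1)" if "s \<in> {1..n} - {inv \<sigma> ?k}" for s
      proof -
        have "\<sigma> s \<noteq> ?k" using that permutes_inverses(2)[OF \<sigma>, of s] by auto
        moreover have "\<sigma> s \<in> {1..n}" using that permutes_in_image[OF \<sigma>, of s] by auto
        ultimately show ?thesis by (auto simp: nth_append nth_Cons')
      qed
      moreover have "(\<Prod>s\<in>{1..n}. \<psi> s ((us @ w # vs) ! (\<sigma> s - 1))) = \<psi> (inv \<sigma> ?k) ((us @ w # vs) ! (\<sigma> (inv \<sigma> ?k) - 1))
          * (\<Prod>s\<in>{1..n} - {inv \<sigma> ?k}. \<psi> s ((us @ w # vs) ! (\<sigma> s - 1)))"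
        by (rule prod.remove[OF finite_atLeastAtMost k(1)])
      moreover have "(us @ w # vs) ! (\<sigma> (inv \<sigma> ?k) - 1) = w" by (simp add: k(2))
      ultimately show ?thesis by (simp add: d_def mult_ac)
    qed
    then show ?thesis using True by (simp add: alt_word_def)
  qed
  then show ?thesis by blast
next
  case False
  then show ?thesis by (intro exI[of _ "\<lambda>_. 0"]) (simp add: alt_word_def)
qed

text \<open>Transposing the two equal neighbouring letters preserves every product and reverses its
  sign.\<close>

lemma alt_word_square: "alt_word n \<psi> (us @ w # w # vs) = 0"
proof (cases "length us + Suc (Suc (length vs)) = n")
  case True
  let ?k = "Suc (length us)" and ?ws = "us @ w # w # vs"
  let ?t = "Transposition.transpose ?k (Suc ?k)"
  let ?f = "\<lambda>\<sigma>. of_int (sign \<sigma>) * (\<Prod>s\<in>{1..n}. \<psi> s (?ws ! (\<sigma> s - 1)))"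
  have t: "?ws ! (?t s - 1) = ?ws ! (s - 1)" for s
    by (auto simp: transpose_def nth_append)
  have "(\<Sum>\<sigma> | \<sigma> permutes {1..n}. ?f \<sigma>) = (\<Sum>\<sigma> | \<sigma> permutes {1..n}. ?f (?t \<circ> \<sigma>))"
    using True by (intro setum_permutations_compose_left permutes_swap_id) auto
  also have "\<dots> = (\<Sum>\<sigma> | \<sigma> permutes {1..n}. - ?f \<sigma>)"
  proof (intro sum.cong refl)
    fix \<sigma> assume "\<sigma> \<in> {\<sigma>. \<sigma> permutes {1..n}}"
    then have "permutation \<sigma>" by (auto simp: permutation_permutes)
    then have "sign (?t \<circ> \<sigma>) = - sign \<sigma>"
      by (subst sign_compose[OF permutation_swap_id]) (simp_all add: sign_swap_id)
    then show "?f (?t \<circ> \<sigma>) = - ?f \<sigma>"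
      by (simp only: comp_apply t of_int_minus mult_minus_left)
  qed
  also have "\<dots> = - (\<Sum>\<sigma> | \<sigma> permutes {1..n}. ?f \<sigma>)" by (rule sum_negf)
  finally show ?thesis using True by (simp add: alt_word_def)
qed (simp add: alt_word_def)

lemma clinear_mult_zero:
  fixes F :: "'w free_algebra \<Rightarrow> complex"
  assumes "clinear F" "\<And>us vs. F (Poly_Mapping.single (Word us) 1 * r * Poly_Mapping.single (Word vs) 1) = 0"
  shows "F (a * r * b) = 0"
proof -
  have single: "Poly_Mapping.single u c = c *\<^sub>C Poly_Mapping.single u (1::complex)" for u :: "'w fword" and c
    by (rule poly_mapping_eqI) (simp add: lookup_single when_def)
  have "F ((\<Sum>u\<in>Poly_Mapping.keys a. Poly_Mapping.single u (Poly_Mapping.lookup a u)) * r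
      * (\<Sum>v\<in>Poly_Mapping.keys b. Poly_Mapping.single v (Poly_Mapping.lookup b v))) = 0"
    unfolding sum_distrib_left sum_distrib_right clinearD(6)[OF assms(1)]
  proof (intro sum.neutral ballI)
    fix u v
    have "F (Poly_Mapping.single u 1 * r * Poly_Mapping.single v 1) = 0"
      using assms(2)[of "letters u" "letters v"] by simp
    then show "F (Poly_Mapping.single u (Poly_Mapping.lookup a u) * r * Poly_Mapping.single v (Poly_Mapping.lookup b v)) = 0"
      by (subst (1 2) single) (simp add: mult_scaleC_left mult_scaleC_right clinearD(2)[OF assms(1)])
  qed
  then show ?thesis by (simp only: poly_mapping_sum_single)
qed

text \<open>Descent to the quotient. A general multiple of a relator reduces to a relator placed
  between two words; there the linear relators are handled by \<open>alt_word_split\<close> and the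
  squares by \<open>alt_word_square\<close>.\<close>

lemma alt_word_ideal:
  assumes lin: "\<And>s. clinear (\<psi> s)" and "p \<in> ext_ideal"
  shows "free_extend (\<lambda>u. alt_word n \<psi> (letters u)) p = 0"
  using assms(2) unfolding ext_ideal_def
proof (induction rule: cvec.span_induct_alt)
  let ?F = "free_extend (\<lambda>u. alt_word n \<psi> (letters u))"
  have F: "clinear ?F" by (rule free_extend_linear)
  case base
  show ?case by (rule clinearD(3)[OF F])
  case (step c x y)
  then obtain a r b where x: "x = a * r * b" "r \<in> ext_relators" by blast
  have word: "Poly_Mapping.single (Word us) 1 * letter w * Poly_Mapping.single (Word vs) 1
      = Poly_Mapping.single (Word (us @ w # vs)) 1" for us vs w
    by (simp add: letter_def mult_single plus_fword_def)
  have word2: "Poly_Mapping.single (Word us) 1 * (letter w * letter w') * Poly_Mapping.single (Word vs) 1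
      = Poly_Mapping.single (Word (us @ w # w' # vs)) 1" for us vs w w'
    by (simp add: letter_def mult_single plus_fword_def)
  have "?F (a * r * b) = 0"
  proof (rule clinear_mult_zero[OF F])
    fix us vs
    obtain d where d: "\<And>w. alt_word n \<psi> (us @ w # vs)
        = (\<Sum>\<sigma> | \<sigma> permutes {1..n}. d \<sigma> * \<psi> (inv \<sigma> (Suc (length us))) w)"
      using alt_word_split[of n \<psi> us vs] by blast
    show "?F (Poly_Mapping.single (Word us) 1 * r * Poly_Mapping.single (Word vs) 1) = 0"
      using x(2)
    proof cases
      case (add v w)
      then show ?thesis
        by (simp add: left_diff_distrib right_diff_distrib word clinearD(4)[OF F] d clinearD(1)[OF lin]
            distrib_left sum.distrib)
    next
      case (scale c w)
      then show ?thesis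
        by (simp add: left_diff_distrib right_diff_distrib word clinearD(2,4)[OF F] d clinearD(2)[OF lin]
            mult_scaleC_left mult_scaleC_right sum_distrib_left mult.left_commute)
    next
      case (square w)
      then show ?thesis by (simp add: word2 alt_word_square)
    qed
  qed
  then show ?case using step(2) by (simp add: x(1) clinearD(1,2)[OF F])
qed

text \<open>Evaluated on a chosen representative; for linear functionals \<open>alt_form_abs\<close>
  removes the dependence on that choice.\<close>

definition alt_form :: "nat \<Rightarrow> (nat \<Rightarrow> 'w::complex_vector \<Rightarrow> complex) \<Rightarrow> 'w exterior \<Rightarrow> complex"
  where "alt_form n \<psi> x = free_extend (\<lambda>u. alt_word n \<psi> (letters u)) (rep_exterior x)"

lemma prod_ext_inj: "prod_list (map ext_inj ws) = abs_exterior (Poly_Mapping.single (Word ws) 1)"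
  by (simp add: abs_exterior_eval word_eval_def scaleC_one)

lemma alt_form_abs:
  assumes "\<And>s. clinear (\<psi> s)"
  shows "alt_form n \<psi> (abs_exterior p) = free_extend (\<lambda>u. alt_word n \<psi> (letters u)) p"
proof -
  have "ext_rel (rep_exterior (abs_exterior p)) p"
    by (rule Quotient3_rep_abs[OF Quotient3_exterior equivp_reflp[OF ext_rel_equivp]])
  then have "free_extend (\<lambda>u. alt_word n \<psi> (letters u)) (rep_exterior (abs_exterior p) - p) = 0"
    by (intro alt_word_ideal assms) (simp add: ext_rel_def)
  then show ?thesis by (simp add: alt_form_def clinearD(4)[OF free_extend_linear])
qed

lemma alt_form_linear:
  assumes "\<And>s. clinear (\<psi> s)" shows "clinear (alt_form n \<psi>)"
proof (rule clinearI)
  fix x y show "alt_form n \<psi> (x + y) = alt_form n \<psi> x + alt_form n \<psi> y"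
    by (induct x; induct y) (simp add: plus_exterior.abs_eq alt_form_abs[OF assms] clinearD[OF free_extend_linear])
next
  fix c x show "alt_form n \<psi> (c *\<^sub>C x) = c *\<^sub>C alt_form n \<psi> x"
    by (induct x) (simp add: scaleC_exterior.abs_eq alt_form_abs[OF assms] clinearD[OF free_extend_linear])
qed

lemma alt_form_prod:
  assumes "\<And>s. clinear (\<psi> s)"
  shows "alt_form n \<psi> (prod_list (map ext_inj ws)) = alt_word n \<psi> ws"
  by (simp add: prod_ext_inj alt_form_abs[OF assms])

lemma span_prod_ext_inj: "cvec.span (range (\<lambda>ws. prod_list (map ext_inj ws))) = UNIV"
proof -
  have "x \<in> cvec.span (range (\<lambda>ws. prod_list (map ext_inj ws)))" for x :: "'a exterior"
    by (induct x) (unfold abs_exterior_eval word_eval_def free_extend_def,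
        intro cvec.span_sum cvec.span_scale cvec.span_base rangeI)
  then show ?thesis by blast
qed

lemma clinear_eq_on_span:
  assumes "clinear f" "clinear g" "\<And>x. x \<in> S \<Longrightarrow> f x = g x" "x \<in> cvec.span S"
  shows "f x = g x"
  using assms(4) by (induction rule: cvec.span_induct_alt) (simp_all add: clinearD[OF assms(1)] clinearD[OF assms(2)] assms(3))

lemma clinear_eq_on_ext:
  assumes "clinear f" "clinear g" "\<And>ws. f (prod_list (map ext_inj ws)) = g (prod_list (map ext_inj ws))"
  shows "f x = g x"
  by (rule clinear_eq_on_span[OF assms(1,2), of "range (\<lambda>ws. prod_list (map ext_inj ws))"])
    (use assms(3) span_prod_ext_inj in auto)

lemma clinear_compose: "clinear f \<Longrightarrow> clinear g \<Longrightarrow> clinear (\<lambda>x. f (g x))"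
  by (rule clinearI) (simp_all add: clinearD)

lemma clinear_sum: "(\<And>i. i \<in> I \<Longrightarrow> clinear (f i)) \<Longrightarrow> clinear (\<lambda>x. \<Sum>i\<in>I. f i x)"
  by (rule clinearI) (simp_all add: clinearD sum.distrib cvec.scale_sum_right)

lemma clinear_scale: "clinear f \<Longrightarrow> clinear (\<lambda>x. c *\<^sub>C f x)"
  by (rule clinearI) (simp_all add: clinearD scaleC_add_right scaleC_scaleC mult.commute)

lemma clinear_scale_right: "clinear f \<Longrightarrow> clinear (\<lambda>x. f x *\<^sub>C (v :: 'v::complex_vector))"
  by (rule clinearI) (simp_all add: clinearD scaleC_add_left scaleC_scaleC)

lemma alg_homD:
  assumes "alg_hom F"
  shows "clinear F" "F 1 = 1" "F (x * y) = F x * F y" "F (prod_list xs) = prod_list (map F xs)"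
proof -
  show "clinear F" "F 1 = 1" "F (x * y) = F x * F y" for x y using assms by (simp_all add: alg_hom_def)
  then show "F (prod_list xs) = prod_list (map F xs)" by (induction xs) simp_all
qed

lemma alt_form_ext_map:
  assumes "\<And>s. clinear (\<psi> s)" "clinear f"
  shows "alt_form n \<psi> (ext_map f x) = alt_form n (\<lambda>s w. \<psi> s (f w)) x"
proof (rule clinear_eq_on_ext[where f = "\<lambda>x. alt_form n \<psi> (ext_map f x)"])
  note E = ext_map[OF assms(2)]
  have \<psi>f: "clinear (\<lambda>w. \<psi> s (f w))" for s by (rule clinear_compose[OF assms])
  show "clinear (\<lambda>x. alt_form n \<psi> (ext_map f x))"
    by (rule clinear_compose[OF alt_form_linear[OF assms(1)] alg_homD(1)[OF E(1)]])
  show "clinear (alt_form n (\<lambda>s w. \<psi> s (f w)))" by (intro alt_form_linear \<psi>f)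
  fix ws
  have "ext_map f (prod_list (map ext_inj ws)) = prod_list (map ext_inj (map f ws))"
    by (simp add: alg_homD(4)[OF E(1)] E(2) o_def)
  then have "alt_form n \<psi> (ext_map f (prod_list (map ext_inj ws))) = alt_word n \<psi> (map f ws)"
    by (simp only: alt_form_prod[OF assms(1)])
  also have "\<dots> = alt_word n (\<lambda>s w. \<psi> s (f w)) ws"
  proof (cases "length ws = n")
    case True
    have "map f ws ! (\<sigma> s - 1) = f (ws ! (\<sigma> s - 1))" if "\<sigma> permutes {1..n}" "s \<in> {1..n}" for \<sigma> s
      using permutes_in_image[OF that(1), of s] that(2) True by (intro nth_map) auto
    then show ?thesis using True by (auto simp: alt_word_def intro!: sum.cong prod.cong)
  qed (simp add: alt_word_def)
  finally show "alt_form n \<psi> (ext_map f (prod_list (map ext_inj ws)))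
      = alt_form n (\<lambda>s w. \<psi> s (f w)) (prod_list (map ext_inj ws))"
    by (simp only: alt_form_prod[OF \<psi>f])
qed

lemma alt_form_multilinear:
  assumes "finite B" "\<And>s i. clinear (\<psi> s i)"
  shows "alt_form n (\<lambda>s w. \<Sum>i\<in>B. c s i * \<psi> s i w) x
    = (\<Sum>I\<in>{1..n} \<rightarrow>\<^sub>E B. (\<Prod>s\<in>{1..n}. c s (I s)) * alt_form n (\<lambda>s. \<psi> s (I s)) x)"
proof (rule clinear_eq_on_ext[where g = "\<lambda>x. \<Sum>I\<in>{1..n} \<rightarrow>\<^sub>E B. (\<Prod>s\<in>{1..n}. c s (I s)) * alt_form n (\<lambda>s. \<psi> s (I s)) x"])
  have lin: "clinear (\<lambda>w. \<Sum>i\<in>B. c s i * \<psi> s i w)" for s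
    using clinear_sum[of B "\<lambda>i w. c s i *\<^sub>C \<psi> s i w"] assms(2) by (simp add: clinear_scale del: scaleC_complex_def) simp
  show "clinear (alt_form n (\<lambda>s w. \<Sum>i\<in>B. c s i * \<psi> s i w))" by (intro alt_form_linear lin)
  show "clinear (\<lambda>x. \<Sum>I\<in>{1..n} \<rightarrow>\<^sub>E B. (\<Prod>s\<in>{1..n}. c s (I s)) * alt_form n (\<lambda>s. \<psi> s (I s)) x)"
    unfolding scaleC_complex_def[symmetric]
    by (intro clinear_sum clinear_scale alt_form_linear assms(2))
  fix ws :: "'b list"
  show "alt_form n (\<lambda>s w. \<Sum>i\<in>B. c s i * \<psi> s i w) (prod_list (map ext_inj ws))
      = (\<Sum>I\<in>{1..n} \<rightarrow>\<^sub>E B. (\<Prod>s\<in>{1..n}. c s (I s)) * alt_form n (\<lambda>s. \<psi> s (I s)) (prod_list (map ext_inj ws)))"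
  proof (cases "length ws = n")
    case True
    have "(\<Prod>s\<in>{1..n}. \<Sum>i\<in>B. c s i * \<psi> s i (ws ! (\<sigma> s - 1)))
        = (\<Sum>I\<in>{1..n} \<rightarrow>\<^sub>E B. (\<Prod>s\<in>{1..n}. c s (I s)) * (\<Prod>s\<in>{1..n}. \<psi> s (I s) (ws ! (\<sigma> s - 1))))" for \<sigma>
      using assms(1) by (subst prod_sum_PiE) (auto simp: prod.distrib)
    then show ?thesis using True
      by (simp only: alt_form_prod[OF lin] alt_form_prod[OF assms(2)] alt_word_def if_True sum_distrib_left)
        (subst sum.swap, simp add: sum_distrib_left mult.left_commute)
  qed (simp add: alt_form_prod[OF lin] alt_form_prod[OF assms(2)] alt_word_def)
qed

section \<open>Functionals on the tensor product of V and its dual\<close>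

definition tensor_pair :: "'v::complex_vector dual \<Rightarrow> 'v \<Rightarrow> ('v, 'v dual) tensor \<Rightarrow> complex"
  where "tensor_pair f v = (THE T. clinear T \<and> (\<forall>v' f'. T (v' \<otimes>\<^sub>C f') = dual_apply f v' * dual_apply f' v))"

lemma dual_apply_linear: "clinear (dual_apply f)"
  using dual_apply[of f] by simp

lemma tensor_pair:
  "clinear (tensor_pair f v)" "tensor_pair f v (v' \<otimes>\<^sub>C f') = dual_apply f v' * dual_apply f' v"
proof -
  have "\<exists>!T. clinear T \<and> (\<forall>v' f'. T (v' \<otimes>\<^sub>C f') = dual_apply f v' * dual_apply f' v)"
    by (rule tensor_universal)
      (auto intro!: clinearI simp: clinearD[OF dual_apply_linear] algebra_simps plus_dual.rep_eq scaleC_dual.rep_eq)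
  from theI'[OF this] show "clinear (tensor_pair f v)" "tensor_pair f v (v' \<otimes>\<^sub>C f') = dual_apply f v' * dual_apply f' v"
    unfolding tensor_pair_def by blast+
qed

lemma span_tprod: "cvec.span (range (\<lambda>(v, f). v \<otimes>\<^sub>C f)) = UNIV"
proof -
  have "x \<in> cvec.span (range (\<lambda>(v, f). v \<otimes>\<^sub>C f))" for x :: "('a, 'b) tensor"
    by (induct x) (unfold tensor_eq_sum case_prod_unfold,
        intro cvec.span_sum cvec.span_scale cvec.span_base range_eqI[where x = "(_, _)"], simp)
  then show ?thesis by blast
qed

lemma clinear_eq_on_tensor:
  assumes "clinear f" "clinear g" "\<And>v w. f (v \<otimes>\<^sub>C w) = g (v \<otimes>\<^sub>C w)"
  shows "f x = g x"
  by (rule clinear_eq_on_span[OF assms(1,2), of "range (\<lambda>(v, f). v \<otimes>\<^sub>C f)"])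
    (use assms(3) span_tprod in auto)

section \<open>Coordinates on the exterior algebra of a matrix space\<close>

lemma ext_inj_anticommute: "ext_inj v * ext_inj w = - (ext_inj w * ext_inj v)"
proof -
  have "0 = ext_inj (v + w) * ext_inj (v + w)" by (rule ext_inj_square[symmetric])
  also have "\<dots> = ext_inj v * ext_inj w + ext_inj w * ext_inj v"
    by (simp add: clinearD(1)[OF ext_inj_linear] distrib_left distrib_right ext_inj_square)
  finally show ?thesis by (simp add: eq_neg_iff_add_eq_0)
qed

lemma dual_apply_arg_linear: "clinear (\<lambda>f. dual_apply f v)"
  by (rule clinearI) (simp_all add: plus_dual.rep_eq scaleC_dual.rep_eq)

lemma tprod_linear: "clinear (\<lambda>v. v \<otimes>\<^sub>C w)" "clinear (\<lambda>w. v \<otimes>\<^sub>C w)"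
  by (auto intro!: clinearI simp: tprod_add_left tprod_add_right tprod_scale_left tprod_scale_right)

lemma span_mult_left:
  fixes S :: "'a::complex_algebra_1 set"
  assumes "x \<in> cvec.span S" "\<And>y. y \<in> S \<Longrightarrow> a * y \<in> cvec.span S"
  shows "a * x \<in> cvec.span S"
  using assms(1)
  by (induction rule: cvec.span_induct_alt)
    (simp_all add: cvec.span_zero distrib_left mult_scaleC_right cvec.span_add cvec.span_scale assms(2))

locale matrix_units =
  fixes e :: "nat \<Rightarrow> 'v::complex_vector" and e' :: "nat \<Rightarrow> 'v dual" and N :: nat
    and A :: "nat \<Rightarrow> nat \<Rightarrow> ('v, 'v dual) tensor exterior"
  assumes inj_e: "inj_on e {1..N}"
    and independent_e: "cvec.independent (e ` {1..N})"
    and span_e: "cvec.span (e ` {1..N}) = UNIV"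
    and dual: "\<And>i j. i \<in> {1..N} \<Longrightarrow> j \<in> {1..N} \<Longrightarrow> dual_apply (e' j) (e i) = of_bool (i = j)"
    and A: "\<And>i j. i \<in> {1..N} \<Longrightarrow> j \<in> {1..N} \<Longrightarrow> A i j = ext_inj (e i \<otimes>\<^sub>C e' j)"
begin

sublocale odd_matrix N A
  by unfold_locales (simp only: A, rule ext_inj_anticommute)

lemma vector_expand: "v = (\<Sum>i\<in>{1..N}. dual_apply (e' i) v *\<^sub>C e i)"
proof (rule clinear_eq_on_span[where S = "e ` {1..N}" and f = "\<lambda>v. v"])
  show "clinear (\<lambda>v::'v. v)" by (rule clinearI) simp_all
  show "clinear (\<lambda>v. \<Sum>i\<in>{1..N}. dual_apply (e' i) v *\<^sub>C e i)"
    by (intro clinear_sum clinear_scale_right dual_apply_linear)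
  fix x assume "x \<in> e ` {1..N}"
  then obtain j where j: "j \<in> {1..N}" "x = e j" by blast
  then have "(\<Sum>i\<in>{1..N}. dual_apply (e' i) x *\<^sub>C e i) = (\<Sum>i\<in>{1..N}. if i = j then e j else 0)"
    by (intro sum.cong) (auto simp: dual scaleC_one)
  then show "x = (\<Sum>i\<in>{1..N}. dual_apply (e' i) x *\<^sub>C e i)" using j by simp
qed (simp_all only: span_e UNIV_I)

lemma dual_expand: "f = (\<Sum>j\<in>{1..N}. dual_apply f (e j) *\<^sub>C e' j)"
proof (rule dual_apply_inject[THEN iffD1], rule ext)
  fix v
  have "dual_apply f v = dual_apply f (\<Sum>i\<in>{1..N}. dual_apply (e' i) v *\<^sub>C e i)"
    by (rule arg_cong[OF vector_expand])
  also have "\<dots> = (\<Sum>i\<in>{1..N}. dual_apply (e' i) v * dual_apply f (e i))"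
    by (simp add: clinearD(2,6)[OF dual_apply_linear])
  also have "\<dots> = dual_apply (\<Sum>j\<in>{1..N}. dual_apply f (e j) *\<^sub>C e' j) v"
    by (simp add: clinearD(2,6)[OF dual_apply_arg_linear] mult.commute)
  finally show "dual_apply f v = dual_apply (\<Sum>j\<in>{1..N}. dual_apply f (e j) *\<^sub>C e' j) v" .
qed

lemma tensor_expand:
  "w = (\<Sum>i\<in>{1..N}. \<Sum>j\<in>{1..N}. tensor_pair (e' i) (e j) w *\<^sub>C (e i \<otimes>\<^sub>C e' j))"
proof (rule clinear_eq_on_tensor[where f = "\<lambda>w. w"])
  show "clinear (\<lambda>w::('v, 'v dual) tensor. w)" by (rule clinearI) simp_all
  show "clinear (\<lambda>w. \<Sum>i\<in>{1..N}. \<Sum>j\<in>{1..N}. tensor_pair (e' i) (e j) w *\<^sub>C (e i \<otimes>\<^sub>C e' j))"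
    by (intro clinear_sum clinear_scale_right tensor_pair)
  fix v f
  have "v \<otimes>\<^sub>C f = (\<Sum>i\<in>{1..N}. dual_apply (e' i) v *\<^sub>C e i) \<otimes>\<^sub>C (\<Sum>j\<in>{1..N}. dual_apply f (e j) *\<^sub>C e' j)"
    by (rule arg_cong2[OF vector_expand dual_expand])
  also have "\<dots> = (\<Sum>i\<in>{1..N}. dual_apply (e' i) v *\<^sub>C (e i \<otimes>\<^sub>C (\<Sum>j\<in>{1..N}. dual_apply f (e j) *\<^sub>C e' j)))"
    by (simp only: clinearD(6)[OF tprod_linear(1)] tprod_scale_left)
  also have "\<dots> = (\<Sum>i\<in>{1..N}. \<Sum>j\<in>{1..N}. tensor_pair (e' i) (e j) (v \<otimes>\<^sub>C f) *\<^sub>C (e i \<otimes>\<^sub>C e' j))"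
    by (simp only: clinearD(6)[OF tprod_linear(2)] tprod_scale_right cvec.scale_sum_right scaleC_scaleC tensor_pair(2))
  finally show "v \<otimes>\<^sub>C f = (\<Sum>i\<in>{1..N}. \<Sum>j\<in>{1..N}. tensor_pair (e' i) (e j) (v \<otimes>\<^sub>C f) *\<^sub>C (e i \<otimes>\<^sub>C e' j))" .
qed

definition monomial :: "nat \<Rightarrow> (nat \<Rightarrow> nat) \<Rightarrow> (nat \<Rightarrow> nat) \<Rightarrow> ('v, 'v dual) tensor exterior"
  where "monomial n P Q = prod_list (map (\<lambda>s. A (P s) (Q s)) [1..<Suc n])"

abbreviation tuples :: "nat \<Rightarrow> (nat \<Rightarrow> nat) set"
  where "tuples n \<equiv> {1..n} \<rightarrow>\<^sub>E {1..N}"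

lemma finite_tuples: "finite (tuples n)"
  by (intro finite_PiE) auto

lemma prod_list_pairs_monomial:
  assumes "set ps \<subseteq> {1..N} \<times> {1..N}"
  obtains P Q where "P \<in> tuples (length ps)" "Q \<in> tuples (length ps)"
    "prod_list (map (\<lambda>(i, j). A i j) ps) = monomial (length ps) P Q"
proof
  let ?P = "\<lambda>s\<in>{1..length ps}. fst (ps ! (s - 1))" and ?Q = "\<lambda>s\<in>{1..length ps}. snd (ps ! (s - 1))"
  have nth: "ps ! (s - 1) \<in> {1..N} \<times> {1..N}" if "s \<in> {1..length ps}" for s
    using that nth_mem[of "s - 1" ps] assms by (meson atLeastAtMost_iff diff_less less_le_trans subsetD zero_less_one order_less_le_trans)
  show "?P \<in> tuples (length ps)" "?Q \<in> tuples (length ps)"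
    using nth by (auto simp: mem_Times_iff)
  have "map (\<lambda>(i, j). A i j) ps = map (\<lambda>s. A (?P s) (?Q s)) [1..<Suc (length ps)]"
    by (rule nth_equalityI) (simp_all add: case_prod_unfold del: upt_Suc)
  then show "prod_list (map (\<lambda>(i, j). A i j) ps) = monomial (length ps) ?P ?Q"
    by (simp only: monomial_def)
qed

lemma span_monomial: "cvec.span {monomial n P Q | n P Q. P \<in> tuples n \<and> Q \<in> tuples n} = UNIV"
proof -
  define L where "L = {prod_list (map (\<lambda>(i, j). A i j) ps) | ps. set ps \<subseteq> {1..N} \<times> {1..N}}"
  have mult: "ext_inj w * x \<in> cvec.span L" if x: "x \<in> cvec.span L" for w x
  proof (rule span_mult_left[OF x])
    fix y assume "y \<in> L"
    then obtain ps where ps: "y = prod_list (map (\<lambda>(i, j). A i j) ps)" "set ps \<subseteq> {1..N} \<times> {1..N}"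
      by (auto simp: L_def)
    have L: "A i j * y \<in> L" if "i \<in> {1..N}" "j \<in> {1..N}" for i j
      unfolding L_def by (intro CollectI exI[of _ "(i, j) # ps"]) (use that ps in simp)
    have "ext_inj w = (\<Sum>i\<in>{1..N}. \<Sum>j\<in>{1..N}. tensor_pair (e' i) (e j) w *\<^sub>C A i j)"
      by (subst tensor_expand[of w]) (simp add: clinearD(2,6)[OF ext_inj_linear] A)
    then have "ext_inj w * y = (\<Sum>i\<in>{1..N}. \<Sum>j\<in>{1..N}. tensor_pair (e' i) (e j) w *\<^sub>C (A i j * y))"
      by (simp add: sum_distrib_right mult_scaleC_left)
    also have "\<dots> \<in> cvec.span L"
      using L by (intro cvec.span_sum cvec.span_scale cvec.span_base)
    finally show "ext_inj w * y \<in> cvec.span L" .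
  qed
  have "prod_list (map ext_inj ws) \<in> cvec.span L" for ws
  proof (induction ws)
    case Nil
    show ?case unfolding L_def by (intro cvec.span_base CollectI exI[of _ "[]"]) simp
  qed (simp add: mult)
  then have "cvec.span L = UNIV"
    using span_prod_ext_inj cvec.span_minimal[OF _ cvec.subspace_span, of "range (\<lambda>ws. prod_list (map ext_inj ws))" L]
    by blast
  moreover have "L \<subseteq> {monomial n P Q | n P Q. P \<in> tuples n \<and> Q \<in> tuples n}"
  proof
    fix x assume "x \<in> L"
    then obtain ps where ps: "x = prod_list (map (\<lambda>(i, j). A i j) ps)" "set ps \<subseteq> {1..N} \<times> {1..N}"
      unfolding L_def by blast
    obtain P Q where "P \<in> tuples (length ps)" "Q \<in> tuples (length ps)" "x = monomial (length ps) P Q"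
      using prod_list_pairs_monomial[OF ps(2)] ps(1) by metis
    then show "x \<in> {monomial n P Q | n P Q. P \<in> tuples n \<and> Q \<in> tuples n}" by blast
  qed
  ultimately show ?thesis using cvec.span_mono by blast
qed

text \<open>Reads off the coefficient of the monomial with row indices P and column indices Q; as
  \<open>coord_monomial\<close> shows, reorderings of that monomial also count, with their
  signs.\<close>

definition coord :: "nat \<Rightarrow> (nat \<Rightarrow> nat) \<Rightarrow> (nat \<Rightarrow> nat) \<Rightarrow> ('v, 'v dual) tensor exterior \<Rightarrow> complex"
  where "coord n P Q = alt_form n (\<lambda>s. tensor_pair (e' (P s)) (e (Q s)))"

lemma coord_linear: "clinear (coord n P Q)"
  unfolding coord_def by (intro alt_form_linear tensor_pair)

lemma monomial_ext_inj:
  assumes "P \<in> tuples n" "Q \<in> tuples n"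
  shows "monomial n P Q = prod_list (map ext_inj (map (\<lambda>s. e (P s) \<otimes>\<^sub>C e' (Q s)) [1..<Suc n]))"
proof -
  have "A (P s) (Q s) = ext_inj (e (P s) \<otimes>\<^sub>C e' (Q s))" if "s \<in> set [1..<Suc n]" for s
    using that assms by (intro A) (auto simp del: upt_Suc)
  then show ?thesis unfolding monomial_def map_map comp_def by (intro arg_cong[of _ _ prod_list] map_cong refl)
qed

lemma coord_monomial:
  assumes PQ: "P \<in> tuples n" "Q \<in> tuples n" and PQ': "P' \<in> tuples m" "Q' \<in> tuples m"
  shows "coord n P Q (monomial m P' Q') = (if m = n then
    \<Sum>\<sigma> | \<sigma> permutes {1..n}. of_int (sign \<sigma>) * (of_bool (P' \<circ> \<sigma> = P) * of_bool (Q' \<circ> \<sigma> = Q)) else 0)"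
proof (cases "m = n")
  case True
  let ?ws = "map (\<lambda>s. e (P' s) \<otimes>\<^sub>C e' (Q' s)) [1..<Suc n]"
  have "(\<Prod>s\<in>{1..n}. tensor_pair (e' (P s)) (e (Q s)) (?ws ! (\<sigma> s - 1))) = of_bool (P' \<circ> \<sigma> = P) * of_bool (Q' \<circ> \<sigma> = Q)"
    if \<sigma>: "\<sigma> permutes {1..n}" for \<sigma>
  proof -
    have \<sigma>s: "\<sigma> s \<in> {1..n}" if "s \<in> {1..n}" for s using permutes_in_image[OF \<sigma>] that by simp
    have "(\<Prod>s\<in>{1..n}. tensor_pair (e' (P s)) (e (Q s)) (?ws ! (\<sigma> s - 1)))
        = (\<Prod>s\<in>{1..n}. of_bool (P' (\<sigma> s) = P s) * of_bool (Q' (\<sigma> s) = Q s))"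
    proof (rule prod.cong[OF refl])
      fix s assume s: "s \<in> {1..n}"
      then have "?ws ! (\<sigma> s - 1) = e (P' (\<sigma> s)) \<otimes>\<^sub>C e' (Q' (\<sigma> s))"
        using \<sigma>s[OF s] by (subst nth_map) (auto simp: nth_upt simp del: upt_Suc)
      moreover have "P s \<in> {1..N}" "Q s \<in> {1..N}" "P' (\<sigma> s) \<in> {1..N}" "Q' (\<sigma> s) \<in> {1..N}"
        using PiE_mem[OF PQ(1) s] PiE_mem[OF PQ(2) s] PiE_mem[OF PQ'(1)[unfolded True] \<sigma>s[OF s]]
          PiE_mem[OF PQ'(2)[unfolded True] \<sigma>s[OF s]] by simp_all
      ultimately show "tensor_pair (e' (P s)) (e (Q s)) (?ws ! (\<sigma> s - 1)) = of_bool (P' (\<sigma> s) = P s) * of_bool (Q' (\<sigma> s) = Q s)"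
        by (simp only: tensor_pair dual eq_commute[of "Q s"])
    qed
    also have "\<dots> = of_bool (\<forall>s\<in>{1..n}. (P' \<circ> \<sigma>) s = P s) * of_bool (\<forall>s\<in>{1..n}. (Q' \<circ> \<sigma>) s = Q s)"
      by (simp only: prod.distrib prod_of_bool finite_atLeastAtMost comp_apply)
    also have "(\<forall>s\<in>{1..n}. (P' \<circ> \<sigma>) s = P s) \<longleftrightarrow> P' \<circ> \<sigma> = P"
      using PiE_ext[OF PiE_permutes[OF PQ'(1)[unfolded True] \<sigma>] PQ(1)] by metis
    also have "(\<forall>s\<in>{1..n}. (Q' \<circ> \<sigma>) s = Q s) \<longleftrightarrow> Q' \<circ> \<sigma> = Q"
      using PiE_ext[OF PiE_permutes[OF PQ'(2)[unfolded True] \<sigma>] PQ(2)] by metis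
    finally show ?thesis .
  qed
  moreover have "length ?ws = n" by simp
  ultimately show ?thesis
    unfolding monomial_ext_inj[OF PQ'] coord_def alt_form_prod[OF tensor_pair(1)]
    by (simp add: True alt_word_def del: upt_Suc)
next
  case False
  then show ?thesis
    unfolding monomial_ext_inj[OF PQ'] coord_def alt_form_prod[OF tensor_pair(1)]
    by (simp add: alt_word_def del: upt_Suc)
qed

text \<open>The homogeneous component of degree n, rebuilt from coordinates. A monomial is met once
  for each of the n! reorderings of its factors, and the sign of the coordinate cancels that of the
  reordered monomial; this accounts for the factor 1 / n!.\<close>

definition proj :: "nat \<Rightarrow> ('v, 'v dual) tensor exterior \<Rightarrow> ('v, 'v dual) tensor exterior"
  where "proj n x = (1 / fact n) *\<^sub>C (\<Sum>P\<in>tuples n. \<Sum>Q\<in>tuples n. coord n P Q x *\<^sub>C monomial n P Q)"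

lemma proj_linear: "clinear (proj n)"
  unfolding proj_def by (intro clinear_scale clinear_sum clinear_scale_right coord_linear)

lemma monomial_permutes:
  assumes "P \<in> tuples n" "Q \<in> tuples n" "\<sigma> permutes {1..n}"
  shows "monomial n (P \<circ> \<sigma>) (Q \<circ> \<sigma>) = of_int (sign \<sigma>) * monomial n P Q"
proof -
  have "anticommuting (\<lambda>s. A (P s) (Q s)) {1..n}"
    unfolding anticommuting_def using assms(1,2) by (intro ballI anti) auto
  from prod_list_permutes[OF assms(3) this] show ?thesis by (simp only: monomial_def comp_apply)
qed

lemma proj_monomial:
  assumes "P \<in> tuples m" "Q \<in> tuples m"
  shows "proj n (monomial m P Q) = (if n = m then monomial m P Q else 0)"
proof (cases "n = m")
  case True
  have "(\<Sum>P'\<in>tuples n. \<Sum>Q'\<in>tuples n. coord n P' Q' (monomial m P Q) *\<^sub>C monomial n P' Q')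
      = (\<Sum>P'\<in>tuples n. \<Sum>Q'\<in>tuples n. \<Sum>\<sigma> | \<sigma> permutes {1..n}.
          (of_int (sign \<sigma>) * (of_bool (P \<circ> \<sigma> = P') * of_bool (Q \<circ> \<sigma> = Q'))) *\<^sub>C monomial n P' Q')"
    using coord_monomial[OF _ _ assms] True by (simp add: cvec.scale_sum_left cong: sum.cong)
  also have "\<dots> = (\<Sum>\<sigma> | \<sigma> permutes {1..n}. \<Sum>P'\<in>tuples n. \<Sum>Q'\<in>tuples n.
          (of_int (sign \<sigma>) * (of_bool (P \<circ> \<sigma> = P') * of_bool (Q \<circ> \<sigma> = Q'))) *\<^sub>C monomial n P' Q')"
    by (rule sum_rotate)
  also have "\<dots> = (\<Sum>\<sigma> | \<sigma> permutes {1..n}. of_int (sign \<sigma>) *\<^sub>C monomial n (P \<circ> \<sigma>) (Q \<circ> \<sigma>))"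
  proof (rule sum.cong[OF refl])
    fix \<sigma> assume "\<sigma> \<in> {\<sigma>. \<sigma> permutes {1..n}}"
    then have "P \<circ> \<sigma> \<in> tuples n" "Q \<circ> \<sigma> \<in> tuples n"
      unfolding mem_Collect_eq True by (rule PiE_permutes[OF assms(1)] PiE_permutes[OF assms(2)])+
    moreover have "(\<Sum>P'\<in>tuples n. \<Sum>Q'\<in>tuples n. (of_int (sign \<sigma>) * (of_bool (P \<circ> \<sigma> = P') * of_bool (Q \<circ> \<sigma> = Q'))) *\<^sub>C monomial n P' Q')
        = (\<Sum>P'\<in>tuples n. if P \<circ> \<sigma> = P' then \<Sum>Q'\<in>tuples n. if Q \<circ> \<sigma> = Q' then of_int (sign \<sigma>) *\<^sub>C monomial n P' Q' else 0 else 0)"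
      by (auto intro!: sum.cong)
    ultimately show "(\<Sum>P'\<in>tuples n. \<Sum>Q'\<in>tuples n. (of_int (sign \<sigma>) * (of_bool (P \<circ> \<sigma> = P') * of_bool (Q \<circ> \<sigma> = Q'))) *\<^sub>C monomial n P' Q')
        = of_int (sign \<sigma>) *\<^sub>C monomial n (P \<circ> \<sigma>) (Q \<circ> \<sigma>)"
      by (simp add: sum.delta finite_PiE)
  qed
  also have "\<dots> = (\<Sum>\<sigma> | \<sigma> permutes {1..n}. monomial n P Q)"
  proof (rule sum.cong[OF refl])
    fix \<sigma> assume "\<sigma> \<in> {\<sigma>. \<sigma> permutes {1..n}}"
    then show "of_int (sign \<sigma>) *\<^sub>C monomial n (P \<circ> \<sigma>) (Q \<circ> \<sigma>) = monomial n P Q"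
      using monomial_permutes assms True by (cases \<sigma> rule: sign_cases) (auto simp: scaleC_one)
  qed
  also have "\<dots> = fact n *\<^sub>C monomial n P Q"
    by (simp add: card_permutations of_nat_mult_scaleC)
  finally show ?thesis by (simp add: proj_def True scaleC_scaleC scaleC_one)
next
  case False
  then have "(\<Sum>P'\<in>tuples n. \<Sum>Q'\<in>tuples n. coord n P' Q' (monomial m P Q) *\<^sub>C monomial n P' Q') = 0"
    using coord_monomial[OF _ _ assms] by (intro sum.neutral ballI) simp
  then show ?thesis using False by (simp add: proj_def)
qed

text \<open>The bound is a threshold valid for all larger m', so that the bounds of two summands can
  be merged in the induction over the span.\<close>

lemma sum_proj: "\<exists>m. \<forall>m'\<ge>m. x = (\<Sum>n<m'. proj n x)"
proof -
  have "x \<in> cvec.span {monomial n P Q | n P Q. P \<in> tuples n \<and> Q \<in> tuples n}" using span_monomial by simp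
  then show ?thesis
  proof (induction rule: cvec.span_induct_alt)
    case base
    show ?case by (simp add: clinearD(3)[OF proj_linear])
  next
    case (step c x y)
    then obtain k P Q where x: "x = monomial k P Q" "P \<in> tuples k" "Q \<in> tuples k" by blast
    obtain m where m: "\<And>m'. m' \<ge> m \<Longrightarrow> y = (\<Sum>n<m'. proj n y)" using step(2) by blast
    have "c *\<^sub>C x + y = (\<Sum>n<m'. proj n (c *\<^sub>C x + y))" if "m' \<ge> max m (Suc k)" for m'
    proof -
      have "(\<Sum>n<m'. proj n (c *\<^sub>C x + y)) = c *\<^sub>C (\<Sum>n<m'. proj n x) + (\<Sum>n<m'. proj n y)"
        by (simp add: clinearD(1,2)[OF proj_linear] sum.distrib cvec.scale_sum_right)
      also have "(\<Sum>n<m'. proj n x) = (\<Sum>n<m'. if n = k then x else 0)"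
        by (simp only: x(1) proj_monomial[OF x(2,3)])
      also have "\<dots> = x" using that by (simp add: sum.delta')
      also have "(\<Sum>n<m'. proj n y) = y" using m that by simp
      finally show ?thesis by simp
    qed
    then show ?case by blast
  qed
qed

end

section \<open>The first fundamental theorem for the general linear group\<close>

context matrix_units
begin

definition mat_of :: "('v \<Rightarrow> 'v) \<Rightarrow> nat \<Rightarrow> nat \<Rightarrow> complex"
  where "mat_of g a b = dual_apply (e' a) (g (e b))"

lemma mat_of_expand: "g (e b) = (\<Sum>a\<in>{1..N}. mat_of g a b *\<^sub>C e a)"
  unfolding mat_of_def by (rule vector_expand)

lemma mat_of_apply:
  assumes "clinear g"
  shows "dual_apply f (g v) = (\<Sum>b\<in>{1..N}. dual_apply f (g (e b)) * dual_apply (e' b) v)"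
proof -
  have "dual_apply f (g v) = dual_apply f (g (\<Sum>b\<in>{1..N}. dual_apply (e' b) v *\<^sub>C e b))"
    using vector_expand[of v] by simp
  then show ?thesis by (simp add: clinearD(2,6)[OF assms] clinearD(2,6)[OF dual_apply_linear] mult.commute)
qed

text \<open>The coordinates of an invariant commute with the tensor power of g. The entries of
  \<open>inv g\<close> coming from the dual action are cleared by testing with the functionals
  \<open>?R\<close>, so that only entries of g remain; this keeps the identity polynomial in the
  matrix, as \<open>commutes_with_power_shift\<close> requires.\<close>

lemma coord_GL_act:
  assumes g: "g \<in> GL" and x: "GL_act g x = x" and PQ: "P \<in> tuples n" "Q \<in> tuples n"
  shows "(\<Sum>I\<in>tuples n. coord n I Q x * (\<Prod>s\<in>{1..n}. mat_of g (P s) (I s)))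
    = (\<Sum>J\<in>tuples n. coord n P J x * (\<Prod>s\<in>{1..n}. mat_of g (J s) (Q s)))"
proof -
  have g_lin: "clinear g" using g by (simp add: GL_def)
  have inv_g: "inv g (g v) = v" for v using g by (simp add: GL_def bij_is_inj)
  note T = tensor_map[OF g_lin dual_act_linear[OF g]]
  let ?L = "\<lambda>s w. \<Sum>i\<in>{1..N}. mat_of g (P s) i * tensor_pair (e' i) (e (Q s)) w"
  let ?R = "\<lambda>s w. \<Sum>j\<in>{1..N}. mat_of g j (Q s) * tensor_pair (e' (P s)) (e j) w"
  have R_lin: "clinear (?R s)" for s
    unfolding scaleC_complex_def[symmetric] by (intro clinear_sum clinear_scale tensor_pair)
  have L_lin: "clinear (?L s)" for s
    unfolding scaleC_complex_def[symmetric] by (intro clinear_sum clinear_scale tensor_pair)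
  \<comment> \<open>Pulling \<open>?R\<close> back along the action meets
    \<open>inv g (g (e (Q s)))\<close> in the dual factor, where g and its inverse cancel.\<close>
  have eq: "(\<lambda>w. ?R s (tensor_map g (dual_act g) w)) = ?L s" for s
  proof
    fix w
    show "?R s (tensor_map g (dual_act g) w) = ?L s w"
    proof (rule clinear_eq_on_tensor[where f = "\<lambda>w. ?R s (tensor_map g (dual_act g) w)" and g = "?L s"])
      show "clinear (\<lambda>w. ?R s (tensor_map g (dual_act g) w))" by (rule clinear_compose[OF R_lin T(1)])
      show "clinear (?L s)" by (rule L_lin)
      fix v f
      have "?R s (tensor_map g (dual_act g) (v \<otimes>\<^sub>C f))
          = dual_apply (e' (P s)) (g v) * (\<Sum>j\<in>{1..N}. mat_of g j (Q s) * dual_apply f (inv g (e j)))"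
        by (simp add: T(2) tensor_pair dual_apply_dual_act[OF g] sum_distrib_left mult_ac)
      also have "(\<Sum>j\<in>{1..N}. mat_of g j (Q s) * dual_apply f (inv g (e j))) = dual_apply f (inv g (g (e (Q s))))"
        by (subst mat_of_expand) (simp add: clinearD(2,6)[OF GL_inv[OF g]] clinearD(2,6)[OF dual_apply_linear])
      also have "dual_apply (e' (P s)) (g v) = (\<Sum>i\<in>{1..N}. mat_of g (P s) i * dual_apply (e' i) v)"
        unfolding mat_of_def by (rule mat_of_apply[OF g_lin])
      finally show "?R s (tensor_map g (dual_act g) (v \<otimes>\<^sub>C f)) = ?L s (v \<otimes>\<^sub>C f)"
        by (simp add: inv_g tensor_pair sum_distrib_left sum_distrib_right mult_ac)
    qed
  qed
  have "(\<Sum>I\<in>tuples n. coord n I Q x * (\<Prod>s\<in>{1..n}. mat_of g (P s) (I s))) = alt_form n ?L x"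
    unfolding coord_def by (subst alt_form_multilinear) (simp_all add: tensor_pair mult.commute)
  also have "\<dots> = alt_form n (\<lambda>s w. ?R s (tensor_map g (dual_act g) w)) x" by (simp only: eq)
  also have "\<dots> = alt_form n ?R (ext_map (tensor_map g (dual_act g)) x)"
    by (rule alt_form_ext_map[OF R_lin T(1), symmetric])
  also have "\<dots> = alt_form n ?R x" using x by (simp add: GL_act_def)
  also have "\<dots> = (\<Sum>J\<in>tuples n. coord n P J x * (\<Prod>s\<in>{1..n}. mat_of g (J s) (Q s)))"
    unfolding coord_def by (subst alt_form_multilinear) (simp_all add: tensor_pair mult.commute)
  finally show ?thesis .
qed

lemma injective_GL:
  fixes g :: "'v \<Rightarrow> 'v"
  assumes "clinear g" "\<And>v. g v = 0 \<Longrightarrow> v = 0"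
  shows "g \<in> GL"
proof -
  interpret fd: finite_dimensional_vector_space "scaleC :: complex \<Rightarrow> 'v \<Rightarrow> 'v" "e ` {1..N}"
    by unfold_locales (simp_all add: independent_e[simplified] span_e[simplified])
  have "inj g"
  proof (rule injI)
    fix v w assume "g v = g w"
    then have "g (v - w) = 0" by (simp add: clinearD(4)[OF assms(1)])
    then show "v = w" using assms(2) by fastforce
  qed
  then have "surj g" using fd.linear_inj_imp_surj[OF assms(1)] by blast
  with \<open>inj g\<close> show ?thesis using assms(1) by (simp add: GL_def bij_def)
qed

text \<open>Diagonal dominance: at a coordinate of maximal modulus, a kernel vector satisfies |c|
  |x| \<le> (sum of all |M i j|) |x|, which forces x = 0.\<close>

lemma GL_of_dominant_diagonal:
  assumes c: "(\<Sum>i\<in>{1..N}. \<Sum>j\<in>{1..N}. cmod (M i j)) < cmod c"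
  shows "\<exists>g\<in>GL. \<forall>a\<in>{1..N}. \<forall>b\<in>{1..N}. mat_of g a b = M a b + c * of_bool (a = b)"
proof -
  define g where "g v = (\<Sum>i\<in>{1..N}. (\<Sum>j\<in>{1..N}. (M i j + c * of_bool (i = j)) * dual_apply (e' j) v) *\<^sub>C e i)" for v
  have lin: "clinear g"
    unfolding g_def scaleC_complex_def[symmetric]
    by (intro clinear_sum clinear_scale_right clinear_scale dual_apply_linear)
  have coord: "dual_apply (e' a) (g v) = (\<Sum>j\<in>{1..N}. (M a j + c * of_bool (a = j)) * dual_apply (e' j) v)"
    if "a \<in> {1..N}" for a v
  proof -
    have "dual_apply (e' a) (g v) = (\<Sum>i\<in>{1..N}. (\<Sum>j\<in>{1..N}. (M i j + c * of_bool (i = j)) * dual_apply (e' j) v) * dual_apply (e' a) (e i))"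
      by (simp add: g_def clinearD(2,6)[OF dual_apply_linear])
    also have "\<dots> = (\<Sum>i\<in>{1..N}. of_bool (i = a) * (\<Sum>j\<in>{1..N}. (M i j + c * of_bool (i = j)) * dual_apply (e' j) v))"
      using that by (intro sum.cong refl) (subst dual, auto)
    finally show ?thesis using sum_of_bool_mult(1)[OF finite_atLeastAtMost that] by simp
  qed
  have "v = 0" if v: "g v = 0" for v
  proof -
    let ?x = "\<lambda>j. cmod (dual_apply (e' j) v)"
    have "?x i = 0" if i: "i \<in> {1..N}" for i
    proof -
      let ?m = "Max (?x ` {1..N})"
      have "?m \<in> ?x ` {1..N}" using i by (intro Max_in) auto
      then obtain k where k: "k \<in> {1..N}" "?m = ?x k" by auto
      have le: "?x j \<le> ?x k" if "j \<in> {1..N}" for j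
        using that k(2) Max_ge[of "?x ` {1..N}" "?x j"] by simp
      have "0 = (\<Sum>j\<in>{1..N}. (M k j + c * of_bool (k = j)) * dual_apply (e' j) v)"
        using coord[OF k(1), of v] v by (simp add: clinearD(3)[OF dual_apply_linear])
      also have "\<dots> = (\<Sum>j\<in>{1..N}. M k j * dual_apply (e' j) v) + c * (\<Sum>j\<in>{1..N}. of_bool (k = j) * dual_apply (e' j) v)"
        by (simp only: distrib_right sum.distrib sum_distrib_left mult.assoc)
      also have "(\<Sum>j\<in>{1..N}. of_bool (k = j) * dual_apply (e' j) v) = dual_apply (e' k) v"
        by (rule sum_of_bool_mult(2)[OF finite_atLeastAtMost k(1)])
      finally have "c * dual_apply (e' k) v = - (\<Sum>j\<in>{1..N}. M k j * dual_apply (e' j) v)"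
        by (simp add: eq_neg_iff_add_eq_0 add.commute)
      then have "cmod c * ?x k = cmod (\<Sum>j\<in>{1..N}. M k j * dual_apply (e' j) v)"
        by (metis norm_minus_cancel norm_mult)
      also have "\<dots> \<le> (\<Sum>j\<in>{1..N}. cmod (M k j) * ?x j)"
        by (rule order_trans[OF norm_sum]) (simp add: norm_mult)
      also have "\<dots> \<le> (\<Sum>j\<in>{1..N}. cmod (M k j) * ?x k)"
        using le by (intro sum_mono mult_left_mono) auto
      also have "\<dots> = (\<Sum>j\<in>{1..N}. cmod (M k j)) * ?x k" by (simp add: sum_distrib_right)
      also have "\<dots> \<le> (\<Sum>i\<in>{1..N}. \<Sum>j\<in>{1..N}. cmod (M i j)) * ?x k"
        using k(1) by (intro mult_right_mono member_le_sum[of k _ "\<lambda>i. \<Sum>j\<in>{1..N}. cmod (M i j)"]) (auto intro: sum_nonneg)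
      finally have bound: "cmod c * ?x k \<le> (\<Sum>i\<in>{1..N}. \<Sum>j\<in>{1..N}. cmod (M i j)) * ?x k" .
      have "\<not> 0 < ?x k"
      proof
        assume "0 < ?x k"
        from mult_strict_right_mono[OF c this] bound show False by linarith
      qed
      then show ?thesis using le[OF i] by auto
    qed
    then have "(\<Sum>i\<in>{1..N}. dual_apply (e' i) v *\<^sub>C e i) = 0" by (intro sum.neutral) simp
    then show "v = 0" using vector_expand[of v] by simp
  qed
  then have "g \<in> GL" by (rule injective_GL[OF lin])
  moreover have "mat_of g a b = M a b + c * of_bool (a = b)" if ab: "a \<in> {1..N}" "b \<in> {1..N}" for a b
  proof -
    have "mat_of g a b = (\<Sum>j\<in>{1..N}. of_bool (j = b) * (M a j + c * of_bool (a = j)))"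
      unfolding mat_of_def coord[OF ab(1)] using ab(2) by (intro sum.cong refl) (subst dual, auto)
    also have "\<dots> = M a b + c * of_bool (a = b)"
      by (rule sum_of_bool_mult(1)[OF finite_atLeastAtMost ab(2)])
    finally show ?thesis .
  qed
  ultimately show ?thesis by blast
qed

lemma coord_commutes:
  assumes "x \<in> GL_invariants"
  shows "commutes_with_power {1..n} {1..N} (\<lambda>I J. coord n I J x) M"
proof (rule commutes_with_power_shift)
  let ?B = "\<Sum>i\<in>{1..N}. \<Sum>j\<in>{1..N}. cmod (M i j)"
  have B: "?B \<ge> 0" by (intro sum_nonneg) auto
  show "infinite (complex_of_real ` {?B<..})"
    by (subst finite_image_iff) (auto simp: inj_on_def infinite_Ioi)
  fix c assume "c \<in> complex_of_real ` {?B<..}"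
  then have "?B < cmod c" using B by auto
  then obtain g where g: "g \<in> GL" "\<And>a b. a \<in> {1..N} \<Longrightarrow> b \<in> {1..N} \<Longrightarrow> mat_of g a b = M a b + c * of_bool (a = b)"
    using GL_of_dominant_diagonal by blast
  have x: "GL_act g x = x" using assms g(1) by (simp add: GL_invariants_def)
  show "commutes_with_power {1..n} {1..N} (\<lambda>I J. coord n I J x) (\<lambda>a b. M a b + c * of_bool (a = b))"
    unfolding commutes_with_power_def
  proof (intro ballI)
    fix P Q assume PQ: "P \<in> tuples n" "Q \<in> tuples n"
    have "(\<Prod>s\<in>{1..n}. M (I s) (J s) + c * of_bool (I s = J s)) = (\<Prod>s\<in>{1..n}. mat_of g (I s) (J s))"
      if "I \<in> tuples n" "J \<in> tuples n" for I J
      using PiE_mem[OF that(1)] PiE_mem[OF that(2)] by (intro prod.cong refl g(2)[symmetric])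
    then show "(\<Sum>I\<in>tuples n. coord n I Q x * (\<Prod>s\<in>{1..n}. M (P s) (I s) + c * of_bool (P s = I s)))
        = (\<Sum>J\<in>tuples n. coord n P J x * (\<Prod>s\<in>{1..n}. M (J s) (Q s) + c * of_bool (J s = Q s)))"
      using coord_GL_act[OF g(1) x PQ] PQ by (simp only: cong: sum.cong)
  qed
qed

text \<open>The first fundamental theorem in degree n. The coordinates of an invariant are
  combinations of the indicators of J = I \<circ> \<sigma>; inserted in the definition of
  \<open>proj\<close>, each indicator leaves exactly \<open>perm_trace n \<sigma>\<close>.\<close>

lemma proj_invariant:
  assumes "x \<in> GL_invariants"
  shows "proj n x \<in> cvec.span (perm_trace n ` {\<sigma>. \<sigma> permutes {1..n}})"
proof -
  let ?G = "{\<sigma>. \<sigma> permutes {1..n}}"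
  have "\<exists>c. \<forall>I\<in>tuples n. \<forall>J\<in>tuples n. coord n I J x = (\<Sum>\<sigma>\<in>?G. c \<sigma> * of_bool (J = I \<circ> \<sigma>))"
    by (rule commutant_of_symmetric_tensors[OF _ _ refl refl])
      (simp_all only: finite_atLeastAtMost commutes_with_powers_symmetrized[OF _ _ refl refl coord_commutes[OF assms]])
  then obtain c where c: "\<And>I J. I \<in> tuples n \<Longrightarrow> J \<in> tuples n \<Longrightarrow> coord n I J x = (\<Sum>\<sigma>\<in>?G. c \<sigma> * of_bool (J = I \<circ> \<sigma>))"
    by blast
  have "(\<Sum>I\<in>tuples n. \<Sum>J\<in>tuples n. coord n I J x *\<^sub>C monomial n I J)
      = (\<Sum>I\<in>tuples n. \<Sum>J\<in>tuples n. \<Sum>\<sigma>\<in>?G. (c \<sigma> * of_bool (J = I \<circ> \<sigma>)) *\<^sub>C monomial n I J)"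
    using c by (simp only: cvec.scale_sum_left cong: sum.cong)
  also have "\<dots> = (\<Sum>\<sigma>\<in>?G. \<Sum>I\<in>tuples n. \<Sum>J\<in>tuples n. (c \<sigma> * of_bool (J = I \<circ> \<sigma>)) *\<^sub>C monomial n I J)"
    by (rule sum_rotate)
  also have "\<dots> = (\<Sum>\<sigma>\<in>?G. c \<sigma> *\<^sub>C perm_trace n \<sigma>)"
  proof (rule sum.cong[OF refl])
    fix \<sigma> assume \<sigma>: "\<sigma> \<in> ?G"
    have "(\<Sum>J\<in>tuples n. (c \<sigma> * of_bool (J = I \<circ> \<sigma>)) *\<^sub>C monomial n I J) = c \<sigma> *\<^sub>C monomial n I (I \<circ> \<sigma>)"
      if "I \<in> tuples n" for I
    proof -
      have "I \<circ> \<sigma> \<in> tuples n" using PiE_permutes[OF that] \<sigma> by simp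
      moreover have "(\<Sum>J\<in>tuples n. (c \<sigma> * of_bool (J = I \<circ> \<sigma>)) *\<^sub>C monomial n I J)
          = (\<Sum>J\<in>tuples n. if J = I \<circ> \<sigma> then c \<sigma> *\<^sub>C monomial n I J else 0)"
        by (intro sum.cong refl) auto
      ultimately show ?thesis by (simp only: sum.delta' sum.delta finite_tuples if_True)
    qed
    then show "(\<Sum>I\<in>tuples n. \<Sum>J\<in>tuples n. (c \<sigma> * of_bool (J = I \<circ> \<sigma>)) *\<^sub>C monomial n I J) = c \<sigma> *\<^sub>C perm_trace n \<sigma>"
      by (simp only: perm_trace_def cvec.scale_sum_right monomial_def comp_apply cong: sum.cong)
  qed
  also have "\<dots> \<in> cvec.span (perm_trace n ` ?G)"
    by (intro cvec.span_sum cvec.span_scale cvec.span_base imageI)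
  finally show ?thesis unfolding proj_def by (rule cvec.span_scale)
qed

lemma invariant_in_span:
  assumes "x \<in> GL_invariants"
  shows "x \<in> cvec.span {perm_trace n \<sigma> | n \<sigma>. \<sigma> permutes {1..n}}"
proof -
  obtain m where "x = (\<Sum>n<m. proj n x)" using sum_proj[of x] by blast
  moreover have "proj n x \<in> cvec.span {perm_trace n \<sigma> | n \<sigma>. \<sigma> permutes {1..n}}" for n
  proof -
    have "perm_trace n ` {\<sigma>. \<sigma> permutes {1..n}} \<subseteq> {perm_trace n \<sigma> | n \<sigma>. \<sigma> permutes {1..n}}" by blast
    from cvec.span_mono[OF this] proj_invariant[OF assms, of n] show ?thesis by (rule subsetD)
  qed
  ultimately show ?thesis by (metis (no_types, lifting) cvec.span_sum)
qed

section \<open>Invariance of the traces of powers\<close>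

lemma mat_of_inverse:
  assumes "g \<in> GL" "k \<in> {1..N}" "l \<in> {1..N}"
  shows "(\<Sum>i\<in>{1..N}. mat_of g k i * mat_of (inv g) i l) = of_bool (k = l)"
    "(\<Sum>i\<in>{1..N}. mat_of (inv g) k i * mat_of g i l) = of_bool (k = l)"
proof -
  have g: "clinear g" "g (inv g v) = v" "inv g (g v) = v" for v
    using assms(1) by (auto simp: GL_def bij_is_inj bij_is_surj surj_f_inv_f)
  have "of_bool (k = l) = dual_apply (e' k) (e l)" by (auto simp: dual[OF assms(3,2)])
  then show "(\<Sum>i\<in>{1..N}. mat_of g k i * mat_of (inv g) i l) = of_bool (k = l)"
    "(\<Sum>i\<in>{1..N}. mat_of (inv g) k i * mat_of g i l) = of_bool (k = l)"
    using mat_of_apply[OF g(1), of "e' k" "inv g (e l)"] mat_of_apply[OF GL_inv[OF assms(1)], of "e' k" "g (e l)"]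
    by (simp_all only: mat_of_def g)
qed

text \<open>With G the matrix of g, this is the transpose of G times B times the transpose of the
  inverse of G: a conjugation, which is multiplicative in B and hence passes from A to its
  powers.\<close>

definition conj_mat :: "('v \<Rightarrow> 'v) \<Rightarrow> (nat \<Rightarrow> nat \<Rightarrow> ('v, 'v dual) tensor exterior) \<Rightarrow> nat \<Rightarrow> nat \<Rightarrow> ('v, 'v dual) tensor exterior"
  where "conj_mat g B i j = (\<Sum>k\<in>{1..N}. \<Sum>l\<in>{1..N}. (mat_of g k i * mat_of (inv g) j l) *\<^sub>C B k l)"

lemma GL_act_A:
  assumes "g \<in> GL" "i \<in> {1..N}" "j \<in> {1..N}"
  shows "GL_act g (A i j) = conj_mat g A i j"
proof -
  have g: "g (e i) = (\<Sum>k\<in>{1..N}. mat_of g k i *\<^sub>C e k)" by (rule mat_of_expand)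
  have "dual_act g (e' j) = (\<Sum>l\<in>{1..N}. mat_of (inv g) j l *\<^sub>C e' l)"
    using dual_expand[of "dual_act g (e' j)"] by (simp only: dual_apply_dual_act[OF assms(1)] mat_of_def)
  then have "GL_act g (A i j) = ext_inj ((\<Sum>k\<in>{1..N}. mat_of g k i *\<^sub>C e k) \<otimes>\<^sub>C (\<Sum>l\<in>{1..N}. mat_of (inv g) j l *\<^sub>C e' l))"
    using assms g by (simp only: A GL_act(2))
  also have "\<dots> = (\<Sum>k\<in>{1..N}. mat_of g k i *\<^sub>C ext_inj (e k \<otimes>\<^sub>C (\<Sum>l\<in>{1..N}. mat_of (inv g) j l *\<^sub>C e' l)))"
    by (simp only: clinearD(6)[OF tprod_linear(1)] tprod_scale_left clinearD(2,6)[OF ext_inj_linear])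
  also have "\<dots> = (\<Sum>k\<in>{1..N}. \<Sum>l\<in>{1..N}. (mat_of g k i * mat_of (inv g) j l) *\<^sub>C ext_inj (e k \<otimes>\<^sub>C e' l))"
    by (simp only: clinearD(6)[OF tprod_linear(2)] tprod_scale_right clinearD(2,6)[OF ext_inj_linear]
        cvec.scale_sum_right scaleC_scaleC)
  also have "\<dots> = conj_mat g A i j" unfolding conj_mat_def by (intro sum.cong refl) (simp only: A)
  finally show ?thesis .
qed

lemma conj_mat_mult:
  assumes "g \<in> GL"
  shows "(\<Sum>m\<in>{1..N}. conj_mat g B i m * conj_mat g C m j) = conj_mat g (\<lambda>i j. \<Sum>m\<in>{1..N}. B i m * C m j) i j"
proof -
  let ?G = "mat_of g" and ?H = "mat_of (inv g)"
  define BL where "BL l = (\<Sum>k\<in>{1..N}. ?G k i *\<^sub>C B k l)" for l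
  define CR where "CR k = (\<Sum>l\<in>{1..N}. ?H j l *\<^sub>C C k l)" for k
  have B: "conj_mat g B i m = (\<Sum>l\<in>{1..N}. ?H m l *\<^sub>C BL l)" for m
    unfolding conj_mat_def BL_def cvec.scale_sum_right scaleC_scaleC
    by (subst sum.swap) (simp add: mult.commute)
  have C: "conj_mat g C m j = (\<Sum>k\<in>{1..N}. ?G k m *\<^sub>C CR k)" for m
    by (simp add: conj_mat_def CR_def cvec.scale_sum_right scaleC_scaleC)
  have "(\<Sum>m\<in>{1..N}. conj_mat g B i m * conj_mat g C m j)
      = (\<Sum>m\<in>{1..N}. \<Sum>l\<in>{1..N}. \<Sum>k\<in>{1..N}. (?G k m * ?H m l) *\<^sub>C (BL l * CR k))"
    by (simp add: B C sum_product mult_scaleC_left mult_scaleC_right scaleC_scaleC mult.commute)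
  also have "\<dots> = (\<Sum>l\<in>{1..N}. \<Sum>k\<in>{1..N}. \<Sum>m\<in>{1..N}. (?G k m * ?H m l) *\<^sub>C (BL l * CR k))"
    by (rule sum_rotate[symmetric])
  also have "\<dots> = (\<Sum>l\<in>{1..N}. \<Sum>k\<in>{1..N}. if k = l then BL l * CR k else 0)"
    unfolding cvec.scale_sum_left[symmetric]
    by (intro sum.cong refl) (subst mat_of_inverse(1)[OF assms], auto simp: scaleC_one)
  also have "\<dots> = (\<Sum>l\<in>{1..N}. BL l * CR l)" by (intro sum.cong refl) simp
  also have "\<dots> = (\<Sum>l\<in>{1..N}. \<Sum>k\<in>{1..N}. \<Sum>l'\<in>{1..N}. (?G k i * ?H j l') *\<^sub>C (B k l * C l l'))"
    by (simp add: BL_def CR_def sum_product mult_scaleC_left mult_scaleC_right scaleC_scaleC mult.commute)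
  also have "\<dots> = (\<Sum>k\<in>{1..N}. \<Sum>l'\<in>{1..N}. \<Sum>l\<in>{1..N}. (?G k i * ?H j l') *\<^sub>C (B k l * C l l'))"
    by (rule sum_rotate[symmetric])
  finally show ?thesis by (simp add: conj_mat_def cvec.scale_sum_right)
qed

lemma GL_act_mat_pow:
  assumes g: "g \<in> GL" and "i \<in> {1..N}" "j \<in> {1..N}"
  shows "GL_act g (mpow p i j) = conj_mat g (mpow p) i j"
  using assms(2)
proof (induction p arbitrary: i)
  case 0
  have "conj_mat g (mpow 0) i j = (\<Sum>k\<in>{1..N}. (mat_of (inv g) j k * mat_of g k i) *\<^sub>C 1)"
    unfolding conj_mat_def
  proof (rule sum.cong[OF refl])
    fix k assume k: "k \<in> {1..N}"
    have "(\<Sum>l\<in>{1..N}. (mat_of g k i * mat_of (inv g) j l) *\<^sub>C mpow 0 k l)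
        = (\<Sum>l\<in>{1..N}. if k = l then (mat_of g k i * mat_of (inv g) j l) *\<^sub>C 1 else 0)"
      by (intro sum.cong refl) simp
    then show "(\<Sum>l\<in>{1..N}. (mat_of g k i * mat_of (inv g) j l) *\<^sub>C mpow 0 k l) = (mat_of (inv g) j k * mat_of g k i) *\<^sub>C 1"
      using k by (simp add: mult.commute)
  qed
  also have "\<dots> = of_bool (j = i) *\<^sub>C 1"
    by (simp only: cvec.scale_sum_left[symmetric] mat_of_inverse(2)[OF g assms(3) 0])
  also have "\<dots> = GL_act g (mpow 0 i j)"
    using alg_homD(2)[OF GL_act(1)[OF g]] clinearD(3)[OF alg_homD(1)[OF GL_act(1)[OF g]]]
    by (cases "i = j") (simp_all add: scaleC_one)
  finally show ?case by (rule sym)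
next
  case (Suc p)
  note F = GL_act(1)[OF g]
  have "GL_act g (mpow (Suc p) i j) = (\<Sum>m\<in>{1..N}. GL_act g (A i m) * GL_act g (mpow p m j))"
    by (simp add: clinearD(6)[OF alg_homD(1)[OF F]] alg_homD(3)[OF F])
  also have "\<dots> = (\<Sum>m\<in>{1..N}. conj_mat g A i m * conj_mat g (mpow p) m j)"
    using Suc by (intro sum.cong refl arg_cong2[of _ _ _ _ "(*)"] GL_act_A[OF g])
  also have "\<dots> = conj_mat g (\<lambda>i j. \<Sum>m\<in>{1..N}. A i m * mpow p m j) i j"
    by (rule conj_mat_mult[OF g])
  also have "(\<lambda>i j. \<Sum>m\<in>{1..N}. A i m * mpow p m j) = mpow (Suc p)" by (simp add: fun_eq_iff)
  finally show ?case .
qed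

lemma tr_invariant: "tr p \<in> GL_invariants"
  unfolding GL_invariants_def
proof (intro CollectI ballI)
  fix g :: "'v \<Rightarrow> 'v" assume g: "g \<in> GL"
  have "GL_act g (tr p) = (\<Sum>i\<in>{1..N}. conj_mat g (mpow p) i i)"
    unfolding mat_tr_def clinearD(6)[OF alg_homD(1)[OF GL_act(1)[OF g]]]
    by (intro sum.cong refl GL_act_mat_pow[OF g])
  also have "\<dots> = (\<Sum>k\<in>{1..N}. \<Sum>l\<in>{1..N}. \<Sum>i\<in>{1..N}. (mat_of g k i * mat_of (inv g) i l) *\<^sub>C mpow p k l)"
    unfolding conj_mat_def by (rule sum_rotate[symmetric])
  also have "\<dots> = (\<Sum>k\<in>{1..N}. \<Sum>l\<in>{1..N}. if k = l then mpow p k l else 0)"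
    unfolding cvec.scale_sum_left[symmetric]
    by (intro sum.cong refl) (subst mat_of_inverse(1)[OF g], auto simp: scaleC_one)
  also have "\<dots> = tr p" unfolding mat_tr_def by (intro sum.cong refl) simp
  finally show "GL_act g (tr p) = tr p" .
qed

lemma subspace_invariants: "cvec.subspace (GL_invariants :: ('v, 'v dual) tensor exterior set)"
  by (auto simp: cvec.subspace_def GL_invariants_def clinearD[OF alg_homD(1)[OF GL_act(1)]])

lemma prod_list_invariant:
  fixes xs :: "('v, 'v dual) tensor exterior list"
  assumes "set xs \<subseteq> GL_invariants" shows "prod_list xs \<in> GL_invariants"
  using assms by (induction xs) (auto simp: GL_invariants_def alg_homD[OF GL_act(1)])

end

section \<open>Products of traces\<close>

lemma prod_list_sum_PiE:
  fixes F :: "'s \<Rightarrow> 'b \<Rightarrow> 'a::ring_1"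
  assumes "distinct xs"
  shows "prod_list (map (\<lambda>s. \<Sum>i\<in>B. F s i) xs) = (\<Sum>f\<in>set xs \<rightarrow>\<^sub>E B. prod_list (map (\<lambda>s. F s (f s)) xs))"
  using assms
proof (induction xs)
  case (Cons x xs)
  have "(\<Sum>f\<in>set (x # xs) \<rightarrow>\<^sub>E B. prod_list (map (\<lambda>s. F s (f s)) (x # xs)))
      = (\<Sum>b\<in>B. \<Sum>f\<in>set xs \<rightarrow>\<^sub>E B. prod_list (map (\<lambda>s. F s ((f(x := b)) s)) (x # xs)))"
    using Cons.prems by (simp only: list.set) (intro sum_PiE_insert, simp)
  also have "\<dots> = (\<Sum>b\<in>B. \<Sum>f\<in>set xs \<rightarrow>\<^sub>E B. F x b * prod_list (map (\<lambda>s. F s (f s)) xs))"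
  proof (intro sum.cong refl)
    fix b f
    have "map (\<lambda>s. F s ((f(x := b)) s)) xs = map (\<lambda>s. F s (f s)) xs"
      using Cons.prems by (intro map_cong) auto
    then show "prod_list (map (\<lambda>s. F s ((f(x := b)) s)) (x # xs)) = F x b * prod_list (map (\<lambda>s. F s (f s)) xs)"
      by (simp only: list.map prod_list.Cons fun_upd_same)
  qed
  finally show ?case using Cons by (simp add: sum_product)
qed simp

lemma prod_list_scaleC:
  fixes y :: "'s \<Rightarrow> 'a::complex_algebra_1"
  shows "prod_list (map (\<lambda>s. c s *\<^sub>C y s) xs) = prod_list (map c xs) *\<^sub>C prod_list (map y xs)"
  by (induction xs) (simp_all add: mult_scaleC_left mult_scaleC_right scaleC_scaleC scaleC_one mult.commute)

section \<open>Determinants and linear substitutions in anticommuting products\<close>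

definition leibniz :: "nat \<Rightarrow> (nat \<Rightarrow> nat \<Rightarrow> complex) \<Rightarrow> complex"
  where "leibniz N M = (\<Sum>\<sigma> | \<sigma> permutes {1..N}. of_int (sign \<sigma>) * (\<Prod>j\<in>{1..N}. M j (\<sigma> j)))"

lemma leibniz_transpose: "leibniz N (\<lambda>i j. M j i) = leibniz N M"
proof -
  have "leibniz N (\<lambda>i j. M j i) = (\<Sum>\<sigma> | \<sigma> permutes {1..N}. of_int (sign (inv \<sigma>)) * (\<Prod>j\<in>{1..N}. M (inv \<sigma> j) j))"
    unfolding leibniz_def by (rule sum_permutations_inverse)
  also have "\<dots> = leibniz N M"
    unfolding leibniz_def
  proof (rule sum.cong[OF refl])
    fix \<sigma> assume "\<sigma> \<in> {\<sigma>. \<sigma> permutes {1..N}}"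
    then have \<sigma>: "\<sigma> permutes {1..N}" by simp
    have "(\<Prod>j\<in>{1..N}. M (inv \<sigma> j) j) = (\<Prod>j\<in>{1..N}. M (inv \<sigma> (\<sigma> j)) (\<sigma> j))"
      using prod.permute[OF \<sigma>, of "\<lambda>j. M (inv \<sigma> j) j"] by simp
    then show "of_int (sign (inv \<sigma>)) * (\<Prod>j\<in>{1..N}. M (inv \<sigma> j) j) = of_int (sign \<sigma>) * (\<Prod>j\<in>{1..N}. M j (\<sigma> j))"
      using \<sigma> by (simp add: permutes_inverses sign_inverse permutation_permutes[of \<sigma>] exI[of _ "{1..N}"])
  qed
  finally show ?thesis .
qed

text \<open>The determinant as the scalar of a substitution on the top exterior power: in the
  expansion, maps with a repeated value give zero and a permutation gives its sign.\<close>

lemma prod_list_linear_combination: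
  fixes y :: "nat \<Rightarrow> 'a::complex_algebra_1"
  assumes "anticommuting y {1..N}"
  shows "prod_list (map (\<lambda>j. \<Sum>k\<in>{1..N}. M j k *\<^sub>C y k) [1..<Suc N]) = leibniz N M *\<^sub>C prod_list (map y [1..<Suc N])"
proof -
  have set: "set [1..<Suc N] = {1..N}" by auto
  have "prod_list (map (\<lambda>j. \<Sum>k\<in>{1..N}. M j k *\<^sub>C y k) [1..<Suc N])
      = (\<Sum>f\<in>set [1..<Suc N] \<rightarrow>\<^sub>E {1..N}. prod_list (map (\<lambda>j. M j (f j) *\<^sub>C y (f j)) [1..<Suc N]))"
    by (intro prod_list_sum_PiE) (simp del: upt_Suc)
  also have "\<dots> = (\<Sum>f\<in>{1..N} \<rightarrow>\<^sub>E {1..N}. (\<Prod>j\<in>{1..N}. M j (f j)) *\<^sub>C prod_list (map (\<lambda>j. y (f j)) [1..<Suc N]))"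
    unfolding prod_list_scaleC set by (simp add: prod.distinct_set_conv_list[symmetric] atLeastLessThanSuc_atLeastAtMost del: upt_Suc)
  also have "\<dots> = (\<Sum>\<sigma> | \<sigma> permutes {1..N}. (\<Prod>j\<in>{1..N}. M j (restrict \<sigma> {1..N} j)) *\<^sub>C
      prod_list (map (\<lambda>j. y (restrict \<sigma> {1..N} j)) [1..<Suc N]))"
  proof (rule sum_PiE_permutes)
    fix f assume f: "f \<in> {1..N} \<rightarrow>\<^sub>E {1..N}" "\<not> inj_on f {1..N}"
    have "set (map f [1..<Suc N]) \<subseteq> {1..N}" unfolding set_map set using f(1) by auto
    then have "anticommuting y (set (map f [1..<Suc N]))" by (rule anticommuting_subset[OF assms])
    moreover have "\<not> distinct (map f [1..<Suc N])" using f(2) unfolding distinct_map set by blast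
    ultimately have "prod_list (map y (map f [1..<Suc N])) = 0" by (rule prod_list_repeated)
    then show "(\<Prod>j\<in>{1..N}. M j (f j)) *\<^sub>C prod_list (map (\<lambda>j. y (f j)) [1..<Suc N]) = 0"
      by (simp add: comp_def del: upt_Suc)
  qed simp
  also have "\<dots> = (\<Sum>\<sigma> | \<sigma> permutes {1..N}. (of_int (sign \<sigma>) * (\<Prod>j\<in>{1..N}. M j (\<sigma> j))) *\<^sub>C prod_list (map y [1..<Suc N]))"
  proof (rule sum.cong[OF refl])
    fix \<sigma> assume "\<sigma> \<in> {\<sigma>. \<sigma> permutes {1..N}}"
    then have \<sigma>: "\<sigma> permutes {1..N}" by simp
    have "map (\<lambda>j. y (restrict \<sigma> {1..N} j)) [1..<Suc N] = map (\<lambda>j. y (\<sigma> j)) [1..<Suc N]"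
      using set by (intro map_cong refl) (simp del: upt_Suc)
    then have "prod_list (map (\<lambda>j. y (restrict \<sigma> {1..N} j)) [1..<Suc N]) = of_int (sign \<sigma>) * prod_list (map y [1..<Suc N])"
      using prod_list_permutes[OF \<sigma> assms] by (simp only:)
    moreover have "of_int (sign \<sigma>) * z = of_int (sign \<sigma>) *\<^sub>C z" for z :: 'a
      by (cases \<sigma> rule: sign_cases) (simp_all add: scaleC_one)
    ultimately show "(\<Prod>j\<in>{1..N}. M j (restrict \<sigma> {1..N} j)) *\<^sub>C prod_list (map (\<lambda>j. y (restrict \<sigma> {1..N} j)) [1..<Suc N])
        = (of_int (sign \<sigma>) * (\<Prod>j\<in>{1..N}. M j (\<sigma> j))) *\<^sub>C prod_list (map y [1..<Suc N])"
      by (simp add: scaleC_scaleC mult.commute)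
  qed
  finally show ?thesis by (simp add: leibniz_def cvec.scale_sum_left)
qed

lemma prod_list_product:
  fixes y :: "'b \<Rightarrow> 'c \<Rightarrow> 'a::monoid_mult"
  shows "prod_list (map (\<lambda>(i, j). y i j) (List.product xs ys)) = prod_list (map (\<lambda>i. prod_list (map (y i) ys)) xs)"
  by (induction xs) (simp_all add: comp_def)

lemma sum_odd_less:
  fixes N :: nat
  shows "(\<Sum>l | odd l \<and> l < 2 * N. l) = N * N"
proof -
  have "{l. odd l \<and> l < 2 * N} = (\<lambda>k. 2 * k + 1) ` {..<N}" by (auto elim!: oddE)
  then have "(\<Sum>l | odd l \<and> l < 2 * N. l) = (\<Sum>k<N. 2 * k + 1)"
    by (simp add: sum.reindex inj_on_def)
  also have "\<dots> = N * N" by (induction N) auto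
  finally show ?thesis .
qed

lemma odd_decreasing_distinct: "odd_decreasing mu \<Longrightarrow> distinct mu"
  unfolding odd_decreasing_def by (metis order_less_irrefl strict_sorted_iff sorted_wrt_rev distinct_rev)

lemma odd_decreasing_eq:
  assumes "odd_decreasing mu" "odd_decreasing nu" "set mu = set nu" shows "mu = nu"
proof -
  have "sorted_wrt (<) (rev mu)" "sorted_wrt (<) (rev nu)"
    using assms by (simp_all add: odd_decreasing_def sorted_wrt_rev)
  then have "rev mu = rev nu"
    using assms(3) by (intro strict_sorted_equal) auto
  then show ?thesis by simp
qed

lemma odd_decreasing_rev_sort:
  assumes "distinct ls" "\<And>l. l \<in> set ls \<Longrightarrow> odd l"
  shows "odd_decreasing (rev (sort ls))"
proof -
  have "sorted_wrt (<) (sort ls)" using assms(1) by (simp add: strict_sorted_iff)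
  then show ?thesis using assms(2) by (simp add: odd_decreasing_def sorted_wrt_rev)
qed

section \<open>Spanning and independence of products of odd traces\<close>

context odd_matrix
begin

definition tr_prod :: "nat list \<Rightarrow> 'a"
  where "tr_prod ls = prod_list (map tr ls)"

definition trace_exponents :: "nat list set"
  where "trace_exponents = {mu. odd_decreasing mu \<and> (\<forall>m\<in>set mu. m < 2 * N)}"

text \<open>The exponent 0 is kept apart: \<open>tr 0\<close> equals N, although 0 is even.\<close>

lemma tr_prod_zero:
  assumes "0 \<notin> set ls" "\<not> (distinct ls \<and> (\<forall>l\<in>set ls. odd l \<and> l < 2 * N))"
  shows "tr_prod ls = 0"
proof (cases "\<forall>l\<in>set ls. odd l \<and> l < 2 * N")
  case True
  then have "anticommuting tr (set ls)" by (intro tr_anticommuting) auto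
  then show ?thesis using True assms(2) by (auto simp: tr_prod_def intro: prod_list_repeated)
next
  case False
  then obtain l where l: "l \<in> set ls" "\<not> (odd l \<and> l < 2 * N)" by blast
  have "tr l = 0"
  proof (cases "odd l")
    case True
    then have "2 * N < l" using l(2) by (metis dvd_triv_left linorder_neqE_nat)
    with True show ?thesis by (rule tr_large)
  next
    case False
    moreover have "l > 0" using l(1) assms(1) by (metis gr0I)
    ultimately show ?thesis by (intro tr_even) auto
  qed
  then have "0 \<in> set (map tr ls)" using l(1) by force
  then show ?thesis unfolding tr_prod_def by (rule prod_list_eq_zero)
qed

lemma tr_prod_mset_eq:
  assumes "\<forall>l\<in>set ls. odd l" "mset ls = mset ls'"
  shows "\<exists>k. tr_prod ls = (-1) ^ k * tr_prod ls'"
proof -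
  have "anticommuting tr (set ls)" using assms(1) by (intro tr_anticommuting) auto
  then show ?thesis unfolding tr_prod_def using prod_list_mset_eq[OF assms(2), where 'a = 'a] by blast
qed

lemma minus_one_power_mult_scaleC: "(-1) ^ k * x = (-1) ^ k *\<^sub>C (x::'a)"
  by (cases "even k") (simp_all add: scaleC_one)

lemma tr_prod_in_span:
  assumes "0 \<notin> set ls" shows "tr_prod ls \<in> cvec.span (tr_prod ` trace_exponents)"
proof (cases "distinct ls \<and> (\<forall>l\<in>set ls. odd l \<and> l < 2 * N)")
  case True
  then obtain k where "tr_prod ls = (-1) ^ k * tr_prod (rev (sort ls))"
    using tr_prod_mset_eq[of ls "rev (sort ls)"] by auto
  moreover have "rev (sort ls) \<in> trace_exponents"
    unfolding trace_exponents_def using True odd_decreasing_rev_sort[of ls] by auto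
  ultimately show ?thesis
    by (simp only: minus_one_power_mult_scaleC cvec.span_scale cvec.span_base imageI)
qed (simp add: tr_prod_zero[OF assms] cvec.span_zero)

lemma perm_trace_tr_prod:
  assumes "\<sigma> permutes {1..n}"
  obtains k ls where "perm_trace n \<sigma> = (-1) ^ k * tr_prod ls" "0 \<notin> set ls" "sum_list ls = n"
proof -
  obtain cs where cs: "distinct (concat cs)" "set (concat cs) = {1..n}" "[] \<notin> set cs" "\<sigma> = prod_of_cycles cs"
    using permutes_prod_of_cycles[OF assms] by auto
  have "sum_list (map length cs) = n" using distinct_card[OF cs(1)] cs(2) by (simp add: length_concat)
  moreover have "0 \<notin> set (map length cs)" using cs(3) by auto
  moreover have "perm_trace n \<sigma> = (-1) ^ inversions (concat cs) * tr_prod (map length cs)"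
    unfolding cs(4) perm_trace_cycles[OF cs(1-3)] tr_prod_def by (simp add: comp_def)
  ultimately show thesis using that by blast
qed

lemma perm_trace_in_span:
  assumes "\<sigma> permutes {1..n}" shows "perm_trace n \<sigma> \<in> cvec.span (tr_prod ` trace_exponents)"
  using perm_trace_tr_prod[OF assms] tr_prod_in_span cvec.span_scale minus_one_power_mult_scaleC by metis

text \<open>A degree count: a nonzero product of traces has distinct odd exponents below 2N, and
  these can add up to N * N, the sum of all such numbers, only if every one of them occurs.
  Rearranging the factors changes the sign at most.\<close>

lemma odds_nonzero:
  assumes "\<sigma> permutes {1..N * N}" "perm_trace (N * N) \<sigma> \<noteq> 0"
    and "distinct ls" "set ls = {l. odd l \<and> l < 2 * N}"
  shows "tr_prod ls \<noteq> 0"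
proof -
  obtain k ms where ms: "perm_trace (N * N) \<sigma> = (-1) ^ k * tr_prod ms" "0 \<notin> set ms" "sum_list ms = N * N"
    using perm_trace_tr_prod[OF assms(1)] by blast
  then have nz: "tr_prod ms \<noteq> 0" using assms(2) by auto
  then have ms': "distinct ms" "\<forall>l\<in>set ms. odd l \<and> l < 2 * N" using tr_prod_zero[OF ms(2)] by auto
  have fin: "finite {l. odd l \<and> l < 2 * N}" by simp
  have "set ms = {l. odd l \<and> l < 2 * N}"
  proof (rule ccontr)
    assume "set ms \<noteq> {l. odd l \<and> l < 2 * N}"
    then obtain l where l: "odd l" "l < 2 * N" "l \<notin> set ms" using ms'(2) by blast
    then have "(\<Sum>x\<in>insert l (set ms). x) \<le> (\<Sum>l | odd l \<and> l < 2 * N. l)"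
      using ms'(2) by (intro sum_mono2[OF fin]) auto
    moreover have "(\<Sum>x\<in>insert l (set ms). x) = l + N * N"
      using l(3) ms(3) ms'(1) by (simp add: sum_list_distinct_conv_sum_set[of _ "\<lambda>x. x", simplified])
    ultimately show False using l(1) unfolding sum_odd_less by (metis add_le_same_cancel2 even_zero le_zero_eq)
  qed
  then have "mset ms = mset ls" using ms'(1) assms(3,4) set_eq_iff_mset_eq_distinct by metis
  then obtain j where "tr_prod ms = (-1) ^ j * tr_prod ls" using tr_prod_mset_eq ms'(2) by blast
  then show ?thesis using nz by auto
qed

text \<open>Take a shortest \<open>nu\<close> with nonzero coefficient and multiply the relation by
  the odd traces missing from \<open>nu\<close>. Another list either repeats one of these traces, or
  its exponents form a proper subset of those of \<open>nu\<close> and its coefficient is zero by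
  minimality. Only \<open>nu\<close> survives, completed to the full product.\<close>

lemma tr_prod_independent:
  assumes nz: "\<And>ls. distinct ls \<Longrightarrow> set ls = {l. odd l \<and> l < 2 * N} \<Longrightarrow> tr_prod ls \<noteq> 0"
    and fin: "finite trace_exponents" and zero: "(\<Sum>mu\<in>trace_exponents. c mu *\<^sub>C tr_prod mu) = 0" and "mu \<in> trace_exponents"
  shows "c mu = 0"
proof (rule ccontr)
  assume "c mu \<noteq> 0"
  define nu where "nu = arg_min length (\<lambda>nu. nu \<in> trace_exponents \<and> c nu \<noteq> 0)"
  have nu: "nu \<in> trace_exponents" "c nu \<noteq> 0"
    using arg_min_natI[of "\<lambda>nu. nu \<in> trace_exponents \<and> c nu \<noteq> 0" mu length] assms(4) \<open>c mu \<noteq> 0\<close> unfolding nu_def by auto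
  have minimal: "c mu' = 0" if "mu' \<in> trace_exponents" "length mu' < length nu" for mu'
    using arg_min_nat_le[of "\<lambda>nu. nu \<in> trace_exponents \<and> c nu \<noteq> 0" mu' length] that unfolding nu_def by force
  let ?O = "{l. odd l \<and> l < 2 * N}"
  define co where "co = sorted_list_of_set (?O - set nu)"
  have co: "set co = ?O - set nu" "distinct co" by (simp_all add: co_def)
  have expD: "distinct mu'" "set mu' \<subseteq> ?O" "0 \<notin> set mu'" if "mu' \<in> trace_exponents" for mu'
    using that odd_decreasing_distinct by (auto simp: trace_exponents_def odd_decreasing_def)
  have other: "c mu' *\<^sub>C (tr_prod mu' * tr_prod co) = 0" if mu': "mu' \<in> trace_exponents" "mu' \<noteq> nu" for mu'
  proof (cases "set mu' \<subseteq> set nu")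
    case True
    have "set mu' \<noteq> set nu" using odd_decreasing_eq mu' nu(1) by (auto simp: trace_exponents_def)
    then have "card (set mu') < card (set nu)" using True by (intro psubset_card_mono) auto
    then have "length mu' < length nu" using expD(1)[OF mu'(1)] expD(1)[OF nu(1)] by (simp add: distinct_card)
    then show ?thesis using minimal[OF mu'(1)] by simp
  next
    case False
    then have "\<not> distinct (mu' @ co)" using expD(2)[OF mu'(1)] co(1) by auto
    then have "tr_prod (mu' @ co) = 0"
      using expD(3)[OF mu'(1)] co(1) by (intro tr_prod_zero) auto
    then show ?thesis by (simp add: tr_prod_def)
  qed
  have "0 = (\<Sum>mu\<in>trace_exponents. c mu *\<^sub>C tr_prod mu) * tr_prod co" using zero by simp
  also have "\<dots> = (\<Sum>mu\<in>trace_exponents. c mu *\<^sub>C (tr_prod mu * tr_prod co))"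
    by (simp add: sum_distrib_right mult_scaleC_left)
  also have "\<dots> = c nu *\<^sub>C (tr_prod nu * tr_prod co)"
  proof -
    have "(\<Sum>mu\<in>trace_exponents - {nu}. c mu *\<^sub>C (tr_prod mu * tr_prod co)) = 0"
      by (intro sum.neutral ballI other) auto
    then show ?thesis using sum.remove[OF fin nu(1), of "\<lambda>mu. c mu *\<^sub>C (tr_prod mu * tr_prod co)"] by simp
  qed
  also have "tr_prod nu * tr_prod co = tr_prod (nu @ co)" by (simp add: tr_prod_def)
  finally have "c nu *\<^sub>C tr_prod (nu @ co) = 0" by simp
  moreover have "tr_prod (nu @ co) \<noteq> 0"
    using co expD[OF nu(1)] by (intro nz) auto
  ultimately show False using nu(2) by simp
qed

lemma finite_trace_exponents: "finite trace_exponents"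
proof (rule inj_on_finite[of set])
  show "inj_on set trace_exponents" using odd_decreasing_eq by (auto simp: inj_on_def trace_exponents_def)
  show "set ` trace_exponents \<subseteq> Pow {..<2 * N}" by (auto simp: trace_exponents_def)
qed simp

end

section \<open>Nonvanishing of the top product of traces\<close>

lemma split_into_lengths:
  assumes "length xs = sum_list mu"
  shows "\<exists>cs. map length cs = mu \<and> concat cs = xs"
  using assms
proof (induction mu arbitrary: xs)
  case (Cons m mu)
  then have "length (drop m xs) = sum_list mu" by simp
  then obtain cs where "map length cs = mu" "concat cs = drop m xs" using Cons.IH by blast
  then show ?case using Cons.prems by (intro exI[of _ "take m xs # cs"]) simp
qed simp

lemma independent_family:
  fixes f :: "'i \<Rightarrow> 'a::complex_vector"
  assumes "finite I" and c: "\<And>c i. (\<Sum>i\<in>I. c i *\<^sub>C f i) = 0 \<Longrightarrow> i \<in> I \<Longrightarrow> c i = 0"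
  shows "inj_on f I \<and> cvec.independent (f ` I)"
proof
  show inj: "inj_on f I"
  proof (rule inj_onI, rule ccontr)
    fix i j assume ij: "i \<in> I" "j \<in> I" "f i = f j" "i \<noteq> j"
    \<comment> \<open>Working with coefficients per index yields injectivity as well: equal values
      at i and j satisfy the relation with coefficients 1 and -1.\<close>
    let ?c = "\<lambda>k. if k = i then 1 else if k = j then -1 else (0::complex)"
    have "(\<Sum>k\<in>I. ?c k *\<^sub>C f k) = (\<Sum>k\<in>{i, j}. ?c k *\<^sub>C f k)"
      using ij assms(1) by (intro sum.mono_neutral_right) auto
    also have "\<dots> = 0" using ij by (simp add: scaleC_one)
    finally show False using c[of ?c i] ij(1) by simp
  qed
  show "cvec.independent (f ` I)"
  proof (rule cvec.independent_if_scalars_zero)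
    fix u x assume "(\<Sum>x\<in>f ` I. u x *\<^sub>C x) = 0" "x \<in> f ` I"
    then show "u x = 0" using c[of "\<lambda>i. u (f i)"] by (auto simp: sum.reindex[OF inj])
  qed (use assms(1) in simp)
qed

context matrix_units
begin

definition all_pairs :: "(nat \<times> nat) list"
  where "all_pairs = List.product [1..<Suc N] [1..<Suc N]"

definition vol :: "('v, 'v dual) tensor exterior"
  where "vol = prod_list (map (\<lambda>(i, j). A i j) all_pairs)"

lemma set_all_pairs: "set all_pairs = {1..N} \<times> {1..N}"
  unfolding all_pairs_def set_product by auto

lemma distinct_all_pairs: "distinct all_pairs"
  unfolding all_pairs_def by (intro distinct_product distinct_upt)

lemma length_all_pairs: "length all_pairs = N * N"
  by (simp add: all_pairs_def del: upt_Suc)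

text \<open>The alternating form made of the functionals dual to the same pairs has the value 1 on
  the product: as the pairs are distinct, only the identity matches all factors.\<close>

lemma prod_list_pairs_nonzero:
  assumes "distinct ps" "set ps \<subseteq> {1..N} \<times> {1..N}"
  shows "prod_list (map (\<lambda>(i, j). A i j) ps) \<noteq> 0"
proof
  assume "prod_list (map (\<lambda>(i, j). A i j) ps) = 0"
  let ?n = "length ps" and ?ws = "map (\<lambda>(i, j). e i \<otimes>\<^sub>C e' j) ps"
  let ?\<psi> = "\<lambda>s. tensor_pair (e' (fst (ps ! (s - 1)))) (e (snd (ps ! (s - 1))))"
  have nth: "ps ! (s - 1) \<in> {1..N} \<times> {1..N}" if "s \<in> {1..?n}" for s
    using nth_mem[of "s - 1" ps] assms(2) that by auto
  have "map (\<lambda>(i, j). A i j) ps = map ext_inj ?ws"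
    using assms(2) by (auto simp: A)
  then have zero: "prod_list (map ext_inj ?ws) = 0"
    using \<open>prod_list (map (\<lambda>(i, j). A i j) ps) = 0\<close> by (simp only:)
  have "0 = alt_form ?n ?\<psi> (prod_list (map ext_inj ?ws))"
    by (simp only: zero clinearD(3)[OF alt_form_linear[OF tensor_pair(1)]])
  also have "\<dots> = (\<Sum>\<sigma> | \<sigma> permutes {1..?n}. of_int (sign \<sigma>) * (\<Prod>s\<in>{1..?n}. ?\<psi> s (?ws ! (\<sigma> s - 1))))"
    unfolding alt_form_prod[OF tensor_pair(1)] by (simp add: alt_word_def)
  also have "\<dots> = (\<Sum>\<sigma> | \<sigma> permutes {1..?n}. if \<sigma> = id then 1 else 0)"
  proof (rule sum.cong[OF refl])
    fix \<sigma> assume "\<sigma> \<in> {\<sigma>. \<sigma> permutes {1..?n}}"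
    then have \<sigma>: "\<sigma> permutes {1..?n}" by simp
    have \<sigma>s: "\<sigma> s \<in> {1..?n}" if "s \<in> {1..?n}" for s using permutes_in_image[OF \<sigma>] that by simp
    have "(\<Prod>s\<in>{1..?n}. ?\<psi> s (?ws ! (\<sigma> s - 1))) = (\<Prod>s\<in>{1..?n}. of_bool (\<sigma> s = s))"
    proof (rule prod.cong[OF refl])
      fix s assume s: "s \<in> {1..?n}"
      obtain i j where ij: "ps ! (s - 1) = (i, j)" "i \<in> {1..N}" "j \<in> {1..N}"
        using nth[OF s] by (metis mem_Sigma_iff surj_pair)
      obtain k l where kl: "ps ! (\<sigma> s - 1) = (k, l)" "k \<in> {1..N}" "l \<in> {1..N}"
        using nth[OF \<sigma>s[OF s]] by (metis mem_Sigma_iff surj_pair)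
      have len: "\<sigma> s - 1 < ?n" "s - 1 < ?n" using \<sigma>s[OF s] s by auto
      have "?ws ! (\<sigma> s - 1) = e k \<otimes>\<^sub>C e' l" using len kl(1) by simp
      then have "?\<psi> s (?ws ! (\<sigma> s - 1)) = of_bool (k = i) * of_bool (j = l)"
        by (simp only: ij(1) fst_conv snd_conv tensor_pair(2) dual[OF kl(2) ij(2)] dual[OF ij(3) kl(3)])
      also have "\<dots> = of_bool (ps ! (\<sigma> s - 1) = ps ! (s - 1))" unfolding ij(1) kl(1) by auto
      also have "ps ! (\<sigma> s - 1) = ps ! (s - 1) \<longleftrightarrow> \<sigma> s - 1 = s - 1"
        by (rule nth_eq_iff_index_eq[OF assms(1) len])
      also have "\<sigma> s - 1 = s - 1 \<longleftrightarrow> \<sigma> s = s" using \<sigma>s[OF s] s by auto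
      finally show "?\<psi> s (?ws ! (\<sigma> s - 1)) = of_bool (\<sigma> s = s)" .
    qed
    also have "\<dots> = of_bool (\<forall>s\<in>{1..?n}. \<sigma> s = s)" by (simp only: prod_of_bool finite_atLeastAtMost)
    also have "(\<forall>s\<in>{1..?n}. \<sigma> s = s) \<longleftrightarrow> \<sigma> = id"
      using permutes_not_in[OF \<sigma>] by (auto simp: fun_eq_iff)
    finally show "of_int (sign \<sigma>) * (\<Prod>s\<in>{1..?n}. ?\<psi> s (?ws ! (\<sigma> s - 1))) = (if \<sigma> = id then 1 else 0)"
      by (simp only:) simp
  qed
  also have "\<dots> = 1" by (simp add: sum.delta finite_permutations permutes_id)
  finally show False by simp
qed

lemma anticommuting_ext_inj: "(\<And>p. p \<in> S \<Longrightarrow> \<exists>w. y p = ext_inj w) \<Longrightarrow> anticommuting y S"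
  unfolding anticommuting_def using ext_inj_anticommute by metis

text \<open>The inverse of g acts on the column index and g on the row index. Grouped by rows, the
  product contributes det (inverse of g) once for each row; regrouped by columns, it contributes det
  g once for each column. The regrouping sign occurs once on the way and once on the return to
  \<open>vol\<close>, and cancels.\<close>

lemma vol_invariant: "vol \<in> GL_invariants"
  unfolding GL_invariants_def
proof (intro CollectI ballI)
  fix g :: "'v \<Rightarrow> 'v" assume g: "g \<in> GL"
  let ?F = "GL_act g" and ?G = "mat_of g" and ?H = "mat_of (inv g)" and ?U = "[1..<Suc N]"
  note F = GL_act(1)[OF g]
  have U: "set ?U = {1..N}" by auto
  define b where "b i l = (\<Sum>k\<in>{1..N}. ?G k i *\<^sub>C A k l)" for i l
  have bw: "\<exists>w. b i l = ext_inj w" if "l \<in> {1..N}" for i l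
  proof -
    have "b i l = ext_inj (\<Sum>k\<in>{1..N}. ?G k i *\<^sub>C (e k \<otimes>\<^sub>C e' l))"
      using that by (simp add: b_def clinearD(2,6)[OF ext_inj_linear] A)
    then show ?thesis by blast
  qed
  have anti_b: "anticommuting (\<lambda>l. b i l) {1..N}" for i
    by (rule anticommuting_ext_inj) (rule bw)
  have anti_b2: "anticommuting (\<lambda>(i, l). b i l) ({1..N} \<times> {1..N})"
    by (rule anticommuting_ext_inj) (auto intro!: bw)
  have anti_A: "anticommuting (\<lambda>k. A k l) {1..N}" if "l \<in> {1..N}" for l
    unfolding anticommuting_def using that by (intro ballI anti)
  have anti_A2: "anticommuting (\<lambda>(i, l). A i l) ({1..N} \<times> {1..N})"
    unfolding anticommuting_def by (auto intro!: anti)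
  have FA: "?F (A i j) = (\<Sum>l\<in>{1..N}. ?H j l *\<^sub>C b i l)" if "i \<in> {1..N}" "j \<in> {1..N}" for i j
    unfolding GL_act_A[OF g that] conj_mat_def b_def cvec.scale_sum_right scaleC_scaleC
    by (subst sum.swap) (simp add: mult.commute)
  let ?swapped = "map prod.swap all_pairs"
  have "set ?swapped = set all_pairs" by (auto simp: set_all_pairs)
  moreover have "distinct ?swapped" using distinct_all_pairs by (simp add: distinct_map)
  ultimately have "mset all_pairs = mset ?swapped"
    using distinct_all_pairs set_eq_iff_mset_eq_distinct by metis
  then obtain k where k: "\<And>y :: nat \<times> nat \<Rightarrow> ('v, 'v dual) tensor exterior.
      anticommuting y ({1..N} \<times> {1..N}) \<Longrightarrow> prod_list (map y all_pairs) = (-1) ^ k * prod_list (map y ?swapped)"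
    using prod_list_mset_eq[of all_pairs ?swapped] unfolding set_all_pairs by blast
  have swapped: "prod_list (map (\<lambda>(i, j). y i j) ?swapped) = prod_list (map (\<lambda>j. prod_list (map (\<lambda>i. y i j) ?U)) ?U)"
    for y :: "nat \<Rightarrow> nat \<Rightarrow> ('v, 'v dual) tensor exterior"
    using prod_list_product[of "\<lambda>j i. y i j" ?U ?U]
    by (simp add: all_pairs_def case_prod_unfold comp_def del: upt_Suc)
  have const: "prod_list (map (\<lambda>_. c) ?U) = c ^ N" for c :: complex
    by (simp add: map_replicate_const del: upt_Suc)
  have "?F vol = prod_list (map (\<lambda>i. prod_list (map (\<lambda>j. ?F (A i j)) ?U)) ?U)"
    unfolding vol_def all_pairs_def prod_list_product alg_homD(4)[OF F] map_map comp_def ..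
  also have "\<dots> = prod_list (map (\<lambda>i. prod_list (map (\<lambda>j. \<Sum>l\<in>{1..N}. ?H j l *\<^sub>C b i l) ?U)) ?U)"
    using FA U by (intro arg_cong[of _ _ prod_list] map_cong refl) (simp only: U)
  also have "\<dots> = prod_list (map (\<lambda>i. leibniz N ?H *\<^sub>C prod_list (map (b i) ?U)) ?U)"
    by (simp only: prod_list_linear_combination[OF anti_b])
  also have "\<dots> = (leibniz N ?H) ^ N *\<^sub>C prod_list (map (\<lambda>(i, l). b i l) all_pairs)"
    by (simp only: prod_list_scaleC const all_pairs_def prod_list_product)
  also have "prod_list (map (\<lambda>(i, l). b i l) all_pairs) = (-1) ^ k * prod_list (map (\<lambda>(i, l). b i l) ?swapped)"
    by (rule k[OF anti_b2])
  also have "prod_list (map (\<lambda>(i, l). b i l) ?swapped)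
      = prod_list (map (\<lambda>l. prod_list (map (\<lambda>i. \<Sum>k\<in>{1..N}. ?G k i *\<^sub>C A k l) ?U)) ?U)"
    unfolding swapped b_def ..
  also have "\<dots> = prod_list (map (\<lambda>l. leibniz N (\<lambda>i k. ?G k i) *\<^sub>C prod_list (map (\<lambda>k. A k l) ?U)) ?U)"
    using U by (intro arg_cong[of _ _ prod_list] map_cong refl prod_list_linear_combination[where M = "\<lambda>i k. ?G k i"] anti_A) simp
  also have "\<dots> = (leibniz N (\<lambda>i k. ?G k i)) ^ N *\<^sub>C prod_list (map (\<lambda>(i, j). A i j) ?swapped)"
    by (simp only: prod_list_scaleC const swapped)
  finally have "?F vol = (leibniz N ?H * leibniz N ?G) ^ N *\<^sub>C ((-1) ^ k * prod_list (map (\<lambda>(i, j). A i j) ?swapped))"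
    by (simp only: leibniz_transpose[of N ?G] mult_scaleC_right scaleC_scaleC power_mult_distrib)
  also have "(-1) ^ k * prod_list (map (\<lambda>(i, j). A i j) ?swapped) = vol"
    unfolding vol_def by (rule k[OF anti_A2, symmetric])
  \<comment> \<open>Substituting by G and then by its inverse in the product of the first column of
    A gives that product back, and it is nonzero; so the determinants are inverse to each other. For
    N = 0 the exponent is 0.\<close>
  also have "(leibniz N ?H * leibniz N ?G) ^ N = 1"
  proof (cases "N = 0")
    case False
    then have 1: "1 \<in> {1..N}" by simp
    define z where "z i = (\<Sum>k\<in>{1..N}. ?G k i *\<^sub>C A k 1)" for i
    have anti_z: "anticommuting z {1..N}"
      by (rule anticommuting_ext_inj) (use bw[OF 1] in \<open>simp only: z_def b_def\<close>)
    have y: "(\<Sum>i\<in>{1..N}. ?H i j *\<^sub>C z i) = A j 1" if j: "j \<in> {1..N}" for j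
    proof -
      have "(\<Sum>i\<in>{1..N}. ?H i j *\<^sub>C z i) = (\<Sum>i\<in>{1..N}. \<Sum>k\<in>{1..N}. (?G k i * ?H i j) *\<^sub>C A k 1)"
        by (simp add: z_def cvec.scale_sum_right scaleC_scaleC mult.commute)
      also have "\<dots> = (\<Sum>k\<in>{1..N}. (\<Sum>i\<in>{1..N}. ?G k i * ?H i j) *\<^sub>C A k 1)"
        unfolding cvec.scale_sum_left by (rule sum.swap)
      also have "\<dots> = (\<Sum>k\<in>{1..N}. if k = j then A k 1 else 0)"
        by (intro sum.cong refl) (subst mat_of_inverse(1)[OF g _ j], auto simp: scaleC_one)
      finally show ?thesis using j by simp
    qed
    have "prod_list (map (\<lambda>j. A j 1) ?U) = prod_list (map (\<lambda>j. \<Sum>i\<in>{1..N}. ?H i j *\<^sub>C z i) ?U)"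
      using y U by (intro arg_cong[of _ _ prod_list] map_cong refl) (simp only: U)
    also have "\<dots> = leibniz N (\<lambda>j i. ?H i j) *\<^sub>C prod_list (map z ?U)"
      by (rule prod_list_linear_combination[OF anti_z])
    also have "prod_list (map z ?U) = leibniz N (\<lambda>i k. ?G k i) *\<^sub>C prod_list (map (\<lambda>j. A j 1) ?U)"
      unfolding z_def by (rule prod_list_linear_combination[OF anti_A[OF 1]])
    finally have "(leibniz N ?H * leibniz N ?G - 1) *\<^sub>C prod_list (map (\<lambda>j. A j 1) ?U) = 0"
      by (simp only: leibniz_transpose[of N ?G] leibniz_transpose[of N ?H] scaleC_scaleC
          cvec.scale_left_diff_distrib scaleC_one diff_self)
    moreover have "prod_list (map (\<lambda>j. A j 1) ?U) \<noteq> 0"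
      using prod_list_pairs_nonzero[of "map (\<lambda>j. (j, 1)) ?U"] 1
      by (simp add: distinct_map inj_on_def comp_def image_subset_iff del: upt_Suc)
    ultimately show ?thesis by simp
  qed simp
  finally show "?F vol = vol" by (simp add: scaleC_one)
qed

lemma tr_prod_all_odds_nonzero:
  assumes "distinct ls" "set ls = {l. odd l \<and> l < 2 * N}"
  shows "tr_prod ls \<noteq> 0"
proof -
  obtain P Q where PQ: "P \<in> tuples (N * N)" "Q \<in> tuples (N * N)" "vol = monomial (N * N) P Q"
    using prod_list_pairs_monomial[of all_pairs] set_all_pairs unfolding length_all_pairs vol_def by blast
  \<comment> \<open>Passing to this component fixes the degree N * N of the permutation traces, on
    which the count in \<open>odds_nonzero\<close> depends.\<close>
  have "vol = proj (N * N) vol" unfolding PQ(3) using proj_monomial[OF PQ(1,2)] by simp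
  then have span: "vol \<in> cvec.span (perm_trace (N * N) ` {\<sigma>. \<sigma> permutes {1..N * N}})"
    using proj_invariant[OF vol_invariant, of "N * N"] by simp
  have "vol \<noteq> 0"
    unfolding vol_def using distinct_all_pairs set_all_pairs by (intro prod_list_pairs_nonzero) auto
  have "\<exists>\<sigma>. \<sigma> permutes {1..N * N} \<and> perm_trace (N * N) \<sigma> \<noteq> 0"
  proof (rule ccontr)
    assume "\<not> ?thesis"
    then have "perm_trace (N * N) ` {\<sigma>. \<sigma> permutes {1..N * N}} \<subseteq> {0}" by auto
    from cvec.span_mono[OF this] span have "vol \<in> cvec.span {0}" by (rule subsetD)
    then show False using \<open>vol \<noteq> 0\<close> by simp
  qed
  then show ?thesis using odds_nonzero assms by blast
qed

lemma span_tr_prod: "cvec.span (tr_prod ` trace_exponents) = GL_invariants"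
proof
  show "cvec.span (tr_prod ` trace_exponents) \<subseteq> GL_invariants"
  proof (rule cvec.span_minimal[OF _ subspace_invariants])
    show "tr_prod ` trace_exponents \<subseteq> GL_invariants"
      unfolding tr_prod_def using tr_invariant by (auto intro!: prod_list_invariant)
  qed
  show "GL_invariants \<subseteq> cvec.span (tr_prod ` trace_exponents)"
  proof
    fix x :: "('v, 'v dual) tensor exterior" assume "x \<in> GL_invariants"
    then have "x \<in> cvec.span {perm_trace n \<sigma> | n \<sigma>. \<sigma> permutes {1..n}}" by (rule invariant_in_span)
    moreover have "{perm_trace n \<sigma> | n \<sigma>. \<sigma> permutes {1..n}} \<subseteq> cvec.span (tr_prod ` trace_exponents)"
      using perm_trace_in_span by blast
    ultimately show "x \<in> cvec.span (tr_prod ` trace_exponents)"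
      using cvec.span_minimal[OF _ cvec.subspace_span] by blast
  qed
qed

section \<open>Twisted immanants as multiples of products of traces\<close>

text \<open>The signs of \<open>\<chi>\<^sup>*\<close> and of the reordering of the anticommuting entries cancel.\<close>

lemma twisted_char_perm_trace:
  assumes "self_conjugate lam" "\<sigma> permutes {1..sum_list lam}"
  shows "twisted_char lam \<sigma> *\<^sub>C perm_trace (sum_list lam) \<sigma>
    = (if \<exists>cs. cycle_notation (sum_list lam) (diag_hooks lam) \<sigma> cs
       then (\<i> ^ ((sum_list lam - diag_rank lam) div 2) * complex_of_real (sqrt (real (prod_list (diag_hooks lam)))))
         *\<^sub>C tr_prod (diag_hooks lam) else 0)"
proof (cases "\<exists>cs. cycle_notation (sum_list lam) (diag_hooks lam) \<sigma> cs")
  case True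
  let ?n = "sum_list lam" and ?mu = "diag_hooks lam"
  define cs where "cs = (SOME cs. cycle_notation ?n ?mu \<sigma> cs)"
  have "cycle_notation ?n ?mu \<sigma> cs" unfolding cs_def using True by (rule someI_ex)
  then have cs: "map length cs = ?mu" "distinct (concat cs)" "set (concat cs) = {1..?n}" "\<sigma> = prod_of_cycles cs"
    unfolding cycle_notation_def prod_of_cycles_def by blast+
  have "0 \<notin> set ?mu" using diag_hooks_odd_decreasing(1)[OF assms(1)] by (auto simp: odd_decreasing_def)
  then have "[] \<notin> set cs" unfolding cs(1)[symmetric] by force
  then have "perm_trace ?n \<sigma> = (-1) ^ inversions (concat cs) * tr_prod ?mu"
    unfolding cs(4) using perm_trace_cycles[OF cs(2,3)] by (simp add: tr_prod_def comp_def flip: cs(1))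
  moreover have "cycle_sign ?n ?mu \<sigma> = (-1) ^ inversions (concat cs)"
    unfolding cycle_sign_def cs_def by simp
  ultimately show ?thesis using True
    by (simp add: twisted_char_def Let_def minus_one_power_mult_scaleC scaleC_scaleC)
next
  case False
  then show ?thesis by (simp only: twisted_char_def Let_def if_False cvec.scale_zero_left)
qed

text \<open>The list 1, ..., n is cut into consecutive blocks of the prescribed lengths.\<close>

lemma cycle_notation_exists:
  assumes "sum_list mu = n"
  shows "\<exists>\<sigma> cs. \<sigma> permutes {1..n} \<and> cycle_notation n mu \<sigma> cs"
proof -
  obtain cs where cs: "map length cs = mu" "concat cs = [1..<Suc n]"
    using split_into_lengths[of "[1..<Suc n]" mu] assms by (auto simp del: upt_Suc)
  then have set: "set (concat cs) = {1..n}" "distinct (concat cs)" by auto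
  have "prod_of_cycles cs permutes {1..n}" using prod_of_cycles_permutes[of cs] unfolding set(1) .
  moreover have "cycle_notation n mu (prod_of_cycles cs) cs"
    unfolding cycle_notation_def prod_of_cycles_def using cs(1) set by blast
  ultimately show ?thesis by blast
qed

text \<open>Once the signs have cancelled, all permutations of cycle type \<open>?mu\<close>
  contribute the same term, so C is their number times \<open>?K\<close> / n!. It is nonzero because
  such permutations exist and the parts of \<open>?mu\<close>, being odd, are positive.\<close>

lemma twisted_imm_sum_tr_prod:
  assumes "self_conjugate lam"
  shows "\<exists>C. C \<noteq> 0 \<and> twisted_imm_sum N lam A = C *\<^sub>C tr_prod (diag_hooks lam)"
proof -
  let ?n = "sum_list lam" and ?mu = "diag_hooks lam"
  let ?K = "\<i> ^ ((?n - diag_rank lam) div 2) * complex_of_real (sqrt (real (prod_list ?mu)))"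
  let ?S = "{\<sigma>. \<sigma> permutes {1..?n} \<and> (\<exists>cs. cycle_notation ?n ?mu \<sigma> cs)}"
  have "twisted_imm_sum N lam A = (1 / fact ?n) *\<^sub>C (\<Sum>\<sigma> | \<sigma> permutes {1..?n}. twisted_char lam \<sigma> *\<^sub>C perm_trace ?n \<sigma>)"
    unfolding twisted_imm_sum_def twisted_imm_def Let_def perm_trace_def cvec.scale_sum_right
    by (rule sum.swap)
  also have "(\<Sum>\<sigma> | \<sigma> permutes {1..?n}. twisted_char lam \<sigma> *\<^sub>C perm_trace ?n \<sigma>) = (\<Sum>\<sigma>\<in>?S. ?K *\<^sub>C tr_prod ?mu)"
  proof -
    have "(\<Sum>\<sigma> | \<sigma> permutes {1..?n}. twisted_char lam \<sigma> *\<^sub>C perm_trace ?n \<sigma>)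
        = (\<Sum>\<sigma> | \<sigma> permutes {1..?n}. if \<exists>cs. cycle_notation ?n ?mu \<sigma> cs then ?K *\<^sub>C tr_prod ?mu else 0)"
      using twisted_char_perm_trace[OF assms] by (intro sum.cong refl) blast
    also have "\<dots> = (\<Sum>\<sigma>\<in>?S. ?K *\<^sub>C tr_prod ?mu)"
      by (intro sum.mono_neutral_cong_right finite_permutations) auto
    finally show ?thesis .
  qed
  also have "\<dots> = of_nat (card ?S) *\<^sub>C ?K *\<^sub>C tr_prod ?mu"
    by (simp only: sum_constant of_nat_mult_scaleC)
  finally have eq: "twisted_imm_sum N lam A = (1 / fact ?n * (of_nat (card ?S) * ?K)) *\<^sub>C tr_prod ?mu"
    by (simp only: scaleC_scaleC)
  have "?S \<noteq> {}" using cycle_notation_exists[OF sum_list_diag_hooks[OF assms]] by blast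
  moreover have "finite ?S" by (rule finite_subset[OF _ finite_permutations[of "{1..?n}"]]) auto
  ultimately have "card ?S \<noteq> 0" by simp
  moreover have "prod_list ?mu \<noteq> 0"
    using diag_hooks_odd_decreasing(1)[OF assms] by (auto simp: prod_list_zero_iff odd_decreasing_def)
  ultimately have "1 / fact ?n * (of_nat (card ?S) * ?K) \<noteq> 0" by simp
  with eq show ?thesis by blast
qed

end

theorem theorem1p3:
  fixes e :: "nat \<Rightarrow> 'v::complex_vector" and e' :: "nat \<Rightarrow> 'v dual" and N :: nat
    and A :: "nat \<Rightarrow> nat \<Rightarrow> ('v, 'v dual) tensor exterior"
    and Lam :: "nat list set"
  assumes basis: "inj_on e {1..N}" "cvec.independent (e ` {1..N})" "cvec.span (e ` {1..N}) = UNIV"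
    and dual_basis: "\<forall>i\<in>{1..N}. \<forall>j\<in>{1..N}. dual_apply (e' j) (e i) = (if i = j then 1 else 0)"
    and A: "\<forall>i\<in>{1..N}. \<forall>j\<in>{1..N}. A i j = ext_inj (e i \<otimes>\<^sub>C e' j)"
    and Lam: "Lam = {lam. self_conjugate lam \<and> first_part lam \<le> N}"
  shows "inj_on (\<lambda>lam. twisted_imm_sum N lam A) Lam
    \<and> cvec.independent ((\<lambda>lam. twisted_imm_sum N lam A) ` Lam)
    \<and> cvec.span ((\<lambda>lam. twisted_imm_sum N lam A) ` Lam) = GL_invariants"
proof -
  interpret matrix_units e e' N A
    by unfold_locales (use basis dual_basis A in auto)
  have bij: "bij_betw diag_hooks Lam trace_exponents"
    unfolding bij_betw_def Lam trace_exponents_def using diag_hooks_image diag_hooks_inj by (auto simp: inj_on_def)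
  have "\<forall>lam\<in>Lam. \<exists>C. C \<noteq> 0 \<and> twisted_imm_sum N lam A = C *\<^sub>C tr_prod (diag_hooks lam)"
    using twisted_imm_sum_tr_prod unfolding Lam by blast
  then obtain C where C: "\<And>lam. lam \<in> Lam \<Longrightarrow> C lam \<noteq> 0"
    "\<And>lam. lam \<in> Lam \<Longrightarrow> twisted_imm_sum N lam A = C lam *\<^sub>C tr_prod (diag_hooks lam)"
    by metis
  let ?f = "\<lambda>lam. twisted_imm_sum N lam A"
  have ind: "inj_on ?f Lam \<and> cvec.independent (?f ` Lam)"
  proof (rule independent_family)
    show "finite Lam" using bij_betw_finite[OF bij] finite_trace_exponents by simp
    fix c lam assume zero: "(\<Sum>lam\<in>Lam. c lam *\<^sub>C ?f lam) = 0" and lam: "lam \<in> Lam"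
    \<comment> \<open>The coefficient of \<open>tr_prod mu\<close> in the given relation, carried
      along the inverse of the bijection and including the factor C.\<close>
    let ?d = "\<lambda>mu. c (the_inv_into Lam diag_hooks mu) * C (the_inv_into Lam diag_hooks mu)"
    have inv: "the_inv_into Lam diag_hooks (diag_hooks lam) = lam" if "lam \<in> Lam" for lam
      using bij that by (simp add: bij_betw_def the_inv_into_f_f)
    have "(\<Sum>mu\<in>trace_exponents. ?d mu *\<^sub>C tr_prod mu) = (\<Sum>lam\<in>Lam. ?d (diag_hooks lam) *\<^sub>C tr_prod (diag_hooks lam))"
      by (rule sum.reindex_bij_betw[OF bij, symmetric])
    also have "\<dots> = (\<Sum>lam\<in>Lam. c lam *\<^sub>C ?f lam)"
      by (intro sum.cong refl) (simp add: inv C(2) scaleC_scaleC)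
    finally have "(\<Sum>mu\<in>trace_exponents. ?d mu *\<^sub>C tr_prod mu) = 0" using zero by simp
    from tr_prod_independent[OF tr_prod_all_odds_nonzero finite_trace_exponents this bij_betwE[OF bij, rule_format, OF lam]]
    show "c lam = 0" using inv[OF lam] C(1)[OF lam] by simp
  qed
  have "cvec.span (?f ` Lam) = cvec.span (tr_prod ` trace_exponents)"
  proof (rule antisym; rule cvec.span_minimal[OF _ cvec.subspace_span]; rule image_subsetI)
    fix lam assume "lam \<in> Lam"
    then show "?f lam \<in> cvec.span (tr_prod ` trace_exponents)"
      using bij_betwE[OF bij] by (simp add: C(2) cvec.span_scale cvec.span_base)
  next
    fix mu assume "mu \<in> trace_exponents"
    then obtain lam where lam: "lam \<in> Lam" "mu = diag_hooks lam" using bij by (auto simp: bij_betw_def)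
    then have "tr_prod mu = (1 / C lam) *\<^sub>C ?f lam" using C by (simp add: scaleC_scaleC scaleC_one)
    then show "tr_prod mu \<in> cvec.span (?f ` Lam)"
      using lam(1) by (simp add: cvec.span_scale cvec.span_base)
  qed
  with ind span_tr_prod show ?thesis by simp
qed

end
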